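(* Let $X$ be a hyperbolic Riemann surface. Then: (a) $X$ is conformally equivalent to $\mathbb{D}$ if and only if $\mathcal{A}(X)\simeq\mathcal{A}(\mathbb{D})$. (b) $X$ is conformally equivalent to some annulus $A_R=\{z\in\mathbb{C}:1/R<|z|<R\}$, $R>1$, if and only if $\mathcal{A}(X)\simeq\mathcal{A}(A_R)$ for some $R>1$. In this case $\mathcal{A}(X)\simeq\mathcal{A}(A_{R})$ for every $R>1$. (c) $X$ is conformally equivalent to the punctured disk $\mathbb{D}^*=\mathbb{D}\setminus\{0\}$ if and only if $\mathcal{A}(X)\simeq\mathcal{A}(\mathbb{D}^* )$. (d) If $X$ is not conformally equivalent to $\mathbb{D}$, to $\mathbb{D}^*$, or to any annulus $A_R$ ($R>1$), then $\mathcal{A}(X)$ consists only of constant functions.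
   Context: Notation: $\mathbb{D}=\{z\in\mathbb{C}:|z|<1\}$, $\hat{\mathbb{C}}=\mathbb{C}\cup\{\infty\}$. For a complex manifold $M$, $\mathcal{H}(M)$ is the Fréchet space of holomorphic functions on $M$ with the topology of locally uniform convergence. Let $\Omega:=\hat{\mathbb{C}}^2\setminus\big(\{(z,w)\in\mathbb{C}^2: zw=1\}\cup\{(0,\infty)\}\cup\{(\infty,0)\}\big)$. The space $\mathcal{A}(\mathbb{D})$: the set of all $f:\mathbb{D}\to\mathbb{C}$ for which there is $F\in\mathcal{H}(\Omega)$ with $f(z)=F(z,\bar z)$ for all $z\in\mathbb{D}$ (such $F$ is unique); it carries the topology transported from $\mathcal{H}(\Omega)$ via $f\mapsto F$. Deformation parameter: $\hbar\in\mathscr{D}:=\mathbb{C}\setminus\{0,-1,-1/2,-1/3,\dots\}$; $c_0(\hbar)=1$ and $c_n(\hbar)=\hbar^n/\prod_{j=0}^{n-1}(1+j\hbar)$ for $n\ge1$. Peschl–Minda derivatives: for $z\in\mathbb{D}$ let $T_z(u)=(z+u)/(1+\bar z u)$; with $\partial=\frac12(\partial_x-i\partial_y)$ the Wirtinger derivative, for smooth $f:\mathbb{D}\to\mathbb{C}$ set $D^nf(z):=\partial_u^n(f\circ T_z)(0)$ and $\overline{D}^nf(z):=\overline{D^n(\bar f)(z)}$. Star product on $\mathbb{D}$: for $f,\tilde f\in\mathcal{A}(\mathbb{D})$ and $\hbar\in\mathscr{D}$, $(f\star_{\mathbb{D},\hbar}\tilde f)(z)=\sum_{n=0}^\infty\frac{c_n(\hbar)}{n!}\,\overline{D}^nf(z)\,D^n\tilde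 f(z)$; this series converges in $\mathcal{A}(\mathbb{D})$ and makes $(\mathcal{A}(\mathbb{D}),\star_{\mathbb{D},\hbar})$ a Fréchet algebra; it satisfies $(f\circ\varphi)\star_{\mathbb{D},\hbar}(g\circ\varphi)=(f\star_{\mathbb{D},\hbar}g)\circ\varphi$ for conformal automorphisms $\varphi$ of $\mathbb{D}$. Transfer to Riemann surfaces: a Riemann surface $X$ is hyperbolic if its universal cover is $\mathbb{D}$. For a universal covering $\pi:\mathbb{D}\to X$, $\mathcal{A}(X):=\{f:X\to\mathbb{C}: f\circ\pi\in\mathcal{A}(\mathbb{D})\}$, $f\star_{X,\hbar}g$ is defined by $(f\star_{X,\hbar}g)\circ\pi=(f\circ\pi)\star_{\mathbb{D},\hbar}(g\circ\pi)$, and $f_n\to f$ in $\mathcal{A}(X)$ iff $f_n\circ\pi\to f\circ\pi$ in $\mathcal{A}(\mathbb{D})$. These do not depend on the choice of $\pi$, and $(\mathcal{A}(X),\star_{X,\hbar})$ is a Fréchet algebra. A Fréchet algebra isomorphism is a linear bijection that is multiplicative and a homeomorphism. $\mathcal{A}(X)$ and $\mathcal{A}(Y)$ are strongly isomorphic, written $\mathcal{A}(X)\simeq\mathcal{A}(Y)$, if there is one map $T:\mathcal{A}(X)\to\mathcal{A}(Y)$ that is a Fréchet algebra isomorphism $(\mathcal{A}(X),\star_{X,\hbar})\to(\mathcal{A}(Y),\star_{Y,\hbar})$ for every $\hbar\in\mathscr{D}$. *)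

theory Defs
  imports "HOL-Analysis.Analysis"
begin

definition unit_disk :: "complex set" where
  "unit_disk = ball 0 1"

definition punct_disk :: "complex set" where
  "punct_disk = ball 0 1 - {0}"

definition annulus :: "real \<Rightarrow> complex set" where
  "annulus R = {z. 1 / R < norm z \<and> norm z < R}"

text \<open>Omega is covered by four affine charts of the product of two Riemann spheres:
  chart 0: (z,w) itself; chart 1: (s,w) with z = 1/s; chart 2: (z,t) with w = 1/t;
  chart 3: (s,t) with z = 1/s, w = 1/t.  In these coordinates Omega becomes
  {zw \<noteq> 1}, {s \<noteq> w}, {z \<noteq> t}, {st \<noteq> 1} respectively (the excluded points
  (0,\<infinity>) and (\<infinity>,0) are exactly those that would lie on the diagonal in charts 1,2).\<close>

definition chart_dom :: "nat \<Rightarrow> (complex \<times> complex) set" where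
  "chart_dom i =
     (if i = 0 then {p. fst p * snd p \<noteq> 1}
      else if i = 1 then {p. fst p \<noteq> snd p}
      else if i = 2 then {p. fst p \<noteq> snd p}
      else {p. fst p * snd p \<noteq> 1})"

definition chart_to0 :: "nat \<Rightarrow> complex \<times> complex \<Rightarrow> complex \<times> complex" where
  "chart_to0 i p =
     (if i = 0 then p
      else if i = 1 then (inverse (fst p), snd p)
      else if i = 2 then (fst p, inverse (snd p))
      else (inverse (fst p), inverse (snd p)))"

definition chart_ok :: "nat \<Rightarrow> complex \<times> complex \<Rightarrow> bool" where
  "chart_ok i p =
     (if i = 0 then True
      else if i = 1 then fst p \<noteq> 0
      else if i = 2 then snd p \<noteq> 0
      else fst p \<noteq> 0 \<and> snd p \<noteq> 0)"

text \<open>Holomorphy on an open subset of C^2: continuous and holomorphic in each variable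
  separately (equivalent to the usual definition by Osgood's lemma).\<close>
definition holomorphic2_on :: "(complex \<times> complex \<Rightarrow> complex) \<Rightarrow> (complex \<times> complex) set \<Rightarrow> bool" where
  "holomorphic2_on G U \<longleftrightarrow> open U \<and> continuous_on U G \<and>
     (\<forall>z w. (z, w) \<in> U \<longrightarrow>
        (\<lambda>z'. G (z', w)) field_differentiable (at z) \<and>
        (\<lambda>w'. G (z, w')) field_differentiable (at w))"

definition hol_Omega :: "(nat \<Rightarrow> complex \<times> complex \<Rightarrow> complex) \<Rightarrow> bool" where
  "hol_Omega Fs \<longleftrightarrow>
     (\<forall>i<4. holomorphic2_on (Fs i) (chart_dom i) \<and>
        (\<forall>p \<in> chart_dom i. chart_ok i p \<longrightarrow> Fs i p = Fs 0 (chart_to0 i p)))"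

definition A_disk :: "(complex \<Rightarrow> complex) set" where
  "A_disk = {f. (\<forall>z. z \<notin> unit_disk \<longrightarrow> f z = 0) \<and>
               (\<exists>Fs. hol_Omega Fs \<and> (\<forall>z \<in> unit_disk. f z = Fs 0 (z, cnj z)))}"

definition Omega_rep :: "(complex \<Rightarrow> complex) \<Rightarrow> nat \<Rightarrow> complex \<times> complex \<Rightarrow> complex" where
  "Omega_rep f = (SOME Fs. hol_Omega Fs \<and> (\<forall>z \<in> unit_disk. f z = Fs 0 (z, cnj z)))"

text \<open>Topology of locally uniform convergence on Omega transported to A(D): basic
  neighbourhoods are given by finitely many compact sets (one in each chart domain; every compact
  subset of Omega is a union of such) and a radius.\<close>
definition A_disk_topology :: "(complex \<Rightarrow> complex) topology" where
  "A_disk_topology = topology_generated_by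
     {{g \<in> A_disk. \<forall>i<4. \<forall>p \<in> K i. norm (Omega_rep g i p - Omega_rep f i p) < e}
       | f K e. f \<in> A_disk \<and> e > 0 \<and> (\<forall>i<4. compact (K i) \<and> K i \<subseteq> chart_dom i)}"

definition disk_aut :: "complex \<Rightarrow> complex \<Rightarrow> complex" where
  "disk_aut z u = (z + u) / (1 + cnj z * u)"

definition wirtinger :: "(complex \<Rightarrow> complex) \<Rightarrow> complex \<Rightarrow> complex" where
  "wirtinger g u =
     (vector_derivative (\<lambda>t::real. g (u + of_real t)) (at 0)
      - \<i> * vector_derivative (\<lambda>t::real. g (u + \<i> * of_real t)) (at 0)) / 2"

definition PM_D :: "nat \<Rightarrow> (complex \<Rightarrow> complex) \<Rightarrow> complex \<Rightarrow> complex" where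
  "PM_D n f z = (wirtinger ^^ n) (\<lambda>u. f (disk_aut z u)) 0"

definition PM_Dbar :: "nat \<Rightarrow> (complex \<Rightarrow> complex) \<Rightarrow> complex \<Rightarrow> complex" where
  "PM_Dbar n f z = cnj (PM_D n (\<lambda>x. cnj (f x)) z)"

definition hbar_dom :: "complex set" where
  "hbar_dom = {h. h \<noteq> 0 \<and> (\<forall>n::nat. h \<noteq> - 1 / of_nat (Suc n))}"

definition cc :: "nat \<Rightarrow> complex \<Rightarrow> complex" where
  "cc n h = h ^ n / (\<Prod>j<n. 1 + of_nat j * h)"

definition star_disk :: "complex \<Rightarrow> (complex \<Rightarrow> complex) \<Rightarrow> (complex \<Rightarrow> complex) \<Rightarrow> complex \<Rightarrow> complex" where
  "star_disk h f g = (\<lambda>z. if z \<in> unit_disk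
      then (\<Sum>n. cc n h / fact n * PM_Dbar n f z * PM_D n g z) else 0)"

definition riemann_surface :: "'a topology \<Rightarrow> ('a set \<times> ('a \<Rightarrow> complex)) set \<Rightarrow> bool" where
  "riemann_surface X atlas \<longleftrightarrow>
     Hausdorff_space X \<and> connected_space X \<and> topspace X \<noteq> {} \<and>
     (\<Union>(fst ` atlas) = topspace X) \<and>
     (\<forall>(U, \<phi>) \<in> atlas. openin X U \<and> open (\<phi> ` U) \<and>
          homeomorphic_map (subtopology X U) (top_of_set (\<phi> ` U)) \<phi>) \<and>
     (\<forall>(U, \<phi>) \<in> atlas. \<forall>(V, \<psi>) \<in> atlas.
          (\<psi> \<circ> inv_into U \<phi>) holomorphic_on (\<phi> ` (U \<inter> V)))"

definition std_atlas :: "complex set \<Rightarrow> (complex set \<times> (complex \<Rightarrow> complex)) set" where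
  "std_atlas S = {(S, id)}"

definition hol_into :: "'a topology \<Rightarrow> ('a set \<times> ('a \<Rightarrow> complex)) set \<Rightarrow> complex set \<Rightarrow> (complex \<Rightarrow> 'a) \<Rightarrow> bool" where
  "hol_into X atlas S h \<longleftrightarrow> continuous_map (top_of_set S) X h \<and>
     (\<forall>(U, \<phi>) \<in> atlas. (\<phi> \<circ> h) holomorphic_on (S \<inter> h -` U))"

definition hol_from :: "'a topology \<Rightarrow> ('a set \<times> ('a \<Rightarrow> complex)) set \<Rightarrow> ('a \<Rightarrow> complex) \<Rightarrow> bool" where
  "hol_from X atlas g \<longleftrightarrow> (\<forall>(U, \<phi>) \<in> atlas. (g \<circ> inv_into U \<phi>) holomorphic_on (\<phi> ` U))"

definition covering_map_onto :: "complex set \<Rightarrow> 'a topology \<Rightarrow> (complex \<Rightarrow> 'a) \<Rightarrow> bool" where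
  "covering_map_onto S X p \<longleftrightarrow> continuous_map (top_of_set S) X p \<and> p ` S = topspace X \<and>
     (\<forall>x \<in> topspace X. \<exists>U. openin X U \<and> x \<in> U \<and>
        (\<exists>\<V>. \<Union>\<V> = S \<inter> p -` U \<and> (\<forall>V \<in> \<V>. open V) \<and> pairwise disjnt \<V> \<and>
             (\<forall>V \<in> \<V>. homeomorphic_map (top_of_set V) (subtopology X U) p)))"

text \<open>Holomorphic universal covering by the disk (D is simply connected, so any covering
  map from D is a universal covering).\<close>
definition disk_universal_covering :: "'a topology \<Rightarrow> ('a set \<times> ('a \<Rightarrow> complex)) set \<Rightarrow> (complex \<Rightarrow> 'a) \<Rightarrow> bool" where
  "disk_universal_covering X atlas p \<longleftrightarrow>
     covering_map_onto unit_disk X p \<and> hol_into X atlas unit_disk p"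

definition hyperbolic_RS :: "'a topology \<Rightarrow> ('a set \<times> ('a \<Rightarrow> complex)) set \<Rightarrow> bool" where
  "hyperbolic_RS X atlas \<longleftrightarrow> riemann_surface X atlas \<and> (\<exists>p. disk_universal_covering X atlas p)"

definition ucov :: "'a topology \<Rightarrow> ('a set \<times> ('a \<Rightarrow> complex)) set \<Rightarrow> complex \<Rightarrow> 'a" where
  "ucov X atlas = (SOME p. disk_universal_covering X atlas p)"

definition lift :: "'a topology \<Rightarrow> ('a set \<times> ('a \<Rightarrow> complex)) set \<Rightarrow> ('a \<Rightarrow> complex) \<Rightarrow> complex \<Rightarrow> complex" where
  "lift X atlas f = (\<lambda>z. if z \<in> unit_disk then f (ucov X atlas z) else 0)"

definition A_RS :: "'a topology \<Rightarrow> ('a set \<times> ('a \<Rightarrow> complex)) set \<Rightarrow> ('a \<Rightarrow> complex) set" where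
  "A_RS X atlas = {f. (\<forall>x. x \<notin> topspace X \<longrightarrow> f x = 0) \<and> lift X atlas f \<in> A_disk}"

definition star_RS :: "'a topology \<Rightarrow> ('a set \<times> ('a \<Rightarrow> complex)) set \<Rightarrow> complex \<Rightarrow>
    ('a \<Rightarrow> complex) \<Rightarrow> ('a \<Rightarrow> complex) \<Rightarrow> 'a \<Rightarrow> complex" where
  "star_RS X atlas h f g = (\<lambda>x. if x \<in> topspace X then
      star_disk h (lift X atlas f) (lift X atlas g)
        (SOME z. z \<in> unit_disk \<and> ucov X atlas z = x) else 0)"

definition A_RS_topology :: "'a topology \<Rightarrow> ('a set \<times> ('a \<Rightarrow> complex)) set \<Rightarrow> ('a \<Rightarrow> complex) topology" where
  "A_RS_topology X atlas = pullback_topology (A_RS X atlas) (lift X atlas) A_disk_topology"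

definition strongly_iso ::
  "'a topology \<Rightarrow> ('a set \<times> ('a \<Rightarrow> complex)) set \<Rightarrow>
   'b topology \<Rightarrow> ('b set \<times> ('b \<Rightarrow> complex)) set \<Rightarrow> bool" where
  "strongly_iso X ax Y ay \<longleftrightarrow> (\<exists>T.
     bij_betw T (A_RS X ax) (A_RS Y ay) \<and>
     (\<forall>f \<in> A_RS X ax. \<forall>g \<in> A_RS X ax. \<forall>a b.
        T (\<lambda>x. a * f x + b * g x) = (\<lambda>y. a * T f y + b * T g y)) \<and>
     (\<forall>h \<in> hbar_dom. \<forall>f \<in> A_RS X ax. \<forall>g \<in> A_RS X ax.
        T (star_RS X ax h f g) = star_RS Y ay h (T f) (T g)) \<and>
     homeomorphic_map (A_RS_topology X ax) (A_RS_topology Y ay) T)"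

abbreviation strongly_iso_dom :: "'a topology \<Rightarrow> ('a set \<times> ('a \<Rightarrow> complex)) set \<Rightarrow> complex set \<Rightarrow> bool" where
  "strongly_iso_dom X ax S \<equiv> strongly_iso X ax (top_of_set S) (std_atlas S)"

definition conf_equiv :: "'a topology \<Rightarrow> ('a set \<times> ('a \<Rightarrow> complex)) set \<Rightarrow> complex set \<Rightarrow> bool" where
  "conf_equiv X atlas S \<longleftrightarrow> (\<exists>h. homeomorphic_map X (top_of_set S) h \<and>
      hol_from X atlas h \<and> hol_into X atlas S (inv_into (topspace X) h))"

end

theory Submission
  imports Defs "HOL-Complex_Analysis.Complex_Analysis"
begin

text \<open>A function invariant under infinitely many deck transformations extends holomorphically to \<open>\<Omega>\<close> only if it
  factors as \<open>E \<circ> r\<close>, with \<open>E\<close> entire and \<open>r\<close> the moment map of the one-parameter group through a deck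
  transformation: at a fixed \<open>w\<close>, the orbit of the origin accumulates inside the domain of \<open>F(\<sqdot>, w)\<close>. Two
  deck transformations from different one-parameter groups leave only the constants; otherwise the deck group is
  trivial or cyclic and the surface is the disk, the punctured disk or an annulus. On functions
  \<open>E \<circ> r\<close> the star product only depends on the value \<open>\<delta>\<close> of the Casimir \<open>|b|\<^sup>2 - a\<^sup>2\<close> (\<open>\<delta> = 0\<close> for the punctured
  disk, \<open>\<delta> = 1\<close> for every annulus), hence \<open>E \<circ> r \<mapsto> E \<circ> r'\<close> is a strong isomorphism whenever the values of \<open>\<delta>\<close> agree.

  Conversely, the algebra is noncommutative for the disk only, and the values of \<open>\<delta>\<close> are told apart by the relation
  \<open>3 f \<star>\<^sub>1 f - 4 f \<star>\<^sub>1\<^sub>/\<^sub>2 f = \<kappa> f\<close>: for \<open>\<delta> = 1\<close> it has the solutions \<open>f = r \<plusminus> \<i>\<close> with \<open>\<kappa> = \<mp> 2\<i>\<close>,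
  for \<open>\<delta> = 0\<close> and \<open>\<kappa> \<noteq> 0\<close> only constant ones.\<close>

section \<open>Functions on the bidisk and their antidiagonal\<close>

text \<open>Two facts reduce the star product to one variable. Along \<open>disk_aut z\<close> the
  moment map \<open>r\<close> is affine, so the \<open>n\<close>-th invariant derivative of
  \<open>E \<circ> r\<close> is \<open>(D r)^n\<close> times the \<open>n\<close>-th derivative of
  \<open>E\<close>; and \<open>|D r|^2 = r^2 + \<delta>\<close>. The coefficients of the relation
  come from \<open>E = t + c\<close>: only the terms \<open>n = 0, 1\<close> survive, with weights 1
  and \<open>h\<close>, and \<open>3\<close>, \<open>-4\<close> leave
  \<open>- (t + c)^2 + (t^2 + \<delta>)\<close>. The squares of \<open>t\<close> cancel, and the
  rest equals \<open>\<kappa> (t + c)\<close> exactly when \<open>\<kappa> = - 2 c\<close> and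
  \<open>c^2 = - \<delta>\<close>. The definition of a strong isomorphism does not mention the unit,
  so "not constant" cannot be transported directly. Two linearly independent solutions, one for each
  sign of \<open>\<kappa>\<close>, take its place: constants span only a line. The modulus of an
  annulus is lost because it sits in the length of the generating deck transformation, while the
  invariant functions only see the one-parameter group through it.\<close>

lemma holomorphic2_on_slice1:
  assumes "holomorphic2_on G U"
  shows "(\<lambda>x. G (x, w)) holomorphic_on {x. (x, w) \<in> U}"
  using assms unfolding holomorphic2_on_def holomorphic_on_def
  by (auto intro: field_differentiable_at_within)

lemma holomorphic2_on_slice2:
  assumes "holomorphic2_on G U"
  shows "(\<lambda>w. G (x, w)) holomorphic_on {w. (x, w) \<in> U}"
  using assms unfolding holomorphic2_on_def holomorphic_on_def
  by (auto intro: field_differentiable_at_within)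

lemma holomorphic2_on_subset:
  assumes "holomorphic2_on G U" "open V" "V \<subseteq> U"
  shows "holomorphic2_on G V"
  using assms unfolding holomorphic2_on_def by (meson continuous_on_subset subsetD)

lemma holomorphic2_on_swap:
  assumes "holomorphic2_on G U"
  shows "holomorphic2_on (\<lambda>p. G (snd p, fst p)) {p. (snd p, fst p) \<in> U}"
proof -
  have c: "continuous_on UNIV (\<lambda>p::complex \<times> complex. (snd p, fst p))"
    by (intro continuous_intros)
  have o: "open ((\<lambda>p. (snd p, fst p)) -` U)"
    using assms c unfolding holomorphic2_on_def by (intro open_vimage) auto
  have "continuous_on {p. (snd p, fst p) \<in> U} (\<lambda>p. G (snd p, fst p))"
    by (rule continuous_on_compose2[of U G])
       (use assms in \<open>auto simp: holomorphic2_on_def intro!: continuous_intros\<close>)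
  with o assms show ?thesis
    unfolding holomorphic2_on_def by (auto simp: vimage_def)
qed

lemma open_contains_bidisc:
  fixes p :: "complex \<times> complex"
  assumes "open U" "p \<in> U"
  obtains r where "r > 0" "cball (fst p) r \<times> cball (snd p) r \<subseteq> U"
proof -
  obtain A B where AB: "open A" "open B" "p \<in> A \<times> B" "A \<times> B \<subseteq> U"
    using open_prod_elim[OF assms] by blast
  obtain a b where "a > 0" "cball (fst p) a \<subseteq> A" "b > 0" "cball (snd p) b \<subseteq> B"
    using AB open_contains_cball by (metis mem_Times_iff)
  then show ?thesis
    using AB by (intro that[of "min a b"]) (auto simp: subset_iff)
qed

text \<open>Taylor's formula, with Cauchy's inequality for the second derivative on circles of
  radius \<open>r / 2\<close>; hence \<open>8 M / r^2 = 2! M / (r / 2)^2\<close>. The bound depends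
  on \<open>f\<close> only through \<open>M\<close>, so it is uniform in a parameter of
  \<open>f\<close>.\<close>

lemma difference_quotient_bound:
  assumes f: "f holomorphic_on ball x0 (3 * r)" and "r > 0"
    and M: "\<And>y. y \<in> ball x0 (3 * r) \<Longrightarrow> norm (f y) \<le> M"
    and x: "x \<in> ball x0 r" and h: "h \<noteq> 0" "norm h \<le> r / 2"
  shows "norm ((f (x + h) - f x) / h - deriv f x) \<le> 8 * M / r\<^sup>2 * norm h"
proof -
  let ?S = "cball x (norm h)"
  have S: "y \<in> ball x0 (2 * r)" if "y \<in> ?S" for y
    using that x h \<open>r > 0\<close> dist_triangle[of x0 y x] by (auto)
  have M0: "0 \<le> M"
    using M[of x0] \<open>r > 0\<close> by (meson centre_in_ball mult_pos_pos norm_ge_zero order.trans zero_less_numeral)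
  have B: "norm ((deriv ^^ Suc 1) f y) \<le> 8 * M / r\<^sup>2" if "y \<in> ?S" for y
  proof -
    have sub: "cball y (r/2) \<subseteq> ball x0 (3 * r)"
    proof
      fix z assume "z \<in> cball y (r/2)"
      then show "z \<in> ball x0 (3 * r)"
        using S[OF that] dist_triangle[of x0 z y] \<open>r > 0\<close> by auto
    qed
    have "norm ((deriv ^^ 2) f y) \<le> fact 2 * M / (r/2) ^ 2"
    proof (rule Cauchy_inequality)
      show "f holomorphic_on ball y (r/2)"
        using f sub ball_subset_cball holomorphic_on_subset by blast
      show "continuous_on (cball y (r/2)) f"
        using f sub holomorphic_on_imp_continuous_on holomorphic_on_subset by blast
      show "norm (f z) \<le> M" if "norm (y - z) = r/2" for z
        using that sub by (intro M) (auto simp: dist_norm subset_iff)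
    qed (use \<open>r > 0\<close> in auto)
    also have "\<dots> = 8 * M / r\<^sup>2" by (simp add: power2_eq_square)
    finally show ?thesis by (simp add: numeral_2_eq_2)
  qed
  have D: "((deriv ^^ i) f has_field_derivative (deriv ^^ Suc i) f y) (at y within ?S)" if "y \<in> ?S" for i y
  proof -
    have "(deriv ^^ i) f holomorphic_on ball x0 (3 * r)"
      using f holomorphic_higher_deriv by blast
    moreover have "y \<in> ball x0 (3 * r)" using S[OF that] \<open>r > 0\<close> by auto
    ultimately show ?thesis
      by (simp add: DERIV_deriv_iff_field_differentiable holomorphic_on_imp_differentiable_at
          has_field_derivative_at_within)
  qed
  have "norm (f (x + h) - (\<Sum>i\<le>1. (deriv ^^ i) f x * (x + h - x) ^ i / fact i))
      \<le> (8 * M / r\<^sup>2) * norm (x + h - x) ^ Suc 1 / fact 1"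
    by (rule complex_Taylor[where S = ?S and f = "\<lambda>i. (deriv ^^ i) f", simplified comp_def funpow_0 id_def])
       (use D B in \<open>auto simp: dist_norm\<close>)
  then have *: "norm (f (x + h) - f x - deriv f x * h) \<le> 8 * M / r\<^sup>2 * norm h ^ 2"
    by (simp add: numeral_2_eq_2 algebra_simps)
  have "(f (x + h) - f x) / h - deriv f x = (f (x + h) - f x - deriv f x * h) / h"
    using h by (simp add: field_simps)
  also have "norm \<dots> \<le> 8 * M / r\<^sup>2 * norm h ^ 2 / norm h"
    unfolding norm_divide by (intro divide_right_mono *) auto
  finally show ?thesis using h by (simp add: power2_eq_square)
qed

text \<open>Needed to iterate partial derivatives. The derivative is a locally uniform limit of the
  difference quotients \<open>q n\<close>, which are jointly continuous and holomorphic in the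
  second variable; both properties pass to the limit.\<close>

lemma holomorphic2_on_deriv1:
  assumes "holomorphic2_on G U"
  shows "holomorphic2_on (\<lambda>p. deriv (\<lambda>x. G (x, snd p)) (fst p)) U"
proof -
  have oU: "open U" and cG: "continuous_on U G"
    using assms by (auto simp: holomorphic2_on_def)
  define q where "q n p = (G (fst p + 1 / of_nat (Suc n), snd p) - G p) / (1 / of_nat (Suc n))" for n p
  let ?d = "\<lambda>p. deriv (\<lambda>x. G (x, snd p)) (fst p)"
  have loc: "\<exists>r>0. \<exists>N. cball (fst p) r \<times> cball (snd p) r \<subseteq> U \<and>
     (\<forall>n\<ge>N. \<forall>x\<in>cball (fst p) r. x + 1 / of_nat (Suc n) \<in> ball (fst p) (6*r)) \<and>
     ball (fst p) (6*r) \<times> cball (snd p) r \<subseteq> U \<and>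
     uniform_limit (cball (fst p) r \<times> cball (snd p) r) (\<lambda>n. q (n + N)) ?d sequentially"
    if p: "p \<in> U" for p
  proof -
    obtain r where r: "r > 0" "cball (fst p) r \<times> cball (snd p) r \<subseteq> U"
      using open_contains_bidisc[OF oU p] .
    have "compact (G ` (cball (fst p) r \<times> cball (snd p) r))"
      using r cG by (intro compact_continuous_image compact_Times continuous_on_subset[OF cG]) auto
    then obtain M where M: "\<And>y. y \<in> cball (fst p) r \<times> cball (snd p) r \<Longrightarrow> norm (G y) \<le> M" "M > 0"
      unfolding bounded_pos compact_eq_bounded_closed by blast
    \<comment> \<open>\<open>3 * s = r\<close> is the large radius in
      \<open>difference_quotient_bound\<close>, and \<open>6 * t = r\<close> keeps the shifted
      points inside \<open>U\<close>. \<open>N\<close> makes all steps at most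
      \<open>s / 2\<close>.\<close>
    define s where "s = r / 3"
    define t where "t = r / 6"
    have s0: "s > 0" "t > 0" "t < s" "6 * t = r" using r by (auto simp: s_def t_def)
    obtain N where N: "1 / s * 2 < real N" using reals_Archimedean2 by blast
    have hN: "norm (1 / of_nat (Suc (n + N)) :: complex) \<le> s / 2" for n
    proof -
      have "2 / s < real (Suc (n + N))" using N by simp
      have "norm (1 / of_nat (Suc (n + N)) :: complex) = 1 / real (Suc (n + N))"
        by (metis norm_divide norm_of_nat norm_one)
      moreover have "1 / real (Suc (n + N)) \<le> s / 2"
        using \<open>2 / s < real (Suc (n + N))\<close> s0 by (simp add: field_simps)
      ultimately show ?thesis by linarith
    qed
    have bd: "norm (q (n + N) y - ?d y) \<le> 8 * M / s\<^sup>2 * (1 / real (Suc (n + N)))"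
      if y: "y \<in> cball (fst p) t \<times> cball (snd p) t" for n y
    proof -
      have a: "(\<lambda>x. G (x, snd y)) holomorphic_on ball (fst p) (3 * s)"
        by (rule holomorphic_on_subset[OF holomorphic2_on_slice1[OF assms]])
           (use r y in \<open>auto simp: s_def t_def subset_iff\<close>)
      have b: "norm (G (x, snd y)) \<le> M" if "x \<in> ball (fst p) (3 * s)" for x
        by (rule M) (use that y r in \<open>auto simp: s_def t_def\<close>)
      have c: "fst y \<in> ball (fst p) s" using y s0 by auto
      have d: "1 / of_nat (Suc (n + N)) \<noteq> (0 :: complex)" by (simp del: of_nat_Suc)
      have "norm (q (n + N) y - ?d y) \<le> 8 * M / s\<^sup>2 * norm (1 / of_nat (Suc (n + N)) :: complex)"
        using difference_quotient_bound[OF a s0(1) b c d hN] by (simp add: q_def)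
      also have "norm (1 / of_nat (Suc (n + N)) :: complex) = 1 / real (Suc (n + N))"
        by (metis norm_divide norm_of_nat norm_one)
      finally show ?thesis .
    qed
    have ul: "uniform_limit (cball (fst p) t \<times> cball (snd p) t) (\<lambda>n. q (n + N)) ?d sequentially"
    proof (rule uniform_limitI)
      fix e :: real assume "e > 0"
      have "(\<lambda>n. 8 * M / s\<^sup>2 * (1 / real (Suc (n + N)))) \<longlonglongrightarrow> 8 * M / s\<^sup>2 * 0"
        by (intro tendsto_mult tendsto_const LIMSEQ_ignore_initial_segment[of "\<lambda>n. 1 / real (Suc n)"] lim_1_over_n LIMSEQ_Suc)
      then have "\<forall>\<^sub>F n in sequentially. 8 * M / s\<^sup>2 * (1 / real (Suc (n + N))) < e"
        using \<open>e > 0\<close> by (intro order_tendstoD(2)) auto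
      then show "\<forall>\<^sub>F n in sequentially. \<forall>y\<in>cball (fst p) t \<times> cball (snd p) t. dist (q (n + N) y) (?d y) < e"
        by eventually_elim (unfold dist_norm, intro ballI, rule le_less_trans[OF bd], assumption+)
    qed
    have "x + 1 / of_nat (Suc n) \<in> ball (fst p) (6*t)" if "n \<ge> N" "x \<in> cball (fst p) t" for n x
    proof -
      have "norm (1 / of_nat (Suc n) :: complex) \<le> s / 2" using hN[of "n - N"] that by simp
      moreover have "dist (fst p) (x + 1 / of_nat (Suc n)) \<le> dist (fst p) x + norm (1 / of_nat (Suc n) :: complex)"
        by (metis dist_add_cancel dist_norm dist_triangle add.right_neutral diff_0_right dist_0_norm)
      ultimately show ?thesis using that s0 by (auto simp: s_def t_def)
    qed
    moreover have "ball (fst p) (6*t) \<times> cball (snd p) t \<subseteq> U" using r s0 by (auto simp: subset_iff)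
    moreover have "cball (fst p) t \<times> cball (snd p) t \<subseteq> U" using r s0 by (auto simp: subset_iff)
    ultimately show ?thesis using ul s0 by blast
  qed
  have cont: "continuous_on U ?d"
  proof -
    have "isCont ?d p" if p: "p \<in> U" for p
    proof -
      obtain r N where r: "r > 0" "cball (fst p) r \<times> cball (snd p) r \<subseteq> U"
        "\<forall>n\<ge>N. \<forall>x\<in>cball (fst p) r. x + 1 / of_nat (Suc n) \<in> ball (fst p) (6*r)"
        "ball (fst p) (6*r) \<times> cball (snd p) r \<subseteq> U"
        "uniform_limit (cball (fst p) r \<times> cball (snd p) r) (\<lambda>n. q (n + N)) ?d sequentially"
        using loc[OF p] by blast
      have "continuous_on (cball (fst p) r \<times> cball (snd p) r) ?d"
      proof (rule uniform_limit_theorem[OF _ r(5)])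
        show "\<forall>\<^sub>F n in sequentially. continuous_on (cball (fst p) r \<times> cball (snd p) r) (q (n + N))"
          unfolding q_def
        proof (intro always_eventually allI continuous_intros)
          show "continuous_on (cball (fst p) r \<times> cball (snd p) r)
            (\<lambda>x. G (fst x + 1 / of_nat (Suc (n + N)), snd x))" for n
          proof (rule continuous_on_compose2[OF cG])
            show "(\<lambda>x. (fst x + 1 / complex_of_nat (Suc (n + N)), snd x)) ` (cball (fst p) r \<times> cball (snd p) r) \<subseteq> U"
            proof (intro image_subsetI)
              fix y assume "y \<in> cball (fst p) r \<times> cball (snd p) r"
              then have "fst y + 1 / of_nat (Suc (n + N)) \<in> ball (fst p) (6*r)" "snd y \<in> cball (snd p) r"
                using r(3) by (auto simp del: of_nat_Suc)
              then show "(fst y + 1 / of_nat (Suc (n + N)), snd y) \<in> U"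
                using r(4) by blast
            qed
          qed (intro continuous_intros; simp)
        qed (use r(2) cG continuous_on_subset in \<open>auto simp del: of_nat_Suc\<close>)
      qed auto
      then have "continuous_on (ball (fst p) r \<times> ball (snd p) r) ?d"
        by (rule continuous_on_subset) (auto simp: subset_iff)
      moreover have "p \<in> ball (fst p) r \<times> ball (snd p) r" using r(1) by (simp add: mem_Times_iff)
      ultimately show ?thesis
        using continuous_on_interior[of "ball (fst p) r \<times> ball (snd p) r" ?d p] by (simp add: interior_open open_Times)
    qed
    then show ?thesis by (simp add: continuous_at_imp_continuous_on)
  qed
  have d1: "(\<lambda>z'. ?d (z', w)) field_differentiable (at z)" if "(z, w) \<in> U" for z w
  proof -
    have o: "open {x. (x, w) \<in> U}"
      using open_vimage[OF oU, of "\<lambda>x. (x, w)"] by (simp add: vimage_def continuous_on_Pair)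
    have "deriv (\<lambda>x. G (x, w)) holomorphic_on {x. (x, w) \<in> U}"
      by (rule holomorphic_deriv[OF holomorphic2_on_slice1[OF assms] o])
    then show ?thesis using o that by (simp add: holomorphic_on_imp_differentiable_at)
  qed
  have d2: "(\<lambda>w'. ?d (z, w')) field_differentiable (at w)" if "(z, w) \<in> U" for z w
  proof -
    obtain r N where r: "r > 0" "cball z r \<times> cball w r \<subseteq> U"
        "\<forall>n\<ge>N. \<forall>x\<in>cball z r. x + 1 / of_nat (Suc n) \<in> ball z (6*r)"
        "ball z (6*r) \<times> cball w r \<subseteq> U"
        "uniform_limit (cball z r \<times> cball w r) (\<lambda>n. q (n + N)) ?d sequentially"
      using loc[OF \<open>(z, w) \<in> U\<close>, unfolded fst_conv snd_conv] by (elim exE conjE) (rule that; assumption)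
    have "(\<lambda>w'. ?d (z, w')) holomorphic_on ball w r"
    proof (rule holomorphic_uniform_sequence[where f = "\<lambda>n w'. q (n + N) (z, w')"])
      show "(\<lambda>w'. q (n + N) (z, w')) holomorphic_on ball w r" for n
      proof -
        have "z + 1 / of_nat (Suc (n + N)) \<in> ball z (6 * r)" "z \<in> ball z (6 * r)"
          using r(1,3) by (auto simp del: of_nat_Suc)
        moreover have *: "ball w r \<subseteq> {w'. (x, w') \<in> U}" if "x \<in> ball z (6 * r)" for x
          using r(4) that ball_subset_cball by blast
        ultimately have "ball w r \<subseteq> {w'. (z + 1 / of_nat (Suc (n + N)), w') \<in> U}" "ball w r \<subseteq> {w'. (z, w') \<in> U}"
          by (simp_all only: *)
        then have a: "(\<lambda>w'. G (z + 1 / of_nat (Suc (n + N)), w')) holomorphic_on ball w r"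
          and b: "(\<lambda>w'. G (z, w')) holomorphic_on ball w r"
          by - (rule holomorphic_on_subset[OF holomorphic2_on_slice2[OF assms]]; assumption)+
        show ?thesis unfolding q_def fst_conv snd_conv
          by (intro holomorphic_on_divide holomorphic_on_diff holomorphic_on_const a b) (simp del: of_nat_Suc)
      qed
      show "\<exists>d>0. cball x d \<subseteq> ball w r \<and> uniform_limit (cball x d) (\<lambda>n w'. q (n + N) (z, w')) (\<lambda>w'. ?d (z, w')) sequentially"
        if "x \<in> ball w r" for x
      proof -
        obtain d where d: "d > 0" "cball x d \<subseteq> ball w r" using open_contains_cball[of "ball w r"] \<open>x \<in> ball w r\<close> by (metis open_ball)
        have "uniform_limit (cball x d) (\<lambda>n w'. q (n + N) (z, w')) (\<lambda>w'. ?d (z, w')) sequentially"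
        proof (rule uniform_limitI)
          fix e :: real assume "e > 0"
          from uniform_limitD[OF r(5) this]
          show "\<forall>\<^sub>F n in sequentially. \<forall>y\<in>cball x d. dist (q (n + N) (z, y)) (?d (z, y)) < e"
          proof eventually_elim
            case (elim n)
            show ?case
            proof
              fix y assume "y \<in> cball x d"
              then have "(z, y) \<in> cball z r \<times> cball w r" using d(2) r(1) by (auto simp: subset_iff)
              then show "dist (q (n + N) (z, y)) (?d (z, y)) < e" using elim by blast
            qed
          qed
        qed
        with d show ?thesis by (intro exI[of _ d] conjI)
      qed
    qed (rule open_ball)
    then show ?thesis using r(1) by (simp add: holomorphic_on_imp_differentiable_at)
  qed
  show ?thesis unfolding holomorphic2_on_def
    using oU cont d1 d2 by auto
qed

lemma holomorphic2_on_deriv2: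
  assumes "holomorphic2_on G U"
  shows "holomorphic2_on (\<lambda>p. deriv (\<lambda>y. G (fst p, y)) (snd p)) U"
  using holomorphic2_on_swap[OF holomorphic2_on_deriv1[OF holomorphic2_on_swap[OF assms]]]
  by simp

text \<open>Continuity of the partial derivative in the second variable turns separate
  differentiability into a Frechet derivative, so that \<open>G\<close> can be differentiated along
  real lines in the antidiagonal.\<close>

lemma holomorphic2_on_imp_has_derivative:
  assumes G: "holomorphic2_on G U" and U: "(u, v) \<in> U"
  shows "(G has_derivative (\<lambda>(a, b). deriv (\<lambda>x. G (x, v)) u * a + deriv (\<lambda>y. G (u, y)) v * b)) (at (u, v))"
proof -
  have oU: "open U" using G by (simp add: holomorphic2_on_def)
  obtain r where r: "r > 0" "cball u r \<times> cball v r \<subseteq> U"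
    using open_contains_bidisc[OF oU U] by auto
  then have r': "ball u r \<times> ball v r \<subseteq> U" by (auto simp: subset_iff)
  let ?fy = "\<lambda>x y. blinfun_mult_right (deriv (\<lambda>y. G (x, y)) y)"
  have "((\<lambda>(x, y). G (x, y)) has_derivative (\<lambda>(tx, ty). deriv (\<lambda>x. G (x, v)) u * tx + blinfun_apply (?fy u v) ty))
       (at (u, v) within ball u r \<times> ball v r)"
  proof (rule has_derivative_partialsI)
    have "(\<lambda>x. G (x, v)) field_differentiable (at u)"
      using G U by (auto simp: holomorphic2_on_def)
    then show "((\<lambda>x. G (x, v)) has_derivative (*) (deriv (\<lambda>x. G (x, v)) u)) (at u within ball u r)"
      by (simp add: field_differentiable_derivI has_derivative_at_withinI has_field_derivative_imp_has_derivative)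
    show "((\<lambda>y. G (x, y)) has_derivative blinfun_apply (?fy x y)) (at y within ball v r)"
      if "x \<in> ball u r" "y \<in> ball v r" for x y
    proof -
      have "(\<lambda>y. G (x, y)) field_differentiable (at y)"
        using G subsetD[OF r', of "(x, y)"] that unfolding holomorphic2_on_def by blast
      then show ?thesis
        by (simp add: field_differentiable_derivI has_derivative_at_withinI has_field_derivative_imp_has_derivative)
    qed
    have "continuous_on U (\<lambda>p. blinfun_mult_right (deriv (\<lambda>y. G (fst p, y)) (snd p)))"
      using holomorphic2_on_deriv2[OF G] unfolding holomorphic2_on_def
      by (intro bounded_linear.continuous_on[OF bounded_linear_blinfun_mult_right]) auto
    then have "continuous (at (u, v)) (\<lambda>p. blinfun_mult_right (deriv (\<lambda>y. G (fst p, y)) (snd p)))"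
      using oU U continuous_on_eq_continuous_at by blast
    then show "continuous (at (u, v) within ball u r \<times> ball v r) (\<lambda>(x, y). ?fy x y)"
      by (simp add: case_prod_unfold continuous_at_imp_continuous_within)
  qed (use r in auto)
  moreover have "at (u, v) within ball u r \<times> ball v r = at (u, v)"
    using r by (intro at_within_open) (auto simp: open_Times)
  ultimately show ?thesis by simp
qed

text \<open>In the direction \<open>a\<close> the antidiagonal moves by \<open>(a, cnj a)\<close>,
  which gives \<open>d1 * a + d2 * cnj a\<close>. Subtracting \<open>\<i>\<close> times the value at
  \<open>a = \<i>\<close> from the value at \<open>a = 1\<close> cancels \<open>d2\<close> and
  doubles \<open>d1\<close>.\<close>

lemma wirtinger_holomorphic2:
  assumes G: "holomorphic2_on G U" and U: "(u, cnj u) \<in> U"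
  shows "wirtinger (\<lambda>z. G (z, cnj z)) u = deriv (\<lambda>x. G (x, cnj u)) u"
proof -
  define d1 d2 where "d1 = deriv (\<lambda>x. G (x, cnj u)) u" and "d2 = deriv (\<lambda>y. G (u, y)) (cnj u)"
  have der: "(G has_derivative (\<lambda>(a, b). d1 * a + d2 * b)) (at (u, cnj u))"
    using holomorphic2_on_imp_has_derivative[OF G U] by (simp add: d1_def d2_def)
  have line: "vector_derivative (\<lambda>t::real. G (u + a * of_real t, cnj u + b * of_real t)) (at 0) = d1 * a + d2 * b" for a b
  proof -
    have l: "((\<lambda>t::real. (u + a * of_real t, cnj u + b * of_real t)) has_derivative (\<lambda>t. (a * of_real t, b * of_real t))) (at 0)"
      by (auto intro!: derivative_eq_intros)
    have "((\<lambda>t::real. G (u + a * of_real t, cnj u + b * of_real t)) has_derivative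
        (\<lambda>t. case (a * of_real t, b * of_real t) of (a, b) \<Rightarrow> d1 * a + d2 * b)) (at 0)"
      by (rule has_derivative_compose[OF l]) (use der in simp)
    then have "((\<lambda>t::real. G (u + a * of_real t, cnj u + b * of_real t)) has_vector_derivative (d1 * a + d2 * b)) (at 0)"
      unfolding has_vector_derivative_def by (simp add: scaleR_conv_of_real algebra_simps)
    then show ?thesis by (rule vector_derivative_at)
  qed
  show ?thesis
    unfolding wirtinger_def d1_def[symmetric]
    using line[of 1 1] line[of \<i> "-\<i>"] by (simp add: right_diff_distrib mult.commute[of _ \<i>])
qed

lemma wirtinger_cong_open:
  assumes "open S" "z \<in> S" "\<And>x. x \<in> S \<Longrightarrow> f x = g x"
  shows "wirtinger f z = wirtinger g z"
proof -
  have *: "vector_derivative (\<lambda>t::real. f (z + a * of_real t)) (at 0) = vector_derivative (\<lambda>t::real. g (z + a * of_real t)) (at 0)" for a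
  proof (rule vector_derivative_cong_eq)
    have "open ((\<lambda>t::real. z + a * of_real t) -` S)"
      using assms(1) by (intro open_vimage continuous_intros)
    then have "\<forall>\<^sub>F t in nhds 0. t \<in> (\<lambda>t::real. z + a * of_real t) -` S"
      using assms(2) by (intro eventually_nhds_in_open) auto
    then show "\<forall>\<^sub>F t in nhds (0::real). t \<in> UNIV \<longrightarrow> f (z + a * of_real t) = g (z + a * of_real t)"
      by eventually_elim (use assms(3) in auto)
  qed auto
  show ?thesis unfolding wirtinger_def using *[of 1] *[of \<i>] by simp
qed

text \<open>The induction runs over the two-variable functions \<open>H n\<close>: each Wirtinger
  derivative is again the restriction of such a function to the antidiagonal.\<close>

lemma wirtinger_iterate_holomorphic2:
  assumes G: "holomorphic2_on G U" and U: "(u, cnj u) \<in> U"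
  shows "(wirtinger ^^ n) (\<lambda>z. G (z, cnj z)) u = (deriv ^^ n) (\<lambda>x. G (x, cnj u)) u"
proof -
  define H where "H n = ((\<lambda>G p. deriv (\<lambda>x. G (x, snd p)) (fst p)) ^^ n) G" for n
  have H: "holomorphic2_on (H n) U" for n
    by (induction n) (auto simp: H_def G intro: holomorphic2_on_deriv1)
  have Hs: "H (Suc n) (x, w) = deriv (\<lambda>x. H n (x, w)) x" for n x w
    by (simp add: H_def)
  have 1: "H n (x, w) = (deriv ^^ n) (\<lambda>x. G (x, w)) x" for n x w
  proof (induction n arbitrary: x)
    case (Suc n)
    show ?case unfolding Hs Suc.IH by simp
  qed (simp add: H_def)
  have oU: "open {z. (z, cnj z) \<in> U}"
    using G open_vimage[of U "\<lambda>z. (z, cnj z)"]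
    by (simp add: holomorphic2_on_def vimage_def continuous_on_Pair continuous_on_cnj)
  have "(wirtinger ^^ n) (\<lambda>z. G (z, cnj z)) u = H n (u, cnj u)" if "(u, cnj u) \<in> U" for n u
    using that
  proof (induction n arbitrary: u)
    case (Suc n)
    have "(wirtinger ^^ Suc n) (\<lambda>z. G (z, cnj z)) u = wirtinger (\<lambda>u. H n (u, cnj u)) u"
      unfolding funpow.simps o_def using oU by (rule wirtinger_cong_open) (use Suc in auto)
    also have "\<dots> = H (Suc n) (u, cnj u)"
      using wirtinger_holomorphic2[OF H Suc.prems] Hs by simp
    finally show ?case .
  qed (simp add: H_def)
  then show ?thesis using U 1 by simp
qed

text \<open>A function of two variables vanishing on the antidiagonal has vanishing iterated Wirtinger
  derivatives there, so every slice has a zero Taylor series.\<close>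
lemma antidiagonal_identity0:
  assumes G: "holomorphic2_on G (unit_disk \<times> unit_disk)"
    and 0: "\<And>z. z \<in> unit_disk \<Longrightarrow> G (z, cnj z) = 0"
    and x: "x \<in> unit_disk" and w: "w \<in> unit_disk"
  shows "G (x, w) = 0"
proof -
  have cw: "cnj w \<in> unit_disk" using w by (simp add: unit_disk_def)
  have wz: "(wirtinger ^^ n) (\<lambda>z. G (z, cnj z)) u = 0" if "u \<in> unit_disk" for n u
    using that
  proof (induction n arbitrary: u)
    case (Suc n)
    have "(wirtinger ^^ Suc n) (\<lambda>z. G (z, cnj z)) u = wirtinger (\<lambda>u. 0) u"
      unfolding funpow.simps o_def
      by (rule wirtinger_cong_open[of unit_disk]) (use Suc in \<open>auto simp: unit_disk_def\<close>)
    also have "\<dots> = 0" by (simp add: wirtinger_def)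
    finally show ?case .
  qed (use 0 in auto)
  have hol: "(\<lambda>x. G (x, w)) holomorphic_on unit_disk"
    by (rule holomorphic_on_subset[OF holomorphic2_on_slice1[OF G]]) (use w in auto)
  have "(deriv ^^ n) (\<lambda>x. G (x, w)) (cnj w) = 0" for n
    using wirtinger_iterate_holomorphic2[OF G, of "cnj w" n] wz[OF cw] cw w by simp
  then show ?thesis
    using holomorphic_fun_eq_0_on_connected[OF hol _ _ _ cw x] by (simp add: unit_disk_def)
qed

lemma antidiagonal_identity:
  assumes G: "holomorphic2_on G (unit_disk \<times> unit_disk)" and H: "holomorphic2_on H (unit_disk \<times> unit_disk)"
    and eq: "\<And>z. z \<in> unit_disk \<Longrightarrow> G (z, cnj z) = H (z, cnj z)"
    and x: "x \<in> unit_disk" and w: "w \<in> unit_disk"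
  shows "G (x, w) = H (x, w)"
proof -
  have "holomorphic2_on (\<lambda>p. G p - H p) (unit_disk \<times> unit_disk)"
    using G H unfolding holomorphic2_on_def by (auto intro!: continuous_intros derivative_intros)
  then show ?thesis using antidiagonal_identity0[OF _ _ x w, of "\<lambda>p. G p - H p"] eq by simp
qed

section \<open>Closure properties of holomorphy in two variables\<close>

lemma holomorphic2_on_const: "open U \<Longrightarrow> holomorphic2_on (\<lambda>p. c) U"
  by (simp add: holomorphic2_on_def)

lemma holomorphic2_on_fst: "open U \<Longrightarrow> holomorphic2_on fst U"
  unfolding holomorphic2_on_def by (auto intro!: continuous_intros derivative_intros)

lemma holomorphic2_on_snd: "open U \<Longrightarrow> holomorphic2_on snd U"
  unfolding holomorphic2_on_def by (auto intro!: continuous_intros derivative_intros)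

lemma holomorphic2_on_add:
  "holomorphic2_on f U \<Longrightarrow> holomorphic2_on g U \<Longrightarrow> holomorphic2_on (\<lambda>p. f p + g p) U"
  unfolding holomorphic2_on_def by (auto intro!: continuous_intros derivative_intros)

lemma holomorphic2_on_diff:
  "holomorphic2_on f U \<Longrightarrow> holomorphic2_on g U \<Longrightarrow> holomorphic2_on (\<lambda>p. f p - g p) U"
  unfolding holomorphic2_on_def by (auto intro!: continuous_intros derivative_intros)

lemma holomorphic2_on_mult:
  "holomorphic2_on f U \<Longrightarrow> holomorphic2_on g U \<Longrightarrow> holomorphic2_on (\<lambda>p. f p * g p) U"
  unfolding holomorphic2_on_def by (auto intro!: continuous_intros derivative_intros)

lemma holomorphic2_on_divide:
  "holomorphic2_on f U \<Longrightarrow> holomorphic2_on g U \<Longrightarrow> (\<And>p. p \<in> U \<Longrightarrow> g p \<noteq> 0)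
    \<Longrightarrow> holomorphic2_on (\<lambda>p. f p / g p) U"
  unfolding holomorphic2_on_def by (auto intro!: continuous_intros derivative_intros)

lemmas holomorphic2_intros = holomorphic2_on_const holomorphic2_on_fst holomorphic2_on_snd
  holomorphic2_on_add holomorphic2_on_diff holomorphic2_on_mult holomorphic2_on_divide

lemma holomorphic2_on_compose_entire:
  assumes "holomorphic2_on g U" "E holomorphic_on UNIV"
  shows "holomorphic2_on (\<lambda>p. E (g p)) U"
proof -
  have E: "E field_differentiable (at t)" for t
    using assms(2) by (simp add: holomorphic_on_imp_differentiable_at)
  have "continuous_on U (\<lambda>p. E (g p))"
    by (rule continuous_on_compose2[OF holomorphic_on_imp_continuous_on[OF assms(2)]])
       (use assms(1) in \<open>auto simp: holomorphic2_on_def\<close>)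
  moreover have "(\<lambda>z. E (h z)) field_differentiable (at z)" if "h field_differentiable (at z)" for h z
    using field_differentiable_compose[OF that E] by (simp add: o_def)
  ultimately show ?thesis using assms(1) unfolding holomorphic2_on_def by blast
qed

lemma holomorphic2_on_compose_product:
  assumes g: "holomorphic2_on g U" and \<phi>: "\<phi> holomorphic_on A" and \<psi>: "\<psi> holomorphic_on B"
    and o: "open A" "open B" and im: "\<And>x y. x \<in> A \<Longrightarrow> y \<in> B \<Longrightarrow> (\<phi> x, \<psi> y) \<in> U"
  shows "holomorphic2_on (\<lambda>p. g (\<phi> (fst p), \<psi> (snd p))) (A \<times> B)"
  unfolding holomorphic2_on_def
proof (intro conjI allI impI)
  show "open (A \<times> B)" using o by (rule open_Times)
  have c1: "continuous_on (A \<times> B) (\<lambda>p. \<phi> (fst p))"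
    by (rule continuous_on_compose2[OF holomorphic_on_imp_continuous_on[OF \<phi>]]) (auto intro: continuous_intros)
  have c2: "continuous_on (A \<times> B) (\<lambda>p. \<psi> (snd p))"
    by (rule continuous_on_compose2[OF holomorphic_on_imp_continuous_on[OF \<psi>]]) (auto intro: continuous_intros)
  show "continuous_on (A \<times> B) (\<lambda>p. g (\<phi> (fst p), \<psi> (snd p)))"
    by (rule continuous_on_compose2[of U g])
       (use g im c1 c2 in \<open>auto simp: holomorphic2_on_def intro: continuous_on_Pair\<close>)
  fix z w assume zw: "(z, w) \<in> A \<times> B"
  have d\<phi>: "\<phi> field_differentiable (at z)" and d\<psi>: "\<psi> field_differentiable (at w)"
    using zw \<phi> \<psi> o holomorphic_on_imp_differentiable_at by auto
  have "(\<lambda>x. g (x, \<psi> w)) field_differentiable (at (\<phi> z))" "(\<lambda>y. g (\<phi> z, y)) field_differentiable (at (\<psi> w))"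
    using g im zw unfolding holomorphic2_on_def by auto
  from field_differentiable_compose[OF d\<phi> this(1)] field_differentiable_compose[OF d\<psi> this(2)]
  show "(\<lambda>z'. g (\<phi> (fst (z', w)), \<psi> (snd (z', w)))) field_differentiable (at z)"
    "(\<lambda>w'. g (\<phi> (fst (z, w')), \<psi> (snd (z, w')))) field_differentiable (at w)"
    by (simp_all add: o_def)
qed

section \<open>Moment maps\<close>

text \<open>On the antidiagonal, \<open>mom a b\<close> is the moment map of a one-parameter group of automorphisms of
  the disk; \<open>moms a b\<close> is its extension to \<open>\<Omega>\<close>, chart by chart.\<close>

definition mom :: "real \<Rightarrow> complex \<Rightarrow> complex \<times> complex \<Rightarrow> complex" where
  "mom a b p = (of_real a * (1 + fst p * snd p) + b * fst p + cnj b * snd p) / (1 - fst p * snd p)"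

definition moms :: "real \<Rightarrow> complex \<Rightarrow> nat \<Rightarrow> complex \<times> complex \<Rightarrow> complex" where
  "moms a b i p =
    (if i = 0 then mom a b p
     else if i = 1 then (of_real a * (fst p + snd p) + b + cnj b * (snd p * fst p)) / (fst p - snd p)
     else if i = 2 then (of_real a * (snd p + fst p) + b * (fst p * snd p) + cnj b) / (snd p - fst p)
     else (of_real a * (fst p * snd p + 1) + b * snd p + cnj b * fst p) / (fst p * snd p - 1))"

lemma open_chart_dom: "open (chart_dom i)"
proof -
  have "open {p::complex \<times> complex. fst p * snd p \<noteq> 1}" "open {p::complex \<times> complex. fst p \<noteq> snd p}"
    by (intro open_Collect_neq continuous_intros)+
  then show ?thesis by (simp add: chart_dom_def)
qed

lemma moms_0 [simp]: "moms a b 0 = mom a b"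
  by (simp add: moms_def fun_eq_iff)

lemma holomorphic2_moms: "holomorphic2_on (moms a b i) (chart_dom i)"
proof -
  have o: "open {p::complex \<times> complex. fst p * snd p \<noteq> 1}" "open {p::complex \<times> complex. fst p \<noteq> snd p}"
    by (intro open_Collect_neq continuous_intros)+
  have "holomorphic2_on (\<lambda>p. (of_real a * (1 + fst p * snd p) + b * fst p + cnj b * snd p) / (1 - fst p * snd p))
      {p. fst p * snd p \<noteq> 1}"
    "holomorphic2_on (\<lambda>p. (of_real a * (fst p + snd p) + b + cnj b * (snd p * fst p)) / (fst p - snd p)) {p. fst p \<noteq> snd p}"
    "holomorphic2_on (\<lambda>p. (of_real a * (snd p + fst p) + b * (fst p * snd p) + cnj b) / (snd p - fst p)) {p. fst p \<noteq> snd p}"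
    "holomorphic2_on (\<lambda>p. (of_real a * (fst p * snd p + 1) + b * snd p + cnj b * fst p) / (fst p * snd p - 1))
      {p. fst p * snd p \<noteq> 1}"
    by (intro holomorphic2_intros o; simp)+
  then show ?thesis
    unfolding moms_def mom_def chart_dom_def by simp
qed

lemma moms_chart_to0:
  assumes "p \<in> chart_dom i" "chart_ok i p"
  shows "moms a b i p = moms a b 0 (chart_to0 i p)"
  using assms
  by (auto simp: moms_def mom_def chart_to0_def chart_dom_def chart_ok_def divide_simps algebra_simps split: if_splits)

lemma hol_Omega_moms:
  assumes "E holomorphic_on UNIV"
  shows "hol_Omega (\<lambda>i p. E (moms a b i p))"
  using holomorphic2_on_compose_entire[OF holomorphic2_moms assms] moms_chart_to0
  unfolding hol_Omega_def by metis

text \<open>The value 0 off the disk is the convention of \<open>A_disk\<close>; it makes equality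
  of functions the same as equality on the disk.\<close>

definition pull :: "real \<Rightarrow> complex \<Rightarrow> (complex \<Rightarrow> complex) \<Rightarrow> complex \<Rightarrow> complex" where
  "pull a b E = (\<lambda>z. if z \<in> unit_disk then E (mom a b (z, cnj z)) else 0)"

lemma pull_in_A_disk: "E holomorphic_on UNIV \<Longrightarrow> pull a b E \<in> A_disk"
  unfolding A_disk_def pull_def using hol_Omega_moms[of E a b] by (auto simp: moms_def)

lemma mult_neq_1_unit_disk: "x \<in> unit_disk \<Longrightarrow> w \<in> unit_disk \<Longrightarrow> x * w \<noteq> 1"
  using norm_mult_less[of x 1 w 1] by (auto simp: unit_disk_def)

lemma bidisk_subset_chart_dom: "unit_disk \<times> unit_disk \<subseteq> chart_dom 0"
  using mult_neq_1_unit_disk by (auto simp: chart_dom_def)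

lemma open_unit_disk [simp]: "open unit_disk" and connected_unit_disk [simp]: "connected unit_disk"
  by (simp_all add: unit_disk_def)

lemma cnj_unit_disk [simp]: "cnj z \<in> unit_disk \<longleftrightarrow> z \<in> unit_disk"
  by (simp add: unit_disk_def)

lemma holomorphic2_mom_bidisk: "holomorphic2_on (mom a b) (unit_disk \<times> unit_disk)"
  using holomorphic2_on_subset[OF holomorphic2_moms[of a b 0] _ bidisk_subset_chart_dom]
  by (simp add: moms_def open_Times)

lemma cnj_mom: "cnj (mom a b (z, cnj z)) = mom a b (z, cnj z)"
  by (simp add: mom_def algebra_simps)

section \<open>Invariant derivatives of functions of a moment map\<close>

lemma disk_aut_in_unit_disk:
  assumes "z \<in> unit_disk" "u \<in> unit_disk"
  shows "disk_aut z u \<in> unit_disk"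
  using Moebius_function_norm_lt_1[of "-z" u 0] assms
  by (simp add: unit_disk_def disk_aut_def Moebius_function_def add.commute)

lemma disk_aut_holomorphic:
  assumes "z \<in> unit_disk"
  shows "disk_aut z holomorphic_on unit_disk"
  using Moebius_function_holomorphic[of "-z" 0] assms
  by (simp add: unit_disk_def disk_aut_def Moebius_function_def add.commute[of z] cong: holomorphic_cong)

lemma cnj_disk_aut: "cnj (disk_aut z u) = disk_aut (cnj z) (cnj u)"
  by (simp add: disk_aut_def)

text \<open>\<open>(1 - z * cnj z)\<close> times the Wirtinger derivative of
  \<open>mom a b (z, cnj z)\<close>, that is, its first Peschl-Minda derivative.\<close>

definition momd :: "real \<Rightarrow> complex \<Rightarrow> complex \<Rightarrow> complex" where
  "momd a b z = (b + 2 * of_real a * cnj z + cnj b * (cnj z)\<^sup>2) / (1 - z * cnj z)"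

text \<open>With the second variable frozen at \<open>cnj z\<close>, the factor
  \<open>1 + cnj z * x\<close> cancels between numerator and denominator, and what remains has
  degree one in \<open>x\<close>. This is why higher invariant derivatives of \<open>mom\<close>
  vanish and the chain rule for \<open>E \<circ> mom\<close> has a single term.\<close>

lemma mom_disk_aut:
  assumes z: "z \<in> unit_disk" and x: "x \<in> unit_disk"
  shows "mom a b (disk_aut z x, cnj z) = momd a b z * x + mom a b (z, cnj z)"
proof -
  have 1: "1 - z * cnj z \<noteq> 0" using mult_neq_1_unit_disk[of z "cnj z"] z by auto
  have 2: "1 + cnj z * x \<noteq> 0" using mult_neq_1_unit_disk[of "- cnj z" x] z x
    by (auto simp: unit_disk_def add_eq_0_iff)
  define d where "d = 1 + cnj z * x"
  define T where "T = disk_aut z x"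
  have T: "d * T = z + x" using 2 by (simp add: T_def d_def disk_aut_def)
  have "mom a b (T, cnj z) = (d * (of_real a * (1 + T * cnj z) + b * T + cnj b * cnj z)) / (d * (1 - T * cnj z))"
    using 2 by (simp add: mom_def d_def)
  also have "d * (1 - T * cnj z) = d - d * T * cnj z" by (simp add: algebra_simps)
  also have "\<dots> = 1 - z * cnj z" unfolding T by (simp add: d_def algebra_simps)
  also have "d * (of_real a * (1 + T * cnj z) + b * T + cnj b * cnj z)
    = of_real a * (d + d * T * cnj z) + b * (d * T) + cnj b * cnj z * d" by (simp add: algebra_simps)
  also have "\<dots> = of_real a * (d + (z + x) * cnj z) + b * (z + x) + cnj b * cnj z * d" unfolding T ..
  also have "\<dots> / (1 - z * cnj z) = momd a b z * x + mom a b (z, cnj z)"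
    by (simp add: d_def mom_def momd_def power2_eq_square algebra_simps flip: add_divide_distrib)
  finally show ?thesis by (simp add: T_def)
qed

text \<open>The iterated Wirtinger derivative at the origin is the derivative of the slice through
  second coordinate 0. There \<open>disk_aut (cnj z) 0 = cnj z\<close>, so
  \<open>mom_disk_aut\<close> makes the inner function affine.\<close>

lemma PM_D_pull:
  assumes E: "E holomorphic_on UNIV" and z: "z \<in> unit_disk"
  shows "PM_D n (pull a b E) z = momd a b z ^ n * (deriv ^^ n) E (mom a b (z, cnj z))"
proof -
  define G where "G p = E (mom a b (disk_aut z (fst p), disk_aut (cnj z) (snd p)))" for p
  have G: "holomorphic2_on G (unit_disk \<times> unit_disk)"
    unfolding G_def
    by (intro holomorphic2_on_compose_entire[OF _ E]
       holomorphic2_on_compose_product[OF holomorphic2_mom_bidisk[of a b]])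
       (use z disk_aut_in_unit_disk disk_aut_holomorphic in auto)
  have w: "(wirtinger ^^ n) (\<lambda>u. pull a b E (disk_aut z u)) u = (wirtinger ^^ n) (\<lambda>u. G (u, cnj u)) u"
    if "u \<in> unit_disk" for n u
    using that
  proof (induction n arbitrary: u)
    case 0 then show ?case using z disk_aut_in_unit_disk by (simp add: pull_def G_def cnj_disk_aut)
  next
    case (Suc n) then show ?case
      unfolding funpow.simps o_def by (intro wirtinger_cong_open[of unit_disk]) auto
  qed
  have 0: "0 \<in> unit_disk" by (simp add: unit_disk_def)
  have "PM_D n (pull a b E) z = (deriv ^^ n) (\<lambda>x. G (x, 0)) 0"
    unfolding PM_D_def using w[OF 0] wirtinger_iterate_holomorphic2[OF G, of 0 n] 0 by simp
  also have "\<dots> = (deriv ^^ n) (\<lambda>x. E (momd a b z * x + mom a b (z, cnj z))) 0"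
  proof (rule higher_deriv_cong_ev)
    show "\<forall>\<^sub>F x in nhds 0. G (x, 0) = E (momd a b z * x + mom a b (z, cnj z))"
      using eventually_nhds_in_open[OF open_unit_disk 0]
    proof eventually_elim
      case (elim x)
      then show ?case using mom_disk_aut[OF z elim] by (simp add: G_def disk_aut_def)
    qed
  qed simp
  also have "\<dots> = momd a b z ^ n * (deriv ^^ n) E (momd a b z * 0 + mom a b (z, cnj z))"
    by (rule higher_deriv_compose_linear'[OF E, of UNIV]) auto
  finally show ?thesis by simp
qed

lemma higher_deriv_cnj_conj:
  assumes E: "E holomorphic_on UNIV"
  shows "(deriv ^^ n) (\<lambda>t. cnj (E (cnj t))) t = cnj ((deriv ^^ n) E (cnj t))"
proof (induction n arbitrary: t)
  case (Suc n)
  have "(deriv ^^ n) E holomorphic_on UNIV" using E holomorphic_higher_deriv by blast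
  then have "((deriv ^^ n) E has_field_derivative deriv ((deriv ^^ n) E) (cnj t)) (at (cnj t))"
    using holomorphic_derivI by blast
  then have "((cnj \<circ> (deriv ^^ n) E \<circ> cnj) has_field_derivative cnj (deriv ((deriv ^^ n) E) (cnj t))) (at t)"
    using has_field_derivative_cnj_cnj[of "(deriv ^^ n) E" _ t]
    by simp
  moreover have "(deriv ^^ n) (\<lambda>t. cnj (E (cnj t))) = cnj \<circ> (deriv ^^ n) E \<circ> cnj"
    using Suc.IH by auto
  ultimately show ?case by (simp add: DERIV_imp_deriv)
qed simp

lemma entire_cnj_conj: "E holomorphic_on UNIV \<Longrightarrow> (\<lambda>t. cnj (E (cnj t))) holomorphic_on UNIV"
  using holomorphic_on_compose_cnj_cnj[of E UNIV] surjI[of cnj cnj] by (simp add: o_def)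

text \<open>\<open>mom\<close> is real on the antidiagonal, so conjugating \<open>pull a b E\<close>
  amounts to reflecting \<open>E\<close> in the real axis.\<close>

lemma PM_Dbar_pull:
  assumes E: "E holomorphic_on UNIV" and z: "z \<in> unit_disk"
  shows "PM_Dbar n (pull a b E) z = cnj (momd a b z) ^ n * (deriv ^^ n) E (mom a b (z, cnj z))"
proof -
  have "(\<lambda>x. cnj (pull a b E x)) = pull a b (\<lambda>t. cnj (E (cnj t)))"
    by (auto simp: pull_def cnj_mom)
  then show ?thesis
    using PM_D_pull[OF entire_cnj_conj[OF E] z]
    by (simp add: PM_Dbar_def higher_deriv_cnj_conj[OF E] cnj_mom)
qed

text \<open>An identity between the numerators, with the Casimir as the coefficient of
  \<open>(1 - z * cnj z)^2\<close>. It makes the squared length of the invariant gradient a function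
  of the moment map alone, so that the parameters enter the star product only through the
  Casimir.\<close>

lemma momd_mult_cnj:
  assumes z: "z \<in> unit_disk"
  shows "cnj (momd a b z) * momd a b z = (mom a b (z, cnj z))\<^sup>2 + of_real ((norm b)\<^sup>2 - a\<^sup>2)"
proof -
  have 1: "1 - z * cnj z \<noteq> 0" using mult_neq_1_unit_disk[of z "cnj z"] z by auto
  have b: "complex_of_real ((norm b)\<^sup>2 - a\<^sup>2) = b * cnj b - (of_real a)\<^sup>2"
    by (simp only: of_real_diff complex_norm_square) simp
  let ?N = "b + 2 * of_real a * cnj z + cnj b * (cnj z)\<^sup>2" and ?M = "of_real a * (1 + z * cnj z) + b * z + cnj b * cnj z"
  have "cnj ?N * ?N = ?M\<^sup>2 + (b * cnj b - (of_real a)\<^sup>2) * (1 - z * cnj z)\<^sup>2"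
    by (simp add: power2_eq_square algebra_simps)
  then have "cnj ?N * ?N / (1 - z * cnj z)\<^sup>2 = ?M\<^sup>2 / (1 - z * cnj z)\<^sup>2 + (b * cnj b - (of_real a)\<^sup>2)"
    using 1 by (simp add: add_divide_distrib)
  then show ?thesis unfolding b
    by (simp add: mom_def momd_def power_divide power2_eq_square[of "1 - z * cnj z"] mult.commute[of "cnj z" z])
qed

text \<open>The star product as seen by the outer functions: \<open>t\<close> is the value of the
  moment map and \<open>d\<close> that of the Casimir. As with \<open>star_disk\<close>, the
  definition is a bare \<open>suminf\<close>, and convergence is a separate matter.\<close>

definition star_sym :: "complex \<Rightarrow> complex \<Rightarrow> (complex \<Rightarrow> complex) \<Rightarrow> (complex \<Rightarrow> complex) \<Rightarrow> complex \<Rightarrow> complex" where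
  "star_sym h d E1 E2 t = (\<Sum>n. cc n h / fact n * ((t\<^sup>2 + d) ^ n * ((deriv ^^ n) E1 t * (deriv ^^ n) E2 t)))"

lemma star_disk_pull:
  assumes E1: "E1 holomorphic_on UNIV" and E2: "E2 holomorphic_on UNIV" and z: "z \<in> unit_disk"
  shows "star_disk h (pull a b E1) (pull a b E2) z
    = star_sym h (of_real ((norm b)\<^sup>2 - a\<^sup>2)) E1 E2 (mom a b (z, cnj z))"
proof -
  have "cc n h / fact n * PM_Dbar n (pull a b E1) z * PM_D n (pull a b E2) z
    = cc n h / fact n * (((mom a b (z, cnj z))\<^sup>2 + of_real ((norm b)\<^sup>2 - a\<^sup>2)) ^ n *
      ((deriv ^^ n) E1 (mom a b (z, cnj z)) * (deriv ^^ n) E2 (mom a b (z, cnj z))))" for n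
    unfolding PM_D_pull[OF E2 z] PM_Dbar_pull[OF E1 z] momd_mult_cnj[OF z, symmetric] power_mult_distrib
    by (simp only: mult_ac)
  then show ?thesis using z by (simp only: star_disk_def star_sym_def if_True)
qed

section \<open>Functions invariant under automorphisms of the disk\<close>

lemma A_diskE:
  assumes "f \<in> A_disk"
  obtains F where "holomorphic2_on F (chart_dom 0)" "\<And>z. z \<in> unit_disk \<Longrightarrow> f z = F (z, cnj z)"
    "\<And>z. z \<notin> unit_disk \<Longrightarrow> f z = 0"
proof -
  obtain Fs where "hol_Omega Fs" "\<forall>z\<in>unit_disk. f z = Fs 0 (z, cnj z)"
    using assms by (auto simp: A_disk_def)
  then show ?thesis
    using assms by (intro that[of "Fs 0"]) (auto simp: A_disk_def hol_Omega_def)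
qed

lemma islimpt_unit_disk_delete: "z \<in> unit_disk \<Longrightarrow> z islimpt (unit_disk - {w})"
proof -
  assume "z \<in> unit_disk"
  then have "z islimpt unit_disk" by (intro interior_limit_point) (simp add: interior_open)
  then have "z islimpt insert w (unit_disk - {w})" by (rule islimpt_subset) auto
  then show ?thesis by (simp only: islimpt_insert)
qed

text \<open>Both sides are holomorphic on the bidisk and agree on the antidiagonal. The extended
  action uses the reflected map on the second factor, which is again holomorphic.\<close>

lemma antidiagonal_invariance:
  assumes F: "holomorphic2_on F (unit_disk \<times> unit_disk)"
    and \<gamma>: "\<gamma> holomorphic_on unit_disk" "\<gamma> ` unit_disk \<subseteq> unit_disk"
    and inv: "\<And>z. z \<in> unit_disk \<Longrightarrow> F (\<gamma> z, cnj (\<gamma> z)) = F (z, cnj z)"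
    and x: "x \<in> unit_disk" and w: "w \<in> unit_disk"
  shows "F (\<gamma> x, cnj (\<gamma> (cnj w))) = F (x, w)"
proof -
  have c: "cnj ` unit_disk = unit_disk"
    using cnj_unit_disk by (metis complex_cnj_cnj image_eqI image_subsetI subsetI subset_antisym)
  have \<gamma>': "(\<lambda>w. cnj (\<gamma> (cnj w))) holomorphic_on unit_disk"
    using holomorphic_on_compose_cnj_cnj[of \<gamma> unit_disk] \<gamma> c by (simp add: o_def)
  have "holomorphic2_on (\<lambda>p. F (\<gamma> (fst p), cnj (\<gamma> (cnj (snd p))))) (unit_disk \<times> unit_disk)"
    by (rule holomorphic2_on_compose_product[OF F \<gamma>(1) \<gamma>']) (use \<gamma>(2) in \<open>auto simp: image_subset_iff\<close>)
  from antidiagonal_identity[OF this F _ x w] inv show ?thesis by simp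
qed

lemma chart_dom_0_iff: "p \<in> chart_dom 0 \<longleftrightarrow> fst p * snd p \<noteq> 1"
  by (simp add: chart_dom_def)

text \<open>The restriction of \<open>F\<close> to \<open>x = 0\<close> is an entire function of \<open>mom\<close>; the images of the origin under
  the given automorphisms accumulate in the closed disk, on which \<open>F (_, w)\<close> is still holomorphic.\<close>
lemma invariant_imp_pull:
  assumes f: "f \<in> A_disk" and b: "b \<noteq> 0"
    and \<gamma>: "\<And>g. g \<in> \<Gamma> \<Longrightarrow> g holomorphic_on unit_disk" "\<And>g. g \<in> \<Gamma> \<Longrightarrow> g ` unit_disk = unit_disk"
    and invf: "\<And>g z. g \<in> \<Gamma> \<Longrightarrow> z \<in> unit_disk \<Longrightarrow> f (g z) = f z"
    and invm: "\<And>g z. g \<in> \<Gamma> \<Longrightarrow> z \<in> unit_disk \<Longrightarrow> mom a b (g z, cnj (g z)) = mom a b (z, cnj z)"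
    and inf: "infinite ((\<lambda>g. g 0) ` \<Gamma>)"
  shows "\<exists>E. E holomorphic_on UNIV \<and> f = pull a b E"
proof -
  obtain F where F: "holomorphic2_on F (chart_dom 0)" and fF: "\<And>z. z \<in> unit_disk \<Longrightarrow> f z = F (z, cnj z)"
    and f0: "\<And>z. z \<notin> unit_disk \<Longrightarrow> f z = 0"
    using A_diskE[OF f] by blast
  have FD: "holomorphic2_on F (unit_disk \<times> unit_disk)"
    using holomorphic2_on_subset[OF F _ bidisk_subset_chart_dom] by (simp add: open_Times)
  \<comment> \<open>\<open>(t - a) / cnj b\<close> is the solution \<open>w\<close> of
    \<open>mom a b (0, w) = t\<close>. The line \<open>x = 0\<close> avoids
    \<open>x * w = 1\<close>, so \<open>E\<close> is entire.\<close>
  define E where "E t = F (0, (t - of_real a) / cnj b)" for t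
  have "(\<lambda>w. F (0, w)) holomorphic_on UNIV"
    using holomorphic2_on_slice2[OF F, of 0] by (simp add: chart_dom_0_iff)
  then have E: "E holomorphic_on UNIV"
    unfolding E_def
    by (intro holomorphic_on_compose_gen[of "\<lambda>t. (t - of_real a) / cnj b" _ "\<lambda>w. F (0, w)" UNIV, unfolded o_def]
        holomorphic_intros) (use b in auto)
  have zero: "0 \<in> unit_disk" by (simp add: unit_disk_def)
  \<comment> \<open>Surjectivity of \<open>g\<close> writes \<open>(g 0, w)\<close> as the image of
    some \<open>(0, cnj v)\<close>, where the equation holds by the choice of
    \<open>E\<close>.\<close>
  have eq: "F (g 0, w) = E (mom a b (g 0, w))" if g: "g \<in> \<Gamma>" and w: "w \<in> unit_disk" for g w
  proof -
    obtain v where v: "v \<in> unit_disk" "g v = cnj w" using \<gamma>(2)[OF g] w cnj_unit_disk by (metis imageE)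
    have sub: "g ` unit_disk \<subseteq> unit_disk" using \<gamma>(2)[OF g] by simp
    have cv: "cnj v \<in> unit_disk" using v by simp
    have "F (g z, cnj (g z)) = F (z, cnj z)" if "z \<in> unit_disk" for z
      using invf[OF g that] fF[OF that] fF[of "g z"] that sub by (simp add: image_subset_iff)
    from antidiagonal_invariance[OF FD \<gamma>(1)[OF g] sub this zero cv]
    have "F (g 0, w) = F (0, cnj v)" using v by simp
    moreover have "mom a b (g 0, w) = mom a b (0, cnj v)"
      using antidiagonal_invariance[OF holomorphic2_mom_bidisk \<gamma>(1)[OF g] sub invm[OF g] zero cv] v by simp
    ultimately show ?thesis using b by (simp add: E_def mom_def)
  qed
  have "F (x, w) = E (mom a b (x, w))" if x: "x \<in> unit_disk" and w: "w \<in> unit_disk" for x w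
  proof -
    \<comment> \<open>The slice at height \<open>w\<close> is singular only at \<open>1 / w\<close>,
      outside the closed unit disk. Since \<open>r > 1\<close>, an accumulation point on the unit
      circle is still interior; for \<open>w = 0\<close> any number above 1 would do.\<close>
    define r where "r = (if w = 0 then 2 else 1 / norm w)"
    have r: "r > 1" using w by (auto simp: r_def unit_disk_def)
    have dom: "(y, w) \<in> chart_dom 0" if "y \<in> ball 0 r" for y
    proof -
      have "y * w \<noteq> 1"
      proof
        assume yw: "y * w = 1"
        then have "norm y * norm w = 1" "w \<noteq> 0" by (auto simp flip: norm_mult)
        then have "norm y = r" by (simp add: r_def field_simps)
        then show False using that by simp
      qed
      then show ?thesis by (simp add: chart_dom_0_iff)
    qed
    have sub: "(\<lambda>g. g 0) ` \<Gamma> \<subseteq> cball 0 1"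
    proof (intro image_subsetI)
      fix g assume "g \<in> \<Gamma>"
      then have "g 0 \<in> unit_disk" using \<gamma>(2) zero by blast
      then show "g 0 \<in> cball 0 1" by (simp add: unit_disk_def)
    qed
    obtain \<xi> where xi: "\<xi> \<in> cball 0 1" "\<xi> islimpt ((\<lambda>g. g 0) ` \<Gamma>)"
      using compact_cball[of "0::complex" 1, unfolded compact_eq_Bolzano_Weierstrass, rule_format] inf sub by blast
    have h1: "(\<lambda>y. F (y, w)) holomorphic_on ball 0 r"
      by (rule holomorphic_on_subset[OF holomorphic2_on_slice1[OF F]]) (use dom in auto)
    have h2: "(\<lambda>y. E (mom a b (y, w))) holomorphic_on ball 0 r"
      by (rule holomorphic_on_subset[OF holomorphic2_on_slice1[OF holomorphic2_on_compose_entire[OF holomorphic2_moms[of a b 0] E]], simplified])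
         (use dom in auto)
    have "F (x, w) - E (mom a b (x, w)) = 0"
    proof (rule analytic_continuation[where f = "\<lambda>y. F (y, w) - E (mom a b (y, w))" and S = "ball 0 r" and U = "(\<lambda>g. g 0) ` \<Gamma>" and \<xi> = \<xi>])
      show "(\<lambda>g. g 0) ` \<Gamma> \<subseteq> ball 0 r"
        using sub r by (force simp: subset_iff)
      show "x \<in> ball 0 r" using x r by (auto simp: unit_disk_def)
      show "(\<lambda>y. F (y, w) - E (mom a b (y, w))) holomorphic_on ball 0 r"
        using h1 h2 by (rule holomorphic_on_diff)
      show "F (y, w) - E (mom a b (y, w)) = 0" if "y \<in> (\<lambda>g. g 0) ` \<Gamma>" for y
        using that eq w by auto
    qed (use xi r in auto)
    then show ?thesis by simp
  qed
  then have "f = pull a b E" using fF f0 by (auto simp: pull_def)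
  with E show ?thesis by blast
qed

lemma DERIV_eventually_unique:
  assumes "(f has_field_derivative D) (at x)" "(g has_field_derivative D') (at x)"
    "\<forall>\<^sub>F y in nhds x. f y = g y"
  shows "D = D'"
proof -
  have "(f has_field_derivative D') (at x)"
    using assms(2) DERIV_cong_ev[OF refl assms(3) refl] by simp
  then show ?thesis using assms(1) DERIV_unique by blast
qed

lemma mom_slice_deriv:
  "((\<lambda>x. mom a b (x, w)) has_field_derivative (b + 2 * of_real a * w + cnj b * w\<^sup>2)) (at 0)"
  unfolding mom_def by (auto intro!: derivative_eq_intros simp: algebra_simps power2_eq_square)

text \<open>At \<open>(0, w)\<close> the quotient of the two partial derivatives of
  \<open>E \<circ> mom a b\<close> is \<open>(b + 2 a w + cnj b w^2) / cnj b\<close>, whatever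
  \<open>E\<close> is. For equal functions the two quotients agree wherever the derivative of
  \<open>E1\<close> does not vanish, and their difference is affine,
  \<open>\<alpha> + \<beta> * w\<close>, because the quadratic terms cancel.\<close>

lemma pull_eq_pull_cases:
  assumes E1: "E1 holomorphic_on UNIV" and E2: "E2 holomorphic_on UNIV"
    and b: "b1 \<noteq> 0" "b2 \<noteq> 0" and eq: "pull a1 b1 E1 = pull a2 b2 E2"
  shows "(\<exists>c. \<forall>t. E1 t = c) \<or> (\<exists>k::real. k \<noteq> 0 \<and> a2 = k * a1 \<and> b2 = of_real k * b1)"
proof -
  have EE: "E1 (mom a1 b1 (x, w)) = E2 (mom a2 b2 (x, w))" if "x \<in> unit_disk" "w \<in> unit_disk" for x w
    using antidiagonal_identity[OF holomorphic2_on_compose_entire[OF holomorphic2_mom_bidisk E1]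
        holomorphic2_on_compose_entire[OF holomorphic2_mom_bidisk E2] _ that] eq
    by (metis pull_def)
  have D1: "(E1 has_field_derivative deriv E1 t) (at t)" and D2: "(E2 has_field_derivative deriv E2 t) (at t)" for t
    using E1 E2 holomorphic_derivI by blast+
  have zero: "0 \<in> unit_disk" by (simp add: unit_disk_def)
  define e where "e w = cnj b1 * deriv E1 (of_real a1 + cnj b1 * w)" for w
  define \<alpha> \<beta> where "\<alpha> = b1 / cnj b1 - b2 / cnj b2" and "\<beta> = 2 * (of_real a1 / cnj b1 - of_real a2 / cnj b2)"
  have key: "e w * (\<alpha> + \<beta> * w) = 0" if w: "w \<in> unit_disk" for w
  proof -
    have ev: "\<forall>\<^sub>F x in nhds y. x \<in> unit_disk" if "y \<in> unit_disk" for y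
      using eventually_nhds_in_open[OF open_unit_disk that] .
    have "((\<lambda>w. E1 (of_real a1 + cnj b1 * w)) has_field_derivative e w) (at w)"
      unfolding e_def by (rule DERIV_chain2[OF D1, THEN DERIV_cong]) (auto intro!: derivative_eq_intros)
    moreover have "((\<lambda>w. E2 (of_real a2 + cnj b2 * w)) has_field_derivative cnj b2 * deriv E2 (of_real a2 + cnj b2 * w)) (at w)"
      by (rule DERIV_chain2[OF D2, THEN DERIV_cong]) (auto intro!: derivative_eq_intros)
    moreover have "\<forall>\<^sub>F y in nhds w. E1 (of_real a1 + cnj b1 * y) = E2 (of_real a2 + cnj b2 * y)"
      using ev[OF w] by eventually_elim (use EE[OF zero] in \<open>simp add: mom_def\<close>)
    ultimately have e2: "e w = cnj b2 * deriv E2 (of_real a2 + cnj b2 * w)"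
      by (rule DERIV_eventually_unique)
    have m: "mom a b (0, w) = of_real a + cnj b * w" for a b by (simp add: mom_def)
    have "((\<lambda>x. E1 (mom a1 b1 (x, w))) has_field_derivative deriv E1 (of_real a1 + cnj b1 * w) * (b1 + 2 * of_real a1 * w + cnj b1 * w\<^sup>2)) (at 0)"
      using DERIV_chain2[OF D1 mom_slice_deriv[of a1 b1 w], unfolded m] .
    moreover have "((\<lambda>x. E2 (mom a2 b2 (x, w))) has_field_derivative deriv E2 (of_real a2 + cnj b2 * w) * (b2 + 2 * of_real a2 * w + cnj b2 * w\<^sup>2)) (at 0)"
      using DERIV_chain2[OF D2 mom_slice_deriv[of a2 b2 w], unfolded m] .
    moreover have "\<forall>\<^sub>F x in nhds 0. E1 (mom a1 b1 (x, w)) = E2 (mom a2 b2 (x, w))"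
      using ev[OF zero] by eventually_elim (use EE w in simp)
    ultimately have "deriv E1 (of_real a1 + cnj b1 * w) * (b1 + 2 * of_real a1 * w + cnj b1 * w\<^sup>2)
       = deriv E2 (of_real a2 + cnj b2 * w) * (b2 + 2 * of_real a2 * w + cnj b2 * w\<^sup>2)"
      by (rule DERIV_eventually_unique)
    moreover have "deriv E1 (of_real a1 + cnj b1 * w) = e w / cnj b1" "deriv E2 (of_real a2 + cnj b2 * w) = e w / cnj b2"
      using b by (simp_all add: e2) (simp_all add: e_def flip: e2)
    ultimately have "e w * ((b1 + 2 * of_real a1 * w + cnj b1 * w\<^sup>2) / cnj b1 - (b2 + 2 * of_real a2 * w + cnj b2 * w\<^sup>2) / cnj b2) = 0"
      by (simp add: right_diff_distrib)
    moreover have "(b1 + 2 * of_real a1 * w + cnj b1 * w\<^sup>2) / cnj b1 - (b2 + 2 * of_real a2 * w + cnj b2 * w\<^sup>2) / cnj b2 = \<alpha> + \<beta> * w"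
      using b by (simp add: \<alpha>_def \<beta>_def field_simps)
    ultimately show ?thesis by simp
  qed
  show ?thesis
  proof (cases "\<alpha> = 0 \<and> \<beta> = 0")
    case True
    \<comment> \<open>\<open>\<alpha> = 0\<close> says that \<open>k\<close> is real, and
      \<open>\<beta> = 0\<close> that the same factor takes \<open>a1\<close> to
      \<open>a2\<close>.\<close>
    define k where "k = b2 / b1"
    have "cnj k = k" using True b by (simp add: k_def \<alpha>_def field_simps)
    then obtain r where r: "k = of_real r" by (metis Reals_cases Reals_cnj_iff)
    have "of_real a2 = cnj k * (of_real a1 :: complex)"
      using True b by (simp add: k_def \<beta>_def field_simps)
    then have "of_real a2 = k * (of_real a1 :: complex)" by (simp only: \<open>cnj k = k\<close>)
    then have "a2 = r * a1" by (metis r of_real_eq_iff of_real_mult)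
    moreover have "b2 = of_real r * b1" using b by (simp flip: r add: k_def)
    ultimately show ?thesis using b by auto
  next
    case False
    have h: "(\<lambda>w. deriv E1 (of_real a1 + cnj b1 * w)) holomorphic_on UNIV"
      by (intro holomorphic_on_compose_gen[of "\<lambda>w. of_real a1 + cnj b1 * w" _ "deriv E1" UNIV, unfolded o_def]
          holomorphic_intros holomorphic_deriv E1) auto
    have z: "deriv E1 (of_real a1 + cnj b1 * w) = 0" for w
    proof (rule analytic_continuation[OF h])
      \<comment> \<open>The removed point is the only possible zero of
        \<open>\<alpha> + \<beta> * w\<close>. If \<open>\<beta> = 0\<close>, the quotient is 0 by
        convention, and removing it does no harm.\<close>
      show "0 islimpt (unit_disk - {- \<alpha> / \<beta>})" by (rule islimpt_unit_disk_delete[OF zero])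
      show "deriv E1 (of_real a1 + cnj b1 * w) = 0" if "w \<in> unit_disk - {- \<alpha> / \<beta>}" for w
      proof -
        have "\<alpha> + \<beta> * w \<noteq> 0" using that False by (cases "\<beta> = 0") (auto simp: field_simps add_eq_0_iff)
        then show ?thesis using key[of w] that b by (simp add: e_def)
      qed
    qed auto
    have "deriv E1 t = 0" for t
      using z[of "(t - of_real a1) / cnj b1"] b by simp
    then have "(E1 has_field_derivative 0) (at t)" for t using D1 by metis
    then have "\<exists>c. \<forall>t. E1 t = c"
      using has_field_derivative_zero_constant[of UNIV E1] by (auto simp: has_field_derivative_at_within)
    then show ?thesis ..
  qed
qed

section \<open>Uniqueness of the extension to Omega\<close>

lemma connected_mult_neq_1: "connected {x::complex. x * w \<noteq> 1}"
proof (cases "w = 0")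
  case False
  then have "{x. x * w \<noteq> 1} = UNIV - {1 / w}" by (auto simp: field_simps)
  then show ?thesis using connected_open_delete[of UNIV "1 / w"] by (simp add: convex_connected)
qed (simp add: convex_connected)

text \<open>The difference vanishes on the bidisk. Continuation first in \<open>x\<close> and then
  in \<open>w\<close> covers chart 0, every slice of which is the plane minus at most one point. The
  other charts meet chart 0 off the coordinate axes, and a continuous function that vanishes there
  vanishes on the axes too.\<close>

lemma hol_Omega_unique:
  assumes F: "hol_Omega F" and G: "hol_Omega G"
    and eq: "\<And>z. z \<in> unit_disk \<Longrightarrow> F 0 (z, cnj z) = G 0 (z, cnj z)"
    and i: "i < 4" and p: "p \<in> chart_dom i"
  shows "F i p = G i p"
proof -
  have hF: "holomorphic2_on (F j) (chart_dom j)" and hG: "holomorphic2_on (G j) (chart_dom j)" if "j < 4" for j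
    using F G that by (auto simp: hol_Omega_def)
  define H where "H j p = F j p - G j p" for j p
  have H: "holomorphic2_on (H j) (chart_dom j)" if "j < 4" for j
    unfolding H_def using hF[OF that] hG[OF that] by (rule holomorphic2_on_diff)
  have H0: "holomorphic2_on (H 0) (chart_dom 0)" using H by simp
  have bi: "H 0 (x, w) = 0" if "x \<in> unit_disk" "w \<in> unit_disk" for x w
    using antidiagonal_identity0[OF holomorphic2_on_subset[OF H0 _ bidisk_subset_chart_dom] _ that] eq
    by (simp add: H_def open_Times)
  have o: "open {x::complex. x * w \<noteq> 1}" for w by (intro open_Collect_neq continuous_intros)
  have zero: "0 \<in> unit_disk" by (simp add: unit_disk_def)
  have s1: "H 0 (x, w) = 0" if "w \<in> unit_disk" "x * w \<noteq> 1" for x w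
    by (rule analytic_continuation_open[where f = "\<lambda>x. H 0 (x, w)" and g = "\<lambda>x. 0" and s = unit_disk and s' = "{x. x * w \<noteq> 1}"])
       (use that bi zero o connected_mult_neq_1 mult_neq_1_unit_disk holomorphic2_on_slice1[OF H0, of w] in \<open>auto simp: chart_dom_0_iff\<close>)
  have c0: "H 0 (x, w) = 0" if "x * w \<noteq> 1" for x w
  proof (rule analytic_continuation_open[where f = "\<lambda>w. H 0 (x, w)" and g = "\<lambda>x. 0" and s = "unit_disk \<inter> {w. w * x \<noteq> 1}" and s' = "{w. w * x \<noteq> 1}"])
    show "unit_disk \<inter> {w. w * x \<noteq> 1} \<noteq> {}" using zero by (auto intro!: exI[of _ 0])
    show "(\<lambda>w. H 0 (x, w)) holomorphic_on {w. w * x \<noteq> 1}"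
      using holomorphic2_on_slice2[OF H0, of x] by (simp add: chart_dom_0_iff mult.commute)
  qed (use that s1[of _ x] o[of x] connected_mult_neq_1[of x] in \<open>auto simp: mult.commute[of x] intro: open_Int\<close>)
  have ok: "H i (x, w) = 0" if "(x, w) \<in> chart_dom i" "x \<noteq> 0" "w \<noteq> 0" for x w
  proof -
    have "chart_ok i (x, w)" using that by (simp add: chart_ok_def)
    then have "H i (x, w) = H 0 (chart_to0 i (x, w))"
      using F G i that by (simp add: hol_Omega_def H_def)
    also have "\<dots> = 0"
      using that i by (auto simp: chart_to0_def chart_dom_def field_simps intro!: c0 split: if_splits)
    finally show ?thesis .
  qed
  have "H i p = 0"
  proof (rule ccontr)
    assume ne: "H i p \<noteq> 0"
    have "open (chart_dom i \<inter> H i -` (- {0}))"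
      using H[OF i] by (intro continuous_open_preimage) (auto simp: holomorphic2_on_def)
    then obtain r where r: "r > 0" "cball (fst p) r \<times> cball (snd p) r \<subseteq> chart_dom i \<inter> H i -` (- {0})"
      using open_contains_bidisc[of _ p] ne p by (metis ComplI IntI singletonD vimageI)
    have "\<exists>y\<in>cball c r. y \<noteq> 0" for c :: complex
      using r(1) by (intro bexI[of _ "if c = 0 then of_real r else c"]) auto
    then obtain x w where "x \<in> cball (fst p) r" "x \<noteq> 0" "w \<in> cball (snd p) r" "w \<noteq> 0" by metis
    then show False using r(2) ok[of x w] by blast
  qed
  then show ?thesis by (simp add: H_def)
qed

lemma Omega_rep_props:
  assumes "f \<in> A_disk"
  shows "hol_Omega (Omega_rep f)" "\<And>z. z \<in> unit_disk \<Longrightarrow> f z = Omega_rep f 0 (z, cnj z)"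
proof -
  have "\<exists>Fs. hol_Omega Fs \<and> (\<forall>z \<in> unit_disk. f z = Fs 0 (z, cnj z))"
    using assms by (auto simp: A_disk_def)
  from someI_ex[OF this] show "hol_Omega (Omega_rep f)" "\<And>z. z \<in> unit_disk \<Longrightarrow> f z = Omega_rep f 0 (z, cnj z)"
    unfolding Omega_rep_def by auto
qed

text \<open>Uniqueness makes the choice in \<open>Omega_rep\<close> computable, so the
  neighbourhoods of \<open>pull a b E\<close> can be read off from \<open>E\<close>.\<close>

lemma Omega_rep_pull:
  assumes E: "E holomorphic_on UNIV" and "i < 4" "p \<in> chart_dom i"
  shows "Omega_rep (pull a b E) i p = E (moms a b i p)"
  using hol_Omega_unique[OF Omega_rep_props(1)[OF pull_in_A_disk[OF E]] hol_Omega_moms[OF E] _ assms(2,3)]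
    Omega_rep_props(2)[OF pull_in_A_disk[OF E]]
  by (metis moms_0 pull_def)

section \<open>The star product of functions of a moment map\<close>

lemma star_sym_commute: "star_sym h d E1 E2 = star_sym h d E2 E1"
  unfolding star_sym_def by (intro ext suminf_cong arg_cong[where f = "\<lambda>x. _ * (_ * x)"] mult.commute)

lemma cc_one: "cc n 1 = 1 / fact n"
proof -
  have "(\<Prod>j<n. 1 + of_nat j * (1::complex)) = fact n"
    by (simp add: fact_prod_Suc atLeast0LessThan)
  then show ?thesis by (simp add: cc_def)
qed

lemma cc_half: "cc n (1/2) = 1 / fact (Suc n)"
proof (induction n)
  case (Suc n)
  have "cc (Suc n) (1/2) = cc n (1/2) * ((1/2) / (1 + of_nat n * (1/2)))"
    by (simp add: cc_def)
  also have "(1/2) / (1 + of_nat n * (1/2)) = (1 :: complex) / of_nat (Suc (Suc n))"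
  proof -
    have "1 + of_nat n * (1/2) = (of_nat (Suc (Suc n)) :: complex) / 2" by (simp add: field_simps)
    then show ?thesis by simp
  qed
  finally show ?case unfolding Suc.IH by (simp del: of_nat_Suc)
qed (simp add: cc_def)

lemma star_weight_le:
  assumes "h = 1 \<or> h = 1/2"
  shows "norm (cc n h * fact n) \<le> 1"
proof -
  have "norm (cc n 1 * fact n) \<le> 1" by (simp add: cc_one)
  moreover have "cc n (1/2) * fact n = 1 / of_nat (Suc n)" by (simp add: cc_half field_simps del: of_nat_Suc)
  then have "norm (cc n (1/2) * fact n) = 1 / real (Suc n)"
    by (simp only: norm_divide norm_of_nat norm_one)
  then have "norm (cc n (1/2) * fact n) \<le> 1" by simp
  ultimately show ?thesis using assms by (elim disjE) (simp_all only:)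
qed

lemma higher_deriv_entire_bound:
  assumes E: "E holomorphic_on UNIV" and "r > 0" and M: "\<And>s. norm (t - s) = r \<Longrightarrow> norm (E s) \<le> M"
  shows "norm ((deriv ^^ n) E t / fact n) \<le> M / r ^ n"
proof -
  have "norm ((deriv ^^ n) E t) \<le> fact n * M / r ^ n"
    by (rule Cauchy_inequality)
       (use assms holomorphic_on_subset[OF E] in \<open>auto intro: holomorphic_on_imp_continuous_on\<close>)
  then show ?thesis by (simp add: norm_divide divide_le_eq mult.commute)
qed

text \<open>Regrouped into Taylor coefficients of \<open>E1\<close> and \<open>E2\<close>; the
  remaining weight \<open>cc n h * fact n\<close> is 1 at \<open>h = 1\<close> and
  \<open>1 / (n + 1)\<close> at \<open>h = 1/2\<close>.\<close>

lemma star_sym_term_eq: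
  "cc n h / fact n * ((t\<^sup>2 + d) ^ n * ((deriv ^^ n) E1 t * (deriv ^^ n) E2 t))
   = cc n h * fact n * (t\<^sup>2 + d) ^ n * ((deriv ^^ n) E1 t / fact n) * ((deriv ^^ n) E2 t / fact n)"
  by (simp add: field_simps)

text \<open>\<open>S\<close> is chosen with \<open>|t^2 + d| \<le> S^2\<close> near
  \<open>x\<close>. Cauchy's inequality on circles of radius \<open>2 S\<close> then bounds the
  \<open>n\<close>-th term by \<open>M1 * M2 / 4^n\<close>, so the series converges locally
  uniformly.\<close>

lemma star_sym_entire:
  assumes E1: "E1 holomorphic_on UNIV" and E2: "E2 holomorphic_on UNIV" and h: "h = 1 \<or> h = 1/2"
  shows "star_sym h d E1 E2 holomorphic_on UNIV"
proof -
  define f where "f n t = cc n h / fact n * ((t\<^sup>2 + d) ^ n * ((deriv ^^ n) E1 t * (deriv ^^ n) E2 t))" for n t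
  have D: "(deriv ^^ n) E1 holomorphic_on UNIV" "(deriv ^^ n) E2 holomorphic_on UNIV" for n
    using E1 E2 holomorphic_higher_deriv by blast+
  define F where "F N t = (\<Sum>n<N. f n t)" for N t
  have hol: "F N holomorphic_on UNIV" for N
    unfolding F_def f_def by (intro holomorphic_intros D)
  have lim: "uniform_limit (cball x 1) F (star_sym h d E1 E2) sequentially" for x
  proof -
  define R where "R = norm x + 1"
  define S where "S = sqrt (R\<^sup>2 + norm d) + 1"
  have R: "R > 0" by (simp add: R_def add_nonneg_pos)
  have S: "S > 0" by (simp add: S_def add_nonneg_pos)
  have S2: "norm (t\<^sup>2 + d) \<le> S\<^sup>2" if "t \<in> cball x 1" for t
  proof -
    have "norm t \<le> R" using that norm_triangle_ineq2[of t x] by (auto simp: R_def dist_norm norm_minus_commute)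
    then have "norm (t\<^sup>2 + d) \<le> R\<^sup>2 + norm d"
      using norm_triangle_ineq[of "t\<^sup>2" d] power_mono[of "norm t" R 2] by (simp add: norm_power)
    also have "\<dots> = (sqrt (R\<^sup>2 + norm d))\<^sup>2" by simp
    also have "\<dots> \<le> S\<^sup>2" by (intro power_mono) (auto simp: S_def)
    finally show ?thesis .
  qed
  have bounded: "\<exists>M\<ge>0. \<forall>s\<in>cball 0 (R + 2*S). norm (E s) \<le> M" if "E holomorphic_on UNIV" for E :: "complex \<Rightarrow> complex"
  proof -
    have "continuous_on (cball 0 (R + 2*S)) E"
      using holomorphic_on_imp_continuous_on[OF that] continuous_on_subset by blast
    then have "bounded (E ` cball 0 (R + 2*S))"
      by (intro compact_imp_bounded compact_continuous_image compact_cball)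
    then obtain M where "M > 0" "\<forall>x\<in>E ` cball 0 (R + 2*S). norm x \<le> M" unfolding bounded_pos by blast
    then show ?thesis by (intro exI[of _ M]) simp
  qed
  obtain M1 where M1: "M1 \<ge> 0" "\<And>s. s \<in> cball 0 (R + 2*S) \<Longrightarrow> norm (E1 s) \<le> M1"
    using bounded[OF E1] by (elim exE conjE) (rule that, assumption, erule bspec)
  obtain M2 where M2: "M2 \<ge> 0" "\<And>s. s \<in> cball 0 (R + 2*S) \<Longrightarrow> norm (E2 s) \<le> M2"
    using bounded[OF E2] by (elim exE conjE) (rule that, assumption, erule bspec)
  have term_le: "norm (f n t) \<le> M1 * M2 * (1/4) ^ n" if t: "t \<in> cball x 1" for n t
  proof -
    have tR: "norm t \<le> R" using t norm_triangle_ineq2[of t x] by (auto simp: R_def dist_norm norm_minus_commute)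
    have s: "s \<in> cball 0 (R + 2*S)" if "norm (t - s) = 2 * S" for s
      using that tR norm_triangle_ineq2[of s t] by (auto simp: norm_minus_commute)
    have e1: "norm ((deriv ^^ n) E1 t / fact n) \<le> M1 / (2*S) ^ n"
      by (rule higher_deriv_entire_bound[OF E1 _ M1(2)[OF s]]) (simp_all add: S)
    have e2: "norm ((deriv ^^ n) E2 t / fact n) \<le> M2 / (2*S) ^ n"
      by (rule higher_deriv_entire_bound[OF E2 _ M2(2)[OF s]]) (simp_all add: S)
    have "norm (f n t) = norm (cc n h * fact n) * norm (t\<^sup>2 + d) ^ n * norm ((deriv ^^ n) E1 t / fact n) * norm ((deriv ^^ n) E2 t / fact n)"
      unfolding f_def star_sym_term_eq by (simp only: norm_mult norm_power)
    also have "\<dots> \<le> 1 * (S\<^sup>2) ^ n * (M1 / (2*S) ^ n) * (M2 / (2*S) ^ n)"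
      by (intro mult_mono star_weight_le[OF h] power_mono S2 t e1 e2)
         (simp_all add: M1(1) M2(1) S less_imp_le)
    also have "\<dots> = M1 * M2 * ((S\<^sup>2) ^ n / ((2*S) ^ n * (2*S) ^ n))" by simp
    also have "(S\<^sup>2) ^ n / ((2*S) ^ n * (2*S) ^ n) = (1/4) ^ n"
    proof -
      have "(2*S) ^ n * (2*S) ^ n = (4 * S\<^sup>2) ^ n"
        unfolding power_mult_distrib[symmetric] by (simp add: power2_eq_square)
      then have "(S\<^sup>2) ^ n / ((2*S) ^ n * (2*S) ^ n) = (S\<^sup>2 / (4 * S\<^sup>2)) ^ n" by (simp only: power_divide)
      also have "S\<^sup>2 / (4 * S\<^sup>2) = 1/4" using S by simp
      finally show ?thesis .
    qed
    finally show ?thesis .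
  qed
  have "summable (\<lambda>n. M1 * M2 * (1/4) ^ n)" by (intro summable_mult summable_geometric) simp
  from Weierstrass_m_test[OF term_le this]
  have "uniform_limit (cball x 1) (\<lambda>N t. \<Sum>n<N. f n t) (\<lambda>t. \<Sum>n. f n t) sequentially" .
  then show ?thesis unfolding F_def star_sym_def f_def .
  qed
  show ?thesis
  proof (rule holomorphic_uniform_sequence[where f = F and S = UNIV and g = "star_sym h d E1 E2"])
    show "open (UNIV :: complex set)" by (rule open_UNIV)
    show "F n holomorphic_on UNIV" for n by (rule hol)
    show "\<exists>e>0. cball x e \<subseteq> UNIV \<and> uniform_limit (cball x e) F (star_sym h d E1 E2) sequentially" for x
    proof (rule exI[of _ "1::real"], intro conjI)
      show "(0::real) < 1" by (rule zero_less_one)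
      show "cball x 1 \<subseteq> UNIV" by (rule subset_UNIV)
      show "uniform_limit (cball x 1) F (star_sym h d E1 E2) sequentially" by (rule lim)
    qed
  qed
qed

lemma higher_deriv_shift: "(deriv ^^ n) (\<lambda>t::complex. t + c) = (\<lambda>t. if n = 0 then t + c else if n = 1 then 1 else 0)"
proof (induction n)
  case (Suc n)
  have "deriv (\<lambda>t::complex. t + c) = (\<lambda>t. 1)" by (auto intro!: DERIV_imp_deriv derivative_eq_intros)
  then show ?case using Suc by auto
qed auto

lemma star_sym_shift:
  "star_sym h d (\<lambda>t. t + c1) (\<lambda>t. t + c2) t = (t + c1) * (t + c2) + h * (t\<^sup>2 + d)"
proof -
  have "star_sym h d (\<lambda>t. t + c1) (\<lambda>t. t + c2) t =
     (\<Sum>n\<in>{0, 1}. cc n h / fact n * ((t\<^sup>2 + d) ^ n * ((deriv ^^ n) (\<lambda>t. t + c1) t * (deriv ^^ n) (\<lambda>t. t + c2) t)))"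
    unfolding star_sym_def by (rule suminf_finite) (auto simp: higher_deriv_shift)
  then show ?thesis by (simp add: higher_deriv_shift cc_def)
qed

text \<open>The weights at \<open>\<hbar> = 1\<close> and \<open>\<hbar> = 1/2\<close> are \<open>1/n!\<close> and \<open>1/(n+1)!\<close>. With \<open>G = g\<^sub>0 + O(t^m)\<close>, all terms of index
  \<open>n \<ge> 1\<close> are \<open>O(t^(2m))\<close> as \<open>t\<close> tends to 0, so the relation forces \<open>g\<^sub>0 (g\<^sub>0 + \<kappa>) = 0\<close> and \<open>2 g\<^sub>0 + \<kappa> = 0\<close>.\<close>
lemma parabolic_relation_imp_const:
  assumes G: "G holomorphic_on UNIV" and \<kappa>: "\<kappa> \<noteq> 0"
    and rel: "\<And>t::real. t > 0 \<Longrightarrow> 3 * star_sym 1 0 G G (of_real t) - 4 * star_sym (1/2) 0 G G (of_real t) = \<kappa> * G (of_real t)"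
  shows "\<exists>c. \<forall>t. G t = c"
proof (rule ccontr)
  assume nc: "\<not> ?thesis"
  define g0 where "g0 = G 0"
  have hG: "(\<lambda>s. G s - g0) holomorphic_on UNIV" by (intro holomorphic_intros G)
  have nc': "\<not> (\<lambda>s. G s - g0) constant_on UNIV"
  proof
    assume "(\<lambda>s. G s - g0) constant_on UNIV"
    then obtain c where "\<forall>t. G t - g0 = c" unfolding constant_on_def by blast
    then have "\<forall>t. G t = c + g0" by (simp add: diff_eq_eq)
    then show False using nc by blast
  qed
  have conn: "connected (UNIV :: complex set)" and zero: "G 0 - g0 = 0" by (auto simp: g0_def convex_connected)
  obtain H r m where m: "0 < m" and r: "0 < r" and H: "H holomorphic_on ball 0 r"
    and GH: "\<And>w. w \<in> ball 0 r \<Longrightarrow> G w - g0 = (w - 0) ^ m * H w" and Hnz: "\<And>w. w \<in> ball 0 r \<Longrightarrow> H w \<noteq> 0"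
    by (rule holomorphic_factor_zero_nonconstant[OF hG open_UNIV conn UNIV_I[of 0] zero nc']) (rule that; assumption)
  have "continuous_on (cball 0 (r/2)) H"
    using r by (intro holomorphic_on_imp_continuous_on holomorphic_on_subset[OF H]) auto
  then have "bounded (H ` cball 0 (r/2))"
    by (intro compact_imp_bounded compact_continuous_image compact_cball)
  then obtain C where C: "C > 0" "\<And>s. s \<in> cball 0 (r/2) \<Longrightarrow> norm (H s) \<le> C"
    unfolding bounded_pos by blast
  define K where "K = (C * 3 ^ m)\<^sup>2"
  \<comment> \<open>For \<open>t < r / 6\<close> the circles used below lie in the disk of radius
    \<open>3 t < r / 2\<close>, where \<open>H\<close> is bounded by \<open>C\<close>.\<close>
  have est: "norm ((G (of_real t))\<^sup>2 + \<kappa> * G (of_real t)) \<le> K * t ^ (2 * m)" if t: "0 < t" "t < r / 6" for t :: real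
  proof -
    let ?t = "complex_of_real t"
    define u where "u n = ?t ^ n * ((deriv ^^ n) G ?t / fact n)" for n
    \<comment> \<open>Cauchy's inequality for \<open>G - g0\<close> on the circle of radius
      \<open>2 t\<close> about \<open>t\<close>: there \<open>|s| \<le> 3 t\<close>, which gives the
      power \<open>t^m\<close>, and \<open>t^n / (2 t)^n\<close> gives the geometric factor.\<close>
    have ub: "norm (u n) \<le> C * (3 * t) ^ m * (1/2) ^ n" if n: "n > 0" for n
    proof -
      have "norm ((deriv ^^ n) (\<lambda>s. G s - g0) ?t / fact n) \<le> C * (3 * t) ^ m / (2 * t) ^ n"
      proof (rule higher_deriv_entire_bound[OF hG])
        fix s :: complex assume "norm (?t - s) = 2 * t"
        then have s: "norm s \<le> 3 * t" using t norm_triangle_ineq2[of s ?t] by (auto simp: norm_minus_commute)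
        then have "norm (G s - g0) = norm s ^ m * norm (H s)" using GH[of s] t by (simp add: norm_mult norm_power)
        also have "\<dots> \<le> (3 * t) ^ m * C" using s t C by (intro mult_mono power_mono) auto
        finally show "norm (G s - g0) \<le> C * (3 * t) ^ m" by (simp add: mult.commute)
      qed (use t in auto)
      moreover have "(deriv ^^ n) (\<lambda>s. G s - g0) ?t = (deriv ^^ n) G ?t"
        using higher_deriv_diff[OF G, of "\<lambda>s. g0" ?t n] n by simp
      ultimately have "norm ((deriv ^^ n) G ?t / fact n) \<le> C * (3 * t) ^ m / (2 * t) ^ n" by simp
      then have "norm ?t ^ n * norm ((deriv ^^ n) G ?t / fact n) \<le> t ^ n * (C * (3 * t) ^ m / (2 * t) ^ n)"
        using t by (intro mult_mono) auto
      also have "\<dots> = C * (3 * t) ^ m * (1/2) ^ n" using t by (simp add: power_mult_distrib power_divide)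
      finally show ?thesis by (simp only: u_def norm_mult norm_power)
    qed
    have ub2: "norm ((u n)\<^sup>2) \<le> K * t ^ (2 * m) * (1/4) ^ n" if n: "n > 0" for n
    proof -
      have "norm ((u n)\<^sup>2) \<le> (C * (3 * t) ^ m * (1/2) ^ n)\<^sup>2"
        unfolding norm_power using ub[OF n] by (intro power_mono) auto
      also have "\<dots> = K * t ^ (2 * m) * (1/4) ^ n"
      proof -
        have "((1/2) ^ n)\<^sup>2 = (1/4::real) ^ n" by (simp add: power2_eq_square flip: power_mult_distrib)
        moreover have "((3 * t) ^ m)\<^sup>2 = (3 ^ m)\<^sup>2 * t ^ (2 * m)" by (simp only: power_mult_distrib power_even_eq)
        ultimately show ?thesis by (simp only: K_def power_mult_distrib mult.assoc power_even_eq)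
      qed
      finally show ?thesis .
    qed
    have geo: "(\<lambda>n. K * t ^ (2 * m) * (1/4) ^ n) sums (K * t ^ (2 * m) * (1 / (1 - 1/4)))"
      by (intro sums_mult geometric_sums) auto
    have sum1: "summable (\<lambda>n. (u n)\<^sup>2)"
      by (rule summable_comparison_test_ev[OF _ sums_summable[OF geo]])
         (use ub2 in \<open>auto intro: eventually_sequentiallyI[of 1]\<close>)
    have w: "norm (1 / of_nat (Suc n) :: complex) \<le> 1" for n
      by (simp only: norm_divide norm_of_nat norm_one) simp
    have sum2: "summable (\<lambda>n. 1 / of_nat (Suc n) * (u n)\<^sup>2)"
    proof (rule summable_comparison_test_ev[OF _ sums_summable[OF geo]])
      have "norm (1 / of_nat (Suc n) * (u n)\<^sup>2) \<le> K * t ^ (2 * m) * (1/4) ^ n" if "n \<ge> 1" for n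
      proof -
        have "norm (1 / of_nat (Suc n) * (u n)\<^sup>2) \<le> 1 * norm ((u n)\<^sup>2)"
          unfolding norm_mult by (intro mult_right_mono w) auto
        then show ?thesis using ub2[of n] that by simp
      qed
      then show "\<forall>\<^sub>F n in sequentially. norm (1 / of_nat (Suc n) * (u n)\<^sup>2) \<le> K * t ^ (2 * m) * (1/4) ^ n"
        by (rule eventually_sequentiallyI)
    qed
    have S1: "star_sym 1 0 G G ?t = (\<Sum>n. (u n)\<^sup>2)"
      unfolding star_sym_def star_sym_term_eq
      by (rule suminf_cong) (simp add: cc_one u_def power2_eq_square power_mult_distrib)
    have S2: "star_sym (1/2) 0 G G ?t = (\<Sum>n. 1 / of_nat (Suc n) * (u n)\<^sup>2)"
      unfolding star_sym_def star_sym_term_eq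
      by (rule suminf_cong) (simp add: cc_half u_def power2_eq_square power_mult_distrib mult_ac del: of_nat_Suc)
    \<comment> \<open>The combined weight is \<open>-1\<close> at \<open>n = 0\<close> and at most 3
      for \<open>n \<ge> 1\<close>. As the geometric series in \<open>1/4\<close> without its first
      term sums to \<open>1/3\<close>, the bound on the tail is exactly
      \<open>K * t ^ (2 * m)\<close>.\<close>
    define v where "v n = (3 - 4 / of_nat (Suc n)) * (u n)\<^sup>2" for n
    have v: "v n = 3 * (u n)\<^sup>2 - 4 * (1 / of_nat (Suc n) * (u n)\<^sup>2)" for n
      by (simp add: v_def left_diff_distrib del: of_nat_Suc)
    have sumv: "summable v" unfolding v by (rule summable_diff[OF summable_mult[OF sum1] summable_mult[OF sum2]])
    have "suminf v = (\<Sum>n. 3 * (u n)\<^sup>2) - (\<Sum>n. 4 * (1 / of_nat (Suc n) * (u n)\<^sup>2))"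
      unfolding v by (rule suminf_diff[OF summable_mult[OF sum1] summable_mult[OF sum2], symmetric])
    also have "\<dots> = 3 * star_sym 1 0 G G ?t - 4 * star_sym (1/2) 0 G G ?t"
      unfolding S1 S2 suminf_mult[OF sum1] suminf_mult[OF sum2] ..
    finally have "\<kappa> * G ?t = suminf v" using rel[OF t(1)] by simp
    also have "suminf v = (\<Sum>n. v (Suc n)) + v 0" using suminf_split_head[OF sumv] by simp
    also have "v 0 = - (G ?t)\<^sup>2" by (simp add: v_def u_def)
    finally have "(G ?t)\<^sup>2 + \<kappa> * G ?t = (\<Sum>n. v (Suc n))" by simp
    moreover have "norm (\<Sum>n. v (Suc n)) \<le> (\<Sum>n. 3 * (K * t ^ (2 * m) * (1/4) ^ Suc n))"
    proof (rule norm_suminf_le)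
      fix n
      have "norm (3 - 4 / of_nat (Suc (Suc n)) :: complex) = norm (of_real (3 - 4 / real (Suc (Suc n))) :: complex)" by simp
      also have "\<dots> = \<bar>3 - 4 / real (Suc (Suc n))\<bar>" by (simp only: norm_of_real)
      also have "\<dots> \<le> 3" by (simp add: abs_le_iff field_simps)
      finally show "norm (v (Suc n)) \<le> 3 * (K * t ^ (2 * m) * (1/4) ^ Suc n)"
        unfolding v_def norm_mult by (intro mult_mono ub2) auto
    next
      show "summable (\<lambda>n. 3 * (K * t ^ (2 * m) * (1/4) ^ Suc n))"
        by (intro summable_mult summable_Suc_iff[THEN iffD2] summable_geometric) auto
    qed
    moreover have "(\<lambda>n. 3 * (K * t ^ (2 * m) * (1/4) ^ Suc n)) sums (3 * (K * t ^ (2 * m) * (1/3)))"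
    proof -
      have "(\<lambda>n. (1/4::real) ^ Suc n) sums (1/3)"
        using sums_mult[OF geometric_sums[of "1/4::real"], of "1/4"] by simp
      then show ?thesis by (intro sums_mult)
    qed
    ultimately show ?thesis by (simp add: sums_iff)
  qed
  let ?F = "at_right (0::real)"
  have small: "\<forall>\<^sub>F t in ?F. 0 < t \<and> t < r / 6"
    using r by (intro eventually_at_rightI[of 0 "r/6"]) auto
  have tt: "((\<lambda>t. complex_of_real t) \<longlongrightarrow> 0) ?F"
    using tendsto_of_real[of "\<lambda>t. t" 0 ?F] by (simp add: tendsto_ident_at)
  have GT: "((\<lambda>t. G (of_real t)) \<longlongrightarrow> g0) ?F"
    unfolding g0_def by (rule isCont_tendsto_compose[OF _ tt])
      (use holomorphic_on_imp_differentiable_at[OF G] in \<open>simp add: field_differentiable_imp_continuous_at\<close>)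
  have HT: "((\<lambda>t. H (of_real t)) \<longlongrightarrow> H 0) ?F"
    by (rule isCont_tendsto_compose[OF _ tt])
      (use holomorphic_on_imp_differentiable_at[OF H] r in \<open>simp add: field_differentiable_imp_continuous_at\<close>)
  have pw: "((\<lambda>t::real. t ^ k) \<longlongrightarrow> 0) ?F" if "k > 0" for k
    using tendsto_power[OF tendsto_ident_at, of 0 k "{0<..}"] that by (simp add: zero_power)
  have "((\<lambda>t. (G (of_real t))\<^sup>2 + \<kappa> * G (of_real t)) \<longlongrightarrow> 0) ?F"
  proof (rule Lim_null_comparison)
    show "\<forall>\<^sub>F t in ?F. norm ((G (of_real t))\<^sup>2 + \<kappa> * G (of_real t)) \<le> K * t ^ (2 * m)"
      using small by eventually_elim (use est in blast)
    show "((\<lambda>t. K * t ^ (2 * m)) \<longlongrightarrow> 0) ?F" using tendsto_mult_right_zero[OF pw, of "2 * m"] m by simp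
  qed
  moreover have "((\<lambda>t. (G (of_real t))\<^sup>2 + \<kappa> * G (of_real t)) \<longlongrightarrow> g0\<^sup>2 + \<kappa> * g0) ?F"
    by (intro tendsto_intros GT)
  ultimately have q: "g0\<^sup>2 + \<kappa> * g0 = 0"
    by (rule tendsto_unique[OF trivial_limit_at_right_real, symmetric])
  \<comment> \<open>Once \<open>q\<close> removes the constant term, \<open>G^2 + \<kappa> G\<close>
    has a factor \<open>t^m\<close>; dividing it out leaves an estimate that still tends to
    0.\<close>
  have "((\<lambda>t. (2 * g0 + \<kappa>) * H (of_real t) + of_real t ^ m * (H (of_real t))\<^sup>2) \<longlongrightarrow> 0) ?F"
  proof (rule Lim_null_comparison)
    show "\<forall>\<^sub>F t in ?F. norm ((2 * g0 + \<kappa>) * H (of_real t) + of_real t ^ m * (H (of_real t))\<^sup>2) \<le> K * t ^ m"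
      using small
    proof eventually_elim
      case (elim t)
      let ?t = "complex_of_real t"
      have "G ?t = g0 + ?t ^ m * H ?t" using GH[of ?t] elim by (simp add: algebra_simps)
      then have "(G ?t)\<^sup>2 + \<kappa> * G ?t = (g0\<^sup>2 + \<kappa> * g0) + ?t ^ m * ((2 * g0 + \<kappa>) * H ?t + ?t ^ m * (H ?t)\<^sup>2)"
        by (simp add: power2_eq_square algebra_simps)
      then have "t ^ m * norm ((2 * g0 + \<kappa>) * H ?t + ?t ^ m * (H ?t)\<^sup>2) = norm ((G ?t)\<^sup>2 + \<kappa> * G ?t)"
        using elim by (simp add: q norm_mult norm_power)
      also have "\<dots> \<le> t ^ m * (K * t ^ m)" using est[of t] elim unfolding mult_2 power_add by (simp add: mult_ac)
      finally show ?case using elim by simp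
    qed
    show "((\<lambda>t. K * t ^ m) \<longlongrightarrow> 0) ?F" using tendsto_mult_right_zero[OF pw[OF m]] .
  qed
  moreover have "((\<lambda>t. (2 * g0 + \<kappa>) * H (of_real t) + of_real t ^ m * (H (of_real t))\<^sup>2) \<longlongrightarrow> (2 * g0 + \<kappa>) * H 0 + 0 ^ m * (H 0)\<^sup>2) ?F"
    by (intro tendsto_intros HT tt)
  ultimately have "(2 * g0 + \<kappa>) * H 0 + 0 ^ m * (H 0)\<^sup>2 = 0"
    by (rule tendsto_unique[OF trivial_limit_at_right_real, symmetric])
  then have "2 * g0 + \<kappa> = 0" using m Hnz[of 0] r by (simp add: zero_power)
  moreover have "g0 * (g0 + \<kappa>) = 0" using q by (simp add: power2_eq_square algebra_simps)
  ultimately show False using \<kappa> by (auto simp: add_eq_0_iff)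
qed

section \<open>Ranges of the moment maps\<close>

lemma mom_eq_real:
  "mom a b (z, cnj z) = of_real ((a * (1 + (norm z)\<^sup>2) + 2 * Re (b * z)) / (1 - (norm z)\<^sup>2))"
proof -
  have "complex_of_real (2 * Re (b * z)) = b * z + cnj b * cnj z"
    using complex_add_cnj[of "b * z"] by simp
  moreover have "complex_of_real ((norm z)\<^sup>2) = z * cnj z" by (rule complex_norm_square)
  ultimately show ?thesis by (simp only: mom_def of_real_divide of_real_add of_real_mult of_real_diff fst_conv snd_conv of_real_1) (simp add: add.assoc)
qed

text \<open>On the diameter in direction \<open>cnj \<beta>\<close> the product \<open>b * z\<close>
  is real, which leaves a rational function of the real variable \<open>s\<close>.\<close>

lemma mom_real_line: "s\<^sup>2 < 1 \<Longrightarrow> norm \<beta> = 1 \<Longrightarrow> b = of_real c * \<beta> \<Longrightarrow>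
    mom a b (cnj \<beta> * of_real s, cnj (cnj \<beta> * of_real s)) = of_real ((a * (1 + s\<^sup>2) + 2 * c * s) / (1 - s\<^sup>2))"
proof -
  assume *: "norm \<beta> = 1" "b = of_real c * \<beta>"
  have "\<beta> * cnj \<beta> = 1" using * complex_norm_square[of \<beta>] by simp
  then have "b * (cnj \<beta> * of_real s) = of_real (c * s)" by (simp add: *(2) mult_ac)
  then have 1: "Re (b * (cnj \<beta> * of_real s)) = c * s" by (simp only: Re_complex_of_real)
  have 2: "(norm (cnj \<beta> * of_real s))\<^sup>2 = s\<^sup>2" using * by (simp add: norm_mult)
  show ?thesis unfolding mom_eq_real 1 2 by (simp only: mult.assoc)
qed

text \<open>\<open>norm b = a\<close> bounds the numerator below by
  \<open>a (1 - |z|)^2\<close>.\<close>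

lemma mom_parabolic_pos:
  assumes "norm b = a" "a > 0" "z \<in> unit_disk"
  obtains t where "t > 0" "mom a b (z, cnj z) = of_real t"
proof -
  have z: "norm z < 1" using assms by (simp add: unit_disk_def)
  have "- Re (b * z) \<le> norm (b * z)" using abs_Re_le_cmod[of "b * z"] by linarith
  then have "a * (1 + (norm z)\<^sup>2) + 2 * Re (b * z) \<ge> a * (1 - norm z)\<^sup>2"
    using assms by (simp add: norm_mult power2_eq_square algebra_simps)
  moreover have "a * (1 - norm z)\<^sup>2 > 0" using z assms by simp
  moreover have "1 - (norm z)\<^sup>2 > 0" using z by (simp add: abs_square_less_1)
  ultimately show ?thesis by (intro that[OF _ mom_eq_real[of a b z]] divide_pos_pos) linarith+
qed

lemma mom_parabolic_surj:
  assumes "norm b = a" "a > 0" "t > 0"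
  obtains z where "z \<in> unit_disk" "mom a b (z, cnj z) = of_real t"
proof -
  \<comment> \<open>On the diameter of \<open>mom_real_line\<close> the moment map is
    \<open>a (1 + s) / (1 - s)\<close>; this is its inverse.\<close>
  define s where "s = (t - a) / (t + a)"
  have "\<bar>s\<bar> < 1" using assms by (simp add: s_def abs_less_iff field_simps)
  then have s: "s\<^sup>2 < 1" by (simp add: abs_square_less_1)
  have n: "norm (b / of_real a) = 1" using assms by (simp add: norm_divide)
  have "mom a b (cnj (b / of_real a) * of_real s, cnj (cnj (b / of_real a) * of_real s)) = of_real ((a * (1 + s\<^sup>2) + 2 * a * s) / (1 - s\<^sup>2))"
    by (rule mom_real_line[OF s n]) (use assms in auto)
  also have "(a * (1 + s\<^sup>2) + 2 * a * s) / (1 - s\<^sup>2) = t"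
  proof -
    have "a * (1 + s\<^sup>2) + 2 * a * s = a * (1 + s) * (1 + s)" "1 - s\<^sup>2 = (1 - s) * (1 + s)"
      by (simp_all add: power2_eq_square algebra_simps)
    moreover have e: "1 + s = 2 * t / (t + a)" "1 - s = 2 * a / (t + a)" using assms by (simp_all add: s_def field_simps)
    moreover have "1 + s \<noteq> 0" using assms by (simp add: e)
    ultimately have "(a * (1 + s\<^sup>2) + 2 * a * s) / (1 - s\<^sup>2) = a * (1 + s) / (1 - s)" by simp
    then show ?thesis unfolding e using assms by simp
  qed
  finally show ?thesis
    using s n assms by (intro that[of "cnj (b / of_real a) * of_real s"]) (auto simp: unit_disk_def norm_mult abs_square_less_1 norm_divide)
qed

lemma mom_hyperbolic_surj:
  assumes b: "(norm b)\<^sup>2 = a\<^sup>2 + 1"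
  obtains z where "z \<in> unit_disk" "mom a b (z, cnj z) = of_real t"
proof -
  define B where "B = norm b"
  define T where "T = sqrt (1 + t\<^sup>2)"
  \<comment> \<open>A root of \<open>(a + t) s^2 + 2 B s + (a - t) = 0\<close>, whose reduced
    discriminant \<open>B^2 - a^2 + t^2\<close> is \<open>T^2\<close>. The root
    \<open>(T - B) / (a + t)\<close> is written in rationalised form, which is also valid when
    \<open>a + t = 0\<close>.\<close>
  define s where "s = (t - a) / (B + T)"
  have B2: "B\<^sup>2 = a\<^sup>2 + 1" using b by (simp add: B_def)
  have T2: "T\<^sup>2 = 1 + t\<^sup>2" by (simp add: T_def)
  have Ba: "\<bar>a\<bar> < B" using B2 by (intro power2_less_imp_less[of "\<bar>a\<bar>"]) (auto simp: B_def)
  have Tt: "\<bar>t\<bar> < T" using T2 by (intro power2_less_imp_less[of "\<bar>t\<bar>"]) (auto simp: T_def)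
  have B0: "B > 0" using Ba by linarith
  have d: "B + T > 0" using B0 Tt by linarith
  have "\<bar>s\<bar> < 1" using Ba Tt d by (simp add: s_def)
  then have s: "s\<^sup>2 < 1" by (simp add: abs_square_less_1)
  have n: "norm (b / of_real B) = 1" using B0 by (simp add: norm_divide B_def)
  have "mom a b (cnj (b / of_real B) * of_real s, cnj (cnj (b / of_real B) * of_real s)) = of_real ((a * (1 + s\<^sup>2) + 2 * B * s) / (1 - s\<^sup>2))"
    by (rule mom_real_line[OF s n]) (use B0 in auto)
  also have "(a * (1 + s\<^sup>2) + 2 * B * s) / (1 - s\<^sup>2) = t"
  proof -
    have sd: "s * (B + T) = t - a" using d by (simp add: s_def)
    have "(B + T) * ((a + t) * s\<^sup>2 + 2 * B * s + (a - t)) = (a + t) * s * (s * (B + T)) + 2 * B * (s * (B + T)) + (a - t) * (B + T)"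
      by (simp add: power2_eq_square algebra_simps)
    also have "\<dots> = (t - a) * ((a + t) * s + (B - T))" unfolding sd by (simp add: algebra_simps)
    also have "(a + t) * s + (B - T) = 0"
    proof -
      have "(B + T) * ((a + t) * s + (B - T)) = (a + t) * (s * (B + T)) + (B\<^sup>2 - T\<^sup>2)" by (simp add: power2_eq_square algebra_simps)
      also have "\<dots> = 0" unfolding sd B2 T2 by (simp add: power2_eq_square algebra_simps)
      finally show ?thesis using d by simp
    qed
    finally have "(a + t) * s\<^sup>2 + 2 * B * s + (a - t) = 0" using d by simp
    then show ?thesis using s by (simp add: field_simps)
  qed
  finally show ?thesis
    using s n by (intro that[of "cnj (b / of_real B) * of_real s"]) (auto simp: unit_disk_def norm_mult abs_square_less_1 norm_divide)
qed

section \<open>Coverings and deck transformations\<close>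

text \<open>The part of "local homeomorphism" that uniqueness of lifts needs. For holomorphic maps
  it also provides local inverses.\<close>

definition locally_inj_on :: "('a::topological_space \<Rightarrow> 'b) \<Rightarrow> 'a set \<Rightarrow> bool" where
  "locally_inj_on c B \<longleftrightarrow> (\<forall>y\<in>B. \<exists>N. open N \<and> y \<in> N \<and> N \<subseteq> B \<and> inj_on c N)"

lemma locally_inj_onE:
  assumes "locally_inj_on c B" "y \<in> B"
  obtains N where "open N" "y \<in> N" "N \<subseteq> B" "inj_on c N"
  using assms unfolding locally_inj_on_def by blast

text \<open>The set where the lifts agree is open by local injectivity and relatively closed by the
  Hausdorff property. The target of \<open>c\<close> carries no topology, so \<open>c\<close> may
  take values in an abstract surface.\<close>

lemma unique_lift:
  fixes g1 g2 :: "'a::topological_space \<Rightarrow> 'b::t2_space"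
  assumes c: "locally_inj_on c B" and g1: "continuous_on A g1" "g1 ` A \<subseteq> B" and g2: "continuous_on A g2" "g2 ` A \<subseteq> B"
    and eq: "\<And>x. x \<in> A \<Longrightarrow> c (g1 x) = c (g2 x)" and A: "connected A" "open A"
    and a: "a \<in> A" "g1 a = g2 a" and x: "x \<in> A"
  shows "g1 x = g2 x"
proof -
  define T where "T = {x\<in>A. g1 x = g2 x}"
  have "open T"
  proof (subst open_subopen, intro ballI)
    fix y assume y: "y \<in> T"
    then have "g1 y \<in> B" using g1 by (auto simp: T_def)
    then obtain N where N: "open N" "g1 y \<in> N" "N \<subseteq> B" "inj_on c N" using locally_inj_onE[OF c] by blast
    have "open (A \<inter> g1 -` N)" "open (A \<inter> g2 -` N)"
      using continuous_open_preimage[OF g1(1) A(2) N(1)] continuous_open_preimage[OF g2(1) A(2) N(1)] by auto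
    then have "open (A \<inter> g1 -` N \<inter> (A \<inter> g2 -` N))" by (rule open_Int)
    moreover have "A \<inter> g1 -` N \<inter> (A \<inter> g2 -` N) \<subseteq> T"
      using inj_onD[OF N(4)] eq by (auto simp: T_def)
    moreover have "y \<in> A \<inter> g1 -` N \<inter> (A \<inter> g2 -` N)" using y N(2) by (auto simp: T_def)
    ultimately show "\<exists>S. open S \<and> y \<in> S \<and> S \<subseteq> T" by blast
  qed
  moreover have "open (A - T)"
  proof (subst open_subopen, intro ballI)
    fix y assume y: "y \<in> A - T"
    then obtain U V where UV: "open U" "open V" "g1 y \<in> U" "g2 y \<in> V" "U \<inter> V = {}"
      using separation_t2[of "g1 y" "g2 y"] by (auto simp: T_def)
    have "open (A \<inter> g1 -` U)" "open (A \<inter> g2 -` V)"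
      using continuous_open_preimage[OF g1(1) A(2) UV(1)] continuous_open_preimage[OF g2(1) A(2) UV(2)] by auto
    then have "open (A \<inter> g1 -` U \<inter> (A \<inter> g2 -` V))" by (rule open_Int)
    moreover have "A \<inter> g1 -` U \<inter> (A \<inter> g2 -` V) \<subseteq> A - T" using UV(5) by (auto simp: T_def)
    moreover have "y \<in> A \<inter> g1 -` U \<inter> (A \<inter> g2 -` V)" using y UV by auto
    ultimately show "\<exists>S. open S \<and> y \<in> S \<and> S \<subseteq> A - T" by blast
  qed
  ultimately have "T \<inter> A = {} \<or> (A - T) \<inter> A = {}"
    using connectedD[OF A(1), of T "A - T"] by blast
  then have "x \<in> T" using a x by (auto simp: T_def)
  then show ?thesis by (simp add: T_def)
qed

lemma holomorphic_lift:
  assumes f: "f holomorphic_on A" and A: "open A" and g: "continuous_on A g" "g ` A \<subseteq> B"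
    and c: "c holomorphic_on B" "locally_inj_on c B" and eq: "\<And>z. z \<in> A \<Longrightarrow> c (g z) = f z"
  shows "g holomorphic_on A"
proof -
  have "g field_differentiable (at z)" if z: "z \<in> A" for z
  proof -
    obtain N where N: "open N" "g z \<in> N" "N \<subseteq> B" "inj_on c N"
      using locally_inj_onE[OF c(2)] g z by (metis image_subset_iff)
    obtain k where k: "k holomorphic_on (c ` N)" "\<And>y. y \<in> N \<Longrightarrow> k (c y) = y"
      using holomorphic_has_inverse[OF holomorphic_on_subset[OF c(1) N(3)] N(1) N(4)] by metis
    define M where "M = A \<inter> g -` N"
    have M: "open M" "z \<in> M" using continuous_open_preimage[OF g(1) A N(1)] z N by (auto simp: M_def)
    have "k \<circ> f holomorphic_on M"
    proof (rule holomorphic_on_compose)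
      show "f holomorphic_on M" using f by (rule holomorphic_on_subset) (auto simp: M_def)
      show "k holomorphic_on f ` M" using k(1)
      proof (rule holomorphic_on_subset, intro image_subsetI)
        fix y assume "y \<in> M"
        then have "f y = c (g y)" "g y \<in> N" using eq[of y] by (auto simp: M_def)
        then show "f y \<in> c ` N" by (rule image_eqI)
      qed
    qed
    moreover have "(k \<circ> f) y = g y" if "y \<in> M" for y
      using that eq[of y] k(2)[of "g y"] by (simp add: M_def)
    ultimately have "g holomorphic_on M" by (rule holomorphic_transform)
    then show ?thesis using M by (simp add: holomorphic_on_imp_differentiable_at)
  qed
  then show ?thesis unfolding holomorphic_on_def by (simp add: field_differentiable_at_within)
qed

text \<open>\<open>\<mu>\<close> lifts \<open>c\<close> through \<open>e\<close>. Since
  \<open>W\<close> is simply connected, \<open>e\<close> lifts through the covering \<open>c\<close>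
  to some \<open>\<nu>\<close> with \<open>\<nu> (\<mu> 0) = 0\<close>. Both composites are lifts
  with a fixed point, hence identities by \<open>unique_lift\<close>.\<close>

lemma biholomorphic_lift:
  fixes c e \<mu> :: "complex \<Rightarrow> complex"
  assumes c: "covering_space unit_disk c S" "locally_inj_on c unit_disk"
    and W: "open W" "convex W" and e: "continuous_on W e" "locally_inj_on e W" "e ` W \<subseteq> S"
    and \<mu>: "continuous_on unit_disk \<mu>" "\<mu> ` unit_disk \<subseteq> W" "\<And>z. z \<in> unit_disk \<Longrightarrow> e (\<mu> z) = c z"
  shows "bij_betw \<mu> unit_disk W"
proof -
  have zero: "0 \<in> unit_disk" by (simp add: unit_disk_def)
  have m0: "\<mu> 0 \<in> W" using \<mu>(2) zero by blast
  obtain \<nu> where \<nu>: "continuous_on W \<nu>" "\<nu> \<in> W \<rightarrow> unit_disk" "\<nu> (\<mu> 0) = 0" "\<And>y. y \<in> W \<Longrightarrow> c (\<nu> y) = e y"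
  proof (rule covering_space_lift_strong[OF c(1) zero m0 _ _ e(1)])
    show "simply_connected W" using W(2) by (rule convex_imp_simply_connected)
    show "locally path_connected W" using W(2) by (rule convex_imp_locally_path_connected)
    show "e \<in> W \<rightarrow> S" using e(3) by auto
    show "e (\<mu> 0) = c 0" using \<mu>(3) zero by simp
  qed (rule that)
  have 1: "\<mu> (\<nu> y) = y" if "y \<in> W" for y
  proof (rule unique_lift[where c = e and B = W and A = W and a = "\<mu> 0" and ?g1.0 = "\<lambda>y. \<mu> (\<nu> y)" and ?g2.0 = "\<lambda>y. y"])
    show "continuous_on W (\<lambda>y. \<mu> (\<nu> y))"
      by (rule continuous_on_compose2[OF \<mu>(1) \<nu>(1)]) (use \<nu>(2) in auto)
    show "(\<lambda>y. \<mu> (\<nu> y)) ` W \<subseteq> W" using \<nu>(2) \<mu>(2) by blast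
    show "e (\<mu> (\<nu> x)) = e x" if "x \<in> W" for x
      using \<mu>(3)[of "\<nu> x"] \<nu>(2,4) that by auto
  qed (use e W m0 \<nu> that in \<open>auto intro: convex_connected\<close>)
  have 2: "\<nu> (\<mu> z) = z" if "z \<in> unit_disk" for z
  proof (rule unique_lift[where c = c and B = unit_disk and A = unit_disk and a = 0 and ?g1.0 = "\<lambda>y. \<nu> (\<mu> y)" and ?g2.0 = "\<lambda>y. y"])
    show "continuous_on unit_disk (\<lambda>y. \<nu> (\<mu> y))"
      by (rule continuous_on_compose2[OF \<nu>(1) \<mu>(1)]) (use \<mu>(2) in auto)
    show "(\<lambda>y. \<nu> (\<mu> y)) ` unit_disk \<subseteq> unit_disk" using \<nu>(2) \<mu>(2) by blast
    show "c (\<nu> (\<mu> x)) = c x" if "x \<in> unit_disk" for x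
      using \<mu>(2,3) \<nu>(4)[of "\<mu> x"] that by auto
  qed (use c \<nu> zero that in auto)
  show ?thesis
    by (rule bij_betw_byWitness[where f' = \<nu>]) (use 1 2 \<mu>(2) \<nu>(2) in auto)
qed

section \<open>Coverings of a surface by the disk\<close>

locale disk_cover =
  fixes X :: "'a topology" and atlas :: "('a set \<times> ('a \<Rightarrow> complex)) set" and p :: "complex \<Rightarrow> 'a"
  assumes RS: "riemann_surface X atlas" and cover: "disk_universal_covering X atlas p"
begin

lemma p_continuous: "continuous_map (top_of_set unit_disk) X p" and p_onto: "p ` unit_disk = topspace X"
  using cover by (auto simp: disk_universal_covering_def covering_map_onto_def)

lemma open_vimage_p: "openin X U \<Longrightarrow> open (unit_disk \<inter> p -` U)"
  using openin_continuous_map_preimage[OF p_continuous, of U] openin_open_eq[OF open_unit_disk]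
  by (simp add: vimage_def Int_def)

lemma evenly_covered:
  assumes "x \<in> topspace X"
  obtains U \<V> where "openin X U" "x \<in> U" "\<Union>\<V> = unit_disk \<inter> p -` U" "\<And>V. V \<in> \<V> \<Longrightarrow> open V"
    "pairwise disjnt \<V>" "\<And>V. V \<in> \<V> \<Longrightarrow> homeomorphic_map (top_of_set V) (subtopology X U) p"
proof -
  have "\<exists>U. openin X U \<and> x \<in> U \<and> (\<exists>\<V>. \<Union>\<V> = unit_disk \<inter> p -` U \<and> (\<forall>V \<in> \<V>. open V) \<and> pairwise disjnt \<V> \<and>
             (\<forall>V \<in> \<V>. homeomorphic_map (top_of_set V) (subtopology X U) p))"
    using cover assms unfolding disk_universal_covering_def covering_map_onto_def by (elim conjE) (erule bspec)
  then show ?thesis using that by blast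
qed

lemma sheet:
  assumes "z \<in> unit_disk"
  obtains U V where "openin X U" "p z \<in> U" "open V" "z \<in> V" "V \<subseteq> unit_disk"
    "homeomorphic_map (top_of_set V) (subtopology X U) p"
proof -
  have "p z \<in> topspace X" using assms p_onto by blast
  then obtain U \<V> where *: "openin X U" "p z \<in> U" "\<Union>\<V> = unit_disk \<inter> p -` U" "\<And>V. V \<in> \<V> \<Longrightarrow> open V"
    "\<And>V. V \<in> \<V> \<Longrightarrow> homeomorphic_map (top_of_set V) (subtopology X U) p"
    by (rule evenly_covered) (rule that; assumption)
  then have "z \<in> \<Union>\<V>" using assms by simp
  then obtain V where "V \<in> \<V>" "z \<in> V" by blast
  with * show ?thesis by (intro that[of U V]) auto
qed

lemma p_locally_inj: "locally_inj_on p unit_disk"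
  unfolding locally_inj_on_def
proof
  fix z assume "z \<in> unit_disk"
  then obtain U V where "openin X U" "p z \<in> U" "open V" "z \<in> V" "V \<subseteq> unit_disk"
    "homeomorphic_map (top_of_set V) (subtopology X U) p"
    by (rule sheet)
  then show "\<exists>N. open N \<and> z \<in> N \<and> N \<subseteq> unit_disk \<and> inj_on p N"
    by (intro exI[of _ V]) (auto dest: homeomorphic_imp_injective_map)
qed

lemma p_open_map:
  assumes "open W" "W \<subseteq> unit_disk"
  shows "openin X (p ` W)"
proof (subst openin_subopen, intro ballI)
  fix x assume "x \<in> p ` W"
  then obtain z where z: "z \<in> W" "x = p z" by blast
  then have "z \<in> unit_disk" using assms by blast
  then obtain U V where *: "openin X U" "p z \<in> U" "open V" "z \<in> V" "V \<subseteq> unit_disk"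
    "homeomorphic_map (top_of_set V) (subtopology X U) p"
    by (rule sheet)
  have "openin (top_of_set V) (W \<inter> V)" using assms by (simp add: openin_open_Int Int_commute)
  then have "openin (subtopology X U) (p ` (W \<inter> V))"
    using homeomorphic_imp_open_map[OF *(6)] by (simp add: open_map_def)
  then have "openin X (p ` (W \<inter> V))" using *(1) openin_trans_full by blast
  then show "\<exists>T. openin X T \<and> x \<in> T \<and> T \<subseteq> p ` W" using z * by blast
qed

lemma chart_props:
  assumes "(U, \<phi>) \<in> atlas"
  shows "openin X U" "inj_on \<phi> U" "(\<phi> \<circ> p) holomorphic_on (unit_disk \<inter> p -` U)"
proof -
  show o: "openin X U" using RS assms by (auto simp: riemann_surface_def)
  have "homeomorphic_map (subtopology X U) (top_of_set (\<phi> ` U)) \<phi>"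
    using RS assms by (auto simp: riemann_surface_def)
  then have "inj_on \<phi> (topspace (subtopology X U))" by (rule homeomorphic_imp_injective_map)
  then show "inj_on \<phi> U" using openin_subset[OF o] by (simp add: Int_absorb1)
  show "(\<phi> \<circ> p) holomorphic_on (unit_disk \<inter> p -` U)"
    using cover assms by (auto simp: disk_universal_covering_def hol_into_def)
qed

lemma chart:
  assumes "x \<in> topspace X"
  obtains U \<phi> where "(U, \<phi>) \<in> atlas" "x \<in> U"
proof -
  have "x \<in> \<Union>(fst ` atlas)" using RS assms by (simp add: riemann_surface_def)
  then show ?thesis using that by auto
qed

lemma chart_locally_inj:
  assumes "(U, \<phi>) \<in> atlas"
  shows "locally_inj_on (\<phi> \<circ> p) (unit_disk \<inter> p -` U)"
  unfolding locally_inj_on_def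
proof
  fix y assume y: "y \<in> unit_disk \<inter> p -` U"
  obtain N where N: "open N" "y \<in> N" "N \<subseteq> unit_disk" "inj_on p N"
    using locally_inj_onE[OF p_locally_inj, of y] y by auto
  then show "\<exists>N. open N \<and> y \<in> N \<and> N \<subseteq> unit_disk \<inter> p -` U \<and> inj_on (\<phi> \<circ> p) N"
    using y open_vimage_p[OF chart_props(1)[OF assms]] chart_props(2)[OF assms]
    by (intro exI[of _ "N \<inter> (unit_disk \<inter> p -` U)"] conjI comp_inj_on) (auto intro: inj_on_subset)
qed

text \<open>In a chart around \<open>p z\<close> the map \<open>g\<close> is a continuous lift of
  the holomorphic map \<open>\<phi> \<circ> p\<close> through the locally injective
  \<open>\<phi> \<circ> p\<close>.\<close>

lemma deck_holomorphic:
  assumes g: "continuous_on unit_disk g" "g ` unit_disk \<subseteq> unit_disk" and pg: "\<And>z. z \<in> unit_disk \<Longrightarrow> p (g z) = p z"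
  shows "g holomorphic_on unit_disk"
proof -
  have "g field_differentiable (at z)" if z: "z \<in> unit_disk" for z
  proof -
    have "p z \<in> topspace X" using z p_onto by blast
    then obtain U \<phi> where U: "(U, \<phi>) \<in> atlas" "p z \<in> U" by (rule chart)
    note U' = chart_props[OF U(1)]
    have gz: "g z \<in> unit_disk" using g z by blast
    define N where "N = unit_disk \<inter> p -` U"
    have N: "open N" "g z \<in> N" using open_vimage_p[OF U'(1)] gz pg[OF z] U(2) by (auto simp: N_def)
    define M where "M = unit_disk \<inter> g -` N"
    have M: "open M" "z \<in> M" using continuous_open_preimage[OF g(1) open_unit_disk N(1)] z N by (auto simp: M_def)
    have "g holomorphic_on M"
    proof (rule holomorphic_lift[where c = "\<phi> \<circ> p" and f = "\<phi> \<circ> p" and B = N])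
      show "\<phi> \<circ> p holomorphic_on M" using U'(3)
        by (rule holomorphic_on_subset) (use pg in \<open>auto simp: M_def N_def\<close>)
      show "continuous_on M g" using g(1) by (rule continuous_on_subset) (auto simp: M_def)
      show "locally_inj_on (\<phi> \<circ> p) N" unfolding N_def by (rule chart_locally_inj[OF U(1)])
    qed (use M U'(3) pg in \<open>auto simp: M_def N_def\<close>)
    then show ?thesis using M by (simp add: holomorphic_on_imp_differentiable_at)
  qed
  then show ?thesis unfolding holomorphic_on_def by (simp add: field_differentiable_at_within)
qed

text \<open>The fibre product of \<open>p\<close> with itself. It is a set of pairs of complex
  numbers, so \<open>covering_space\<close> applies to its first projection, although
  \<open>X\<close> itself is only a value of type \<open>'a topology\<close>.\<close>

definition fibre_pairs :: "(complex \<times> complex) set" where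
  "fibre_pairs = {(z1, z2). z1 \<in> unit_disk \<and> z2 \<in> unit_disk \<and> p z1 = p z2}"

text \<open>Over a sheet \<open>V0\<close> the pairs split according to the sheet \<open>V\<close>
  that contains the second component. On each part this component is \<open>k (p v)\<close>, with
  \<open>k\<close> the inverse of \<open>p\<close> on \<open>V\<close>.\<close>

lemma covering_space_fibre_pairs: "covering_space fibre_pairs fst unit_disk"
proof
  show "continuous_on fibre_pairs fst" by (intro continuous_intros)
  show "fst ` fibre_pairs = unit_disk" by (force simp: fibre_pairs_def image_iff)
  fix z assume z: "z \<in> unit_disk"
  then have "p z \<in> topspace X" using p_onto by blast
  then obtain U \<V> where *: "openin X U" "p z \<in> U" "\<Union>\<V> = unit_disk \<inter> p -` U" "\<And>V. V \<in> \<V> \<Longrightarrow> open V"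
    "pairwise disjnt \<V>" "\<And>V. V \<in> \<V> \<Longrightarrow> homeomorphic_map (top_of_set V) (subtopology X U) p"
    by (rule evenly_covered) (rule that; assumption)
  have "z \<in> \<Union>\<V>" using z * by simp
  then obtain V0 where V0: "V0 \<in> \<V>" "z \<in> V0" by blast
  have Vsub: "V \<subseteq> unit_disk" "p ` V = U" if "V \<in> \<V>" for V
  proof -
    show "V \<subseteq> unit_disk" using *(3) that by blast
    have "p ` topspace (top_of_set V) = topspace (subtopology X U)"
      using homeomorphic_imp_surjective_map[OF *(6)[OF that]] .
    then show "p ` V = U" using openin_subset[OF *(1)] by (simp add: Int_absorb1)
  qed
  define sh where "sh V = fibre_pairs \<inter> (V0 \<times> V)" for V
  have "\<Union>(sh ` \<V>) = fibre_pairs \<inter> fst -` V0"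
  proof -
    have "\<exists>V\<in>\<V>. w \<in> V" if "(v, w) \<in> fibre_pairs" "v \<in> V0" for v w
    proof -
      have "p v \<in> U" using Vsub[OF V0(1)] that by blast
      then have "w \<in> unit_disk \<inter> p -` U" using that by (auto simp: fibre_pairs_def)
      then show ?thesis using *(3) by blast
    qed
    then show ?thesis by (auto simp: sh_def)
  qed
  moreover have "openin (top_of_set fibre_pairs) (sh V)" if "V \<in> \<V>" for V
    using *(4)[OF that] *(4)[OF V0(1)] by (simp add: sh_def openin_open_Int open_Times)
  moreover have "pairwise disjnt (sh ` \<V>)"
    using *(5) by (force simp: pairwise_def disjnt_def sh_def)
  moreover have "\<exists>q. homeomorphism (sh V) V0 fst q" if V: "V \<in> \<V>" for V
  proof -
    obtain k where k: "homeomorphic_maps (top_of_set V) (subtopology X U) p k"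
      using *(6)[OF V] unfolding homeomorphic_map_maps by blast
    have kU: "k x \<in> V" "p (k x) = x" if "x \<in> U" for x
      using k that openin_subset[OF *(1)] continuous_map_image_subset_topspace[of "subtopology X U" "top_of_set V" k]
      by (auto simp: homeomorphic_maps_def Int_absorb1)
    have kp: "k (p v) = v" if "v \<in> V" for v
      using k that by (auto simp: homeomorphic_maps_def)
    have "continuous_map (top_of_set V0) (subtopology X U) p"
      using *(6)[OF V0(1)] by (rule homeomorphic_imp_continuous_map)
    moreover have "continuous_map (subtopology X U) (top_of_set V) k"
      using k by (auto simp: homeomorphic_maps_def)
    ultimately have "continuous_map (top_of_set V0) (top_of_set V) (k \<circ> p)" by (rule continuous_map_compose)
    then have kc: "continuous_on V0 (\<lambda>v. k (p v))" by (auto simp: o_def)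
    have U0: "p v \<in> U" if "v \<in> V0" for v using Vsub[OF V0(1)] that by blast
    have "homeomorphism (sh V) V0 fst (\<lambda>v. (v, k (p v)))"
    proof (rule homeomorphismI)
      show "continuous_on (sh V) fst" by (intro continuous_intros)
      show "continuous_on V0 (\<lambda>v. (v, k (p v)))" by (intro continuous_intros kc)
      show "fst ` sh V \<subseteq> V0" by (auto simp: sh_def)
      show "(\<lambda>v. (v, k (p v))) ` V0 \<subseteq> sh V"
        using kU U0 subsetD[OF Vsub(1)[OF V]] subsetD[OF Vsub(1)[OF V0(1)]]
        by (auto simp: sh_def fibre_pairs_def)
      show "(fst x, k (p (fst x))) = x" if "x \<in> sh V" for x
        using that kp by (auto simp: sh_def fibre_pairs_def)
    qed auto
    then show ?thesis by blast
  qed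
  ultimately show "\<exists>T. z \<in> T \<and> openin (top_of_set unit_disk) T \<and>
          (\<exists>v. \<Union>v = fibre_pairs \<inter> fst -` T \<and> (\<forall>u\<in>v. openin (top_of_set fibre_pairs) u) \<and>
            pairwise disjnt v \<and> (\<forall>u\<in>v. \<exists>q. homeomorphism u T fst q))"
    using V0 *(4)[OF V0(1)] Vsub[OF V0(1)]
    by (intro exI[of _ V0] conjI exI[of _ "sh ` \<V>"]) (auto simp: openin_open_eq)
qed

definition deck :: "(complex \<Rightarrow> complex) set" where
  "deck = {g. g holomorphic_on unit_disk \<and> bij_betw g unit_disk unit_disk \<and> (\<forall>z\<in>unit_disk. p (g z) = p z)}"

lemma deck_unique:
  assumes "continuous_on unit_disk g" "g ` unit_disk \<subseteq> unit_disk" "\<And>z. z \<in> unit_disk \<Longrightarrow> p (g z) = p z"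
    and "a \<in> unit_disk" "g a = a" "z \<in> unit_disk"
  shows "g z = z"
  by (rule unique_lift[OF p_locally_inj assms(1,2) _ _ _ connected_unit_disk open_unit_disk assms(4) _ assms(6),
        where ?g2.0 = "\<lambda>z. z"])
     (use assms in auto)

text \<open>The disk is simply connected, so the first projection of \<open>fibre_pairs\<close> has
  a section through \<open>(z1, z2)\<close>; its second component is \<open>g\<close>. Exchanging
  \<open>z1\<close> and \<open>z2\<close> gives the inverse.\<close>

lemma deck_transitive:
  assumes z: "z1 \<in> unit_disk" "z2 \<in> unit_disk" "p z1 = p z2"
  shows "\<exists>g\<in>deck. g z1 = z2"
proof -
  have ex: "\<exists>g. continuous_on unit_disk g \<and> g ` unit_disk \<subseteq> unit_disk \<and> (\<forall>z\<in>unit_disk. p (g z) = p z) \<and> g z1 = z2"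
    if z: "z1 \<in> unit_disk" "z2 \<in> unit_disk" "p z1 = p z2" for z1 z2
  proof -
    have mem: "(z1, z2) \<in> fibre_pairs" using z by (simp add: fibre_pairs_def)
    have conv: "convex unit_disk" by (simp add: unit_disk_def)
    obtain G where G: "continuous_on unit_disk G" "G \<in> unit_disk \<rightarrow> fibre_pairs" "G z1 = (z1, z2)"
      "\<And>y. y \<in> unit_disk \<Longrightarrow> fst (G y) = y"
      by (rule covering_space_lift_strong[OF covering_space_fibre_pairs mem z(1) convex_imp_simply_connected[OF conv]
            convex_imp_locally_path_connected[OF conv] continuous_on_id])
         (use that in auto)
    have "snd (G y) \<in> unit_disk \<and> p (snd (G y)) = p y" if "y \<in> unit_disk" for y
      using G(2,4) that by (force simp: fibre_pairs_def Pi_iff)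
    then show ?thesis using G(1,3)
      by (intro exI[of _ "\<lambda>y. snd (G y)"]) (auto intro: continuous_intros)
  qed
  obtain g where g: "continuous_on unit_disk g" "g ` unit_disk \<subseteq> unit_disk" "\<forall>z\<in>unit_disk. p (g z) = p z" "g z1 = z2"
    using ex[OF z] by blast
  obtain k where k: "continuous_on unit_disk k" "k ` unit_disk \<subseteq> unit_disk" "\<forall>z\<in>unit_disk. p (k z) = p z" "k z2 = z1"
    using ex[OF z(2,1) z(3)[symmetric]] by blast
  have kg: "k (g z) = z" if "z \<in> unit_disk" for z
    by (rule deck_unique[where g = "\<lambda>z. k (g z)" and a = z1])
       (use g k z that in \<open>auto simp: image_subset_iff intro: continuous_on_compose2[OF k(1) g(1)]\<close>)
  have gk: "g (k z) = z" if "z \<in> unit_disk" for z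
    by (rule deck_unique[where g = "\<lambda>z. g (k z)" and a = z2])
       (use g k z that in \<open>auto simp: image_subset_iff intro: continuous_on_compose2[OF g(1) k(1)]\<close>)
  have "bij_betw g unit_disk unit_disk"
    by (rule bij_betw_byWitness[where f' = k]) (use kg gk g k in auto)
  then have "g \<in> deck" using deck_holomorphic[OF g(1,2)] g(3) by (auto simp: deck_def)
  then show ?thesis using g(4) by blast
qed

end

lemma holomorphic_onI_local:
  assumes "\<And>y. y \<in> A \<Longrightarrow> \<exists>M g. open M \<and> y \<in> M \<and> g holomorphic_on M \<and> (\<forall>w\<in>M. f w = g w)"
  shows "f holomorphic_on A"
  unfolding holomorphic_on_def
proof
  fix y assume "y \<in> A"
  from assms[OF this] obtain M g where M: "open M" "y \<in> M" "g holomorphic_on M" "\<forall>w\<in>M. f w = g w" by (elim exE conjE) (rule that; assumption)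
  then have "f holomorphic_on M" by - (rule holomorphic_transform[OF M(3)], rule bspec[OF M(4), symmetric])
  then show "f field_differentiable (at y within A)"
    using M by (simp add: field_differentiable_at_within holomorphic_on_imp_differentiable_at)
qed

lemma holomorphic_local_inverse:
  assumes c: "c holomorphic_on B" "locally_inj_on c B" and y: "y \<in> B"
  obtains N k where "open N" "y \<in> N" "N \<subseteq> B" "inj_on c N" "open (c ` N)" "k holomorphic_on c ` N" "\<And>w. w \<in> N \<Longrightarrow> k (c w) = w"
proof -
  obtain N where N: "open N" "y \<in> N" "N \<subseteq> B" "inj_on c N" using locally_inj_onE[OF c(2) y] .
  have h: "c holomorphic_on N" using c(1) N(3) by (rule holomorphic_on_subset)
  obtain k where "k holomorphic_on c ` N" "\<And>w. w \<in> N \<Longrightarrow> k (c w) = w"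
    using holomorphic_has_inverse[OF h N(1,4)] by metis
  then show ?thesis using that N open_mapping_thm3[OF h N(1,4)] by blast
qed

lemma locally_inj_open_map:
  assumes c: "c holomorphic_on B" "locally_inj_on c B" and W: "open W" "W \<subseteq> B"
  shows "open (c ` W)"
proof (subst open_subopen, intro ballI)
  fix x assume "x \<in> c ` W"
  then obtain y where y: "y \<in> W" "x = c y" by blast
  then have "y \<in> B" using W by blast
  then obtain N where N: "open N" "y \<in> N" "N \<subseteq> B" "inj_on c N" using locally_inj_onE[OF c(2)] by blast
  have "c holomorphic_on N \<inter> W" using c(1) by (rule holomorphic_on_subset) (use N in auto)
  then have "open (c ` (N \<inter> W))"
    by (rule open_mapping_thm3) (use N W in \<open>auto intro: inj_on_subset\<close>)
  then show "\<exists>T. open T \<and> x \<in> T \<and> T \<subseteq> c ` W" using y N by blast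
qed

context disk_cover
begin

lemma quotient_p: "quotient_map (top_of_set unit_disk) X p"
proof (rule continuous_open_imp_quotient_map[OF p_continuous])
  show "open_map (top_of_set unit_disk) X p"
    unfolding open_map_def using p_open_map by (auto simp: openin_open_eq)
qed (simp add: p_onto)

lemma locally_inj_same_fibres:
  assumes "\<And>z1 z2. z1 \<in> unit_disk \<Longrightarrow> z2 \<in> unit_disk \<Longrightarrow> q z1 = q z2 \<longleftrightarrow> p z1 = p z2"
  shows "locally_inj_on q unit_disk"
  unfolding locally_inj_on_def
proof
  fix y assume "y \<in> unit_disk"
  then obtain N where N: "open N" "y \<in> N" "N \<subseteq> unit_disk" "inj_on p N" using locally_inj_onE[OF p_locally_inj] by blast
  moreover have "inj_on q N"
    using N(3,4) assms unfolding inj_on_def by blast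
  ultimately show "\<exists>N. open N \<and> y \<in> N \<and> N \<subseteq> unit_disk \<and> inj_on q N" by blast
qed

text \<open>\<open>p\<close> and \<open>q\<close> are quotient maps of the disk with the same
  fibres, so their quotients are homeomorphic. Local inverses of \<open>\<phi> \<circ> p\<close> and
  of \<open>q\<close> show that the homeomorphism is conformal in both directions.\<close>

lemma conf_equiv_same_fibres:
  assumes q: "q holomorphic_on unit_disk" "q ` unit_disk = S" and S: "open S"
    and fib: "\<And>z1 z2. z1 \<in> unit_disk \<Longrightarrow> z2 \<in> unit_disk \<Longrightarrow> q z1 = q z2 \<longleftrightarrow> p z1 = p z2"
  shows "conf_equiv X atlas S"
proof -
  define h where "h x = q (SOME z. z \<in> unit_disk \<and> p z = x)" for x
  have hp: "h (p z) = q z" if z: "z \<in> unit_disk" for z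
  proof -
    have "(SOME z'. z' \<in> unit_disk \<and> p z' = p z) \<in> unit_disk \<and> p (SOME z'. z' \<in> unit_disk \<and> p z' = p z) = p z"
      by (rule someI[of _ z]) (use z in simp)
    then show ?thesis using fib z by (simp add: h_def)
  qed
  have qi: "locally_inj_on q unit_disk" using fib by (rule locally_inj_same_fibres)
  have cq: "continuous_map (top_of_set unit_disk) (top_of_set S) q"
    using q by (auto simp: holomorphic_on_imp_continuous_on)
  have "quotient_map (top_of_set unit_disk) (top_of_set S) q"
  proof (rule continuous_open_imp_quotient_map[OF cq])
    show "open_map (top_of_set unit_disk) (top_of_set S) q"
      unfolding open_map_def
      using locally_inj_open_map[OF q(1) qi] q(2) S by (auto simp: openin_open_eq)
  qed (use q in simp)
  then have qhp: "quotient_map (top_of_set unit_disk) (top_of_set S) (h \<circ> p)"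
    by (rule quotient_map_eq) (simp add: hp)
  have hq: "quotient_map X (top_of_set S) h"
    using quotient_map_compose_eq[OF quotient_p] qhp by blast
  have inj: "inj_on h (topspace X)"
  proof (rule inj_onI)
    fix x y assume "x \<in> topspace X" "y \<in> topspace X" and e: "h x = h y"
    then obtain z w where "z \<in> unit_disk" "x = p z" "w \<in> unit_disk" "y = p w" using p_onto by blast
    then show "x = y" using e hp fib by simp
  qed
  have hom: "homeomorphic_map X (top_of_set S) h" using hq inj by (simp add: homeomorphic_map_def)
  have hfrom: "hol_from X atlas h"
    unfolding hol_from_def
  proof (clarify)
    fix U \<phi> assume U: "(U, \<phi>) \<in> atlas"
    note cp = chart_props[OF U]
    show "(h \<circ> inv_into U \<phi>) holomorphic_on \<phi> ` U"
    proof (rule holomorphic_onI_local)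
      fix y assume "y \<in> \<phi> ` U"
      then obtain x where x: "x \<in> U" "y = \<phi> x" by blast
      then obtain z where z: "z \<in> unit_disk" "x = p z" using openin_subset[OF cp(1)] p_onto by blast
      have zU: "z \<in> unit_disk \<inter> p -` U" using x z by simp
      obtain N k where N: "open N" "z \<in> N" "N \<subseteq> unit_disk \<inter> p -` U" "inj_on (\<phi> \<circ> p) N" "open ((\<phi> \<circ> p) ` N)"
        "k holomorphic_on (\<phi> \<circ> p) ` N" "\<And>w. w \<in> N \<Longrightarrow> k ((\<phi> \<circ> p) w) = w"
        by (rule holomorphic_local_inverse[OF cp(3) chart_locally_inj[OF U] zU]) (rule that; assumption)
      have "q \<circ> k holomorphic_on (\<phi> \<circ> p) ` N"
      proof (rule holomorphic_on_compose[OF N(6)])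
        show "q holomorphic_on k ` (\<phi> \<circ> p) ` N"
        proof (rule holomorphic_on_subset[OF q(1)], intro subsetI)
          fix w assume "w \<in> k ` (\<phi> \<circ> p) ` N"
          then obtain v where v: "v \<in> N" "w = k ((\<phi> \<circ> p) v)" by blast
          then have "w = v" using N(7) by simp
          then show "w \<in> unit_disk" using v(1) N(3) by blast
        qed
      qed
      moreover have "(h \<circ> inv_into U \<phi>) w = (q \<circ> k) w" if w: "w \<in> (\<phi> \<circ> p) ` N" for w
      proof -
        obtain v where v: "v \<in> N" "w = \<phi> (p v)" using w by auto
        then have "p v \<in> U" "v \<in> unit_disk" using N(3) by auto
        then have "inv_into U \<phi> w = p v" using v cp(2) by simp
        then show ?thesis using N(7)[OF v(1)] hp \<open>v \<in> unit_disk\<close> v by simp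
      qed
      moreover have "y \<in> (\<phi> \<circ> p) ` N" using x z N(2) by auto
      ultimately show "\<exists>M g. open M \<and> y \<in> M \<and> g holomorphic_on M \<and> (\<forall>w\<in>M. (h \<circ> inv_into U \<phi>) w = g w)"
        using N(5) by (intro exI[of _ "(\<phi> \<circ> p) ` N"] exI[of _ "q \<circ> k"] conjI ballI)
    qed
  qed
  have surj: "h ` topspace X = S" using homeomorphic_imp_surjective_map[OF hom] by simp
  have invh: "inv_into (topspace X) h (q z) = p z" if "z \<in> unit_disk" for z
  proof -
    have "p z \<in> topspace X" using that p_onto by blast
    from inv_into_f_f[OF inj this] show ?thesis using hp[OF that] by simp
  qed
  have "continuous_map (top_of_set S) X (inv_into (topspace X) h)"
  proof -
    obtain g where g: "homeomorphic_maps X (top_of_set S) h g" using hom homeomorphic_map_maps by blast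
    have "g y = inv_into (topspace X) h y" if "y \<in> S" for y
    proof -
      obtain x where "x \<in> topspace X" "y = h x" using surj \<open>y \<in> S\<close> by blast
      then show ?thesis using g inj by (simp add: homeomorphic_maps_def)
    qed
    moreover have "continuous_map (top_of_set S) X g" using g by (simp add: homeomorphic_maps_def)
    ultimately show ?thesis by - (rule continuous_map_eq[of "top_of_set S" X g], simp_all)
  qed
  moreover have "(\<phi> \<circ> inv_into (topspace X) h) holomorphic_on (S \<inter> inv_into (topspace X) h -` U)" if U: "(U, \<phi>) \<in> atlas" for U \<phi>
  proof (rule holomorphic_onI_local)
    note cp = chart_props[OF U]
    fix y assume y: "y \<in> S \<inter> inv_into (topspace X) h -` U"
    then obtain z where z: "z \<in> unit_disk" "y = q z" using q(2) by auto
    then have pz: "p z \<in> U" using y invh by auto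
    define B where "B = unit_disk \<inter> p -` U"
    have B: "open B" "z \<in> B" using open_vimage_p[OF cp(1)] z pz by (auto simp: B_def)
    obtain N k where N: "open N" "z \<in> N" "N \<subseteq> unit_disk" "inj_on q N"
      "k holomorphic_on q ` N" "\<And>w. w \<in> N \<Longrightarrow> k (q w) = w"
      by (rule holomorphic_local_inverse[OF q(1) qi z(1)]) (rule that; assumption)
    have "open (q ` (N \<inter> B))" by (rule locally_inj_open_map[OF q(1) qi]) (use N B in auto)
    moreover have "(\<phi> \<circ> p) \<circ> k holomorphic_on q ` (N \<inter> B)"
    proof (rule holomorphic_on_compose)
      show "k holomorphic_on q ` (N \<inter> B)"
        by (rule holomorphic_on_subset[OF N(5)]) (rule image_mono, rule Int_lower1)
      show "(\<phi> \<circ> p) holomorphic_on k ` q ` (N \<inter> B)"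
      proof (rule holomorphic_on_subset[OF cp(3)], intro subsetI)
        fix w assume "w \<in> k ` q ` (N \<inter> B)"
        then obtain v where "v \<in> N" "v \<in> B" "w = k (q v)" by blast
        then show "w \<in> unit_disk \<inter> p -` U" using N(6)[of v] by (simp add: B_def)
      qed
    qed
    moreover have "(\<phi> \<circ> inv_into (topspace X) h) w = ((\<phi> \<circ> p) \<circ> k) w" if w: "w \<in> q ` (N \<inter> B)" for w
    proof -
      obtain v where v: "v \<in> N" "w = q v" using w by blast
      have "v \<in> unit_disk" using v(1) N(3) by blast
      then show ?thesis using invh[of v] N(6)[OF v(1)] v(2) by simp
    qed
    moreover have "y \<in> q ` (N \<inter> B)"
      by (rule image_eqI[of _ _ z]) (simp_all add: z(2) N(2) B(2))
    ultimately show "\<exists>M g. open M \<and> y \<in> M \<and> g holomorphic_on M \<and> (\<forall>w\<in>M. (\<phi> \<circ> inv_into (topspace X) h) w = g w)"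
      by (intro exI[of _ "q ` (N \<inter> B)"] exI[of _ "(\<phi> \<circ> p) \<circ> k"] conjI ballI)
  qed
  ultimately have "hol_into X atlas S (inv_into (topspace X) h)"
    unfolding hol_into_def by (intro conjI; clarify)
  then show ?thesis using hom hfrom unfolding conf_equiv_def by (intro exI[of _ h] conjI)
qed

text \<open>Composing \<open>p\<close> with the equivalence replaces the abstract surface by the
  plane domain \<open>S\<close>, to which the lifting theorems for \<open>covering_space\<close>
  apply.\<close>

lemma conf_equiv_imp_covering_space:
  assumes "conf_equiv X atlas S" and S: "open S"
  obtains c where "c holomorphic_on unit_disk" "locally_inj_on c unit_disk" "covering_space unit_disk c S"
    "\<And>z1 z2. z1 \<in> unit_disk \<Longrightarrow> z2 \<in> unit_disk \<Longrightarrow> c z1 = c z2 \<longleftrightarrow> p z1 = p z2"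
proof -
  obtain h where h: "homeomorphic_map X (top_of_set S) h" "hol_from X atlas h"
    using assms unfolding conf_equiv_def by blast
  define c where "c = h \<circ> p"
  have inj: "inj_on h (topspace X)" using h(1) by (rule homeomorphic_imp_injective_map)
  have pX: "p z \<in> topspace X" if "z \<in> unit_disk" for z using that p_onto by blast
  have fib: "c z1 = c z2 \<longleftrightarrow> p z1 = p z2" if "z1 \<in> unit_disk" "z2 \<in> unit_disk" for z1 z2
    using inj_on_eq_iff[OF inj pX[OF that(1)] pX[OF that(2)]] by (simp add: c_def)
  have li: "locally_inj_on c unit_disk" using fib by (rule locally_inj_same_fibres)
  have hol: "c holomorphic_on unit_disk"
  proof (rule holomorphic_onI_local)
    fix z assume z: "z \<in> unit_disk"
    obtain U \<phi> where U: "(U, \<phi>) \<in> atlas" "p z \<in> U" using chart[OF pX[OF z]] .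
    note cp = chart_props[OF U(1)]
    have hf: "(h \<circ> inv_into U \<phi>) holomorphic_on \<phi> ` U" using h(2) U(1) by (auto simp: hol_from_def)
    have "(h \<circ> inv_into U \<phi>) \<circ> (\<phi> \<circ> p) holomorphic_on (unit_disk \<inter> p -` U)"
      by (rule holomorphic_on_compose[OF cp(3)]) (rule holomorphic_on_subset[OF hf], auto)
    moreover have "c w = ((h \<circ> inv_into U \<phi>) \<circ> (\<phi> \<circ> p)) w" if "w \<in> unit_disk \<inter> p -` U" for w
      using that cp(2) by (simp add: c_def)
    ultimately show "\<exists>M g. open M \<and> z \<in> M \<and> g holomorphic_on M \<and> (\<forall>w\<in>M. c w = g w)"
      using open_vimage_p[OF cp(1)] z U(2)
      by (intro exI[of _ "unit_disk \<inter> p -` U"] exI[of _ "(h \<circ> inv_into U \<phi>) \<circ> (\<phi> \<circ> p)"] conjI ballI) auto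
  qed
  have surj: "c ` unit_disk = S"
    using homeomorphic_imp_surjective_map[OF h(1)] p_onto by (auto simp: c_def simp flip: image_image)
  have "covering_space unit_disk c S"
  proof
    show "continuous_on unit_disk c" using hol by (rule holomorphic_on_imp_continuous_on)
    show "c ` unit_disk = S" by (rule surj)
    fix y assume "y \<in> S"
    then obtain z where z: "z \<in> unit_disk" "y = c z" using surj by blast
    obtain U \<V> where *: "openin X U" "p z \<in> U" "\<Union>\<V> = unit_disk \<inter> p -` U" "\<And>V. V \<in> \<V> \<Longrightarrow> open V"
      "pairwise disjnt \<V>" "\<And>V. V \<in> \<V> \<Longrightarrow> homeomorphic_map (top_of_set V) (subtopology X U) p"
      by (rule evenly_covered[OF pX[OF z(1)]]) (rule that; assumption)
    have Vsub: "V \<subseteq> unit_disk" "c ` V = h ` U" "inj_on p V" if "V \<in> \<V>" for V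
    proof -
      show "V \<subseteq> unit_disk" using *(3) that by blast
      have "p ` V = U" using homeomorphic_imp_surjective_map[OF *(6)[OF that]] openin_subset[OF *(1)] by (simp add: Int_absorb1)
      then show "c ` V = h ` U" by (auto simp: c_def simp flip: image_image)
      show "inj_on p V" using homeomorphic_imp_injective_map[OF *(6)[OF that]] by simp
    qed
    have "z \<in> \<Union>\<V>" using z * by simp
    then obtain V0 where V0: "V0 \<in> \<V>" "z \<in> V0" by blast
    have oT: "open (h ` U)" using locally_inj_open_map[OF hol li *(4)[OF V0(1)] Vsub(1)[OF V0(1)]] Vsub(2)[OF V0(1)] by simp
    have "\<Union>\<V> = unit_disk \<inter> c -` (h ` U)"
    proof -
      have "c w \<in> h ` U \<longleftrightarrow> p w \<in> U" if "w \<in> unit_disk" for w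
        using inj_on_image_mem_iff[OF inj pX[OF that] openin_subset[OF *(1)]] by (simp add: c_def)
      then show ?thesis using *(3) by blast
    qed
    moreover have "\<exists>q. homeomorphism V (h ` U) c q" if V: "V \<in> \<V>" for V
    proof -
      have "continuous_on V c" using hol Vsub(1)[OF V] by (meson holomorphic_on_imp_continuous_on holomorphic_on_subset)
      moreover have "inj_on c V" using Vsub(3)[OF V] fib Vsub(1)[OF V] unfolding inj_on_def by blast
      moreover have "openin (top_of_set (h ` U)) (c ` W)" if "openin (top_of_set V) W" for W
      proof -
        have W: "open W" "W \<subseteq> V" using that *(4)[OF V] by (auto simp: openin_open_eq)
        then have "open (c ` W)" using locally_inj_open_map[OF hol li] Vsub(1)[OF V] by blast
        then show ?thesis using image_mono[OF W(2), of c] Vsub(2)[OF V] oT by (simp add: openin_open_eq)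
      qed
      ultimately obtain k where "homeomorphism V (h ` U) c k"
        by - (rule homeomorphism_injective_open_map[OF _ Vsub(2)[OF V]])
      then show ?thesis by blast
    qed
    moreover have "y \<in> h ` U" using z * by (simp add: c_def)
    moreover have "h ` U \<subseteq> S" using Vsub[OF V0(1)] surj by blast
    moreover have "openin (top_of_set unit_disk) V" if "V \<in> \<V>" for V
      using *(4)[OF that] Vsub(1)[OF that] by (simp add: openin_open_eq)
    ultimately show "\<exists>T. y \<in> T \<and> openin (top_of_set S) T \<and>
          (\<exists>v. \<Union>v = unit_disk \<inter> c -` T \<and> (\<forall>u\<in>v. openin (top_of_set unit_disk) u) \<and>
            pairwise disjnt v \<and> (\<forall>u\<in>v. \<exists>q. homeomorphism u T c q))"
      using *(5) oT S by (intro exI[of _ "h ` U"] conjI exI[of _ \<V>]) (auto simp: openin_open_eq)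
  qed
  then show ?thesis using that hol li fib by blast
qed

end

section \<open>Plane domains as hyperbolic surfaces\<close>

lemma riemann_surface_std:
  assumes "open S" "connected S" "S \<noteq> {}"
  shows "riemann_surface (top_of_set S) (std_atlas S)"
proof -
  have "homeomorphic_map (top_of_set S) (top_of_set S) id" by (simp add: homeomorphic_map_id)
  moreover have "(id \<circ> inv_into S id) holomorphic_on S"
    by (rule holomorphic_transform[of id]) (auto simp: holomorphic_on_id)
  ultimately show ?thesis
    using assms unfolding riemann_surface_def std_atlas_def
    by (auto simp: Hausdorff_space_subtopology connected_space_subtopology subtopology_subtopology)
qed

lemma conf_equiv_std:
  assumes "open S"
  shows "conf_equiv (top_of_set S) (std_atlas S) S"
proof -
  have i: "(id \<circ> inv_into S id) holomorphic_on S"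
    by (rule holomorphic_transform[of id]) (auto simp: holomorphic_on_id)
  have "(id \<circ> inv_into S id) holomorphic_on (S \<inter> inv_into S id -` S)"
    by (rule holomorphic_on_subset[OF i]) auto
  moreover have "continuous_map (top_of_set S) (top_of_set S) (inv_into S id)"
    by (rule continuous_map_eq[of _ _ id]) auto
  ultimately show ?thesis
    unfolding conf_equiv_def hol_from_def hol_into_def std_atlas_def
    by (intro exI[of _ id]) (use i in \<open>auto simp: homeomorphic_map_id\<close>)
qed

text \<open>For the model surfaces: \<open>\<mu>\<close> identifies the disk with \<open>W\<close>,
  and \<open>e\<close> is the quotient by the translations through multiples of
  \<open>t\<close>.\<close>

lemma disk_universal_covering_std:
  assumes S: "open S" and W: "open W" and tr: "\<And>\<zeta> (r::real). \<zeta> \<in> W \<Longrightarrow> \<zeta> + of_real r \<in> W"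
    and \<mu>: "\<mu> holomorphic_on unit_disk" "bij_betw \<mu> unit_disk W"
    and e: "e holomorphic_on W" "e ` W = S" and t: "t > 0"
    and ee: "\<And>\<zeta>1 \<zeta>2. \<zeta>1 \<in> W \<Longrightarrow> \<zeta>2 \<in> W \<Longrightarrow> e \<zeta>1 = e \<zeta>2 \<longleftrightarrow> (\<exists>n::int. \<zeta>1 = \<zeta>2 + of_real (of_int n * t))"
  shows "disk_universal_covering (top_of_set S) (std_atlas S) (e \<circ> \<mu>)"
proof -
  have \<mu>W: "\<mu> ` unit_disk = W" "inj_on \<mu> unit_disk" using \<mu>(2) by (auto simp: bij_betw_def)
  have qhol: "(e \<circ> \<mu>) holomorphic_on unit_disk"
    by (rule holomorphic_on_compose[OF \<mu>(1)]) (use e \<mu>W in simp)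
  have qS: "(e \<circ> \<mu>) ` unit_disk = S" using e(2) \<mu>W(1) by (metis image_comp)
  have ev: "\<exists>U. openin (top_of_set S) U \<and> y \<in> U \<and>
        (\<exists>\<V>. \<Union>\<V> = unit_disk \<inter> (e \<circ> \<mu>) -` U \<and> (\<forall>V \<in> \<V>. open V) \<and> pairwise disjnt \<V> \<and>
             (\<forall>V \<in> \<V>. homeomorphic_map (top_of_set V) (subtopology (top_of_set S) U) (e \<circ> \<mu>)))"
    if y: "y \<in> S" for y
  proof -
    obtain a where a: "a \<in> W" "e a = y" using y e(2) by blast
    \<comment> \<open>Half the period as radius: two points of one ball differ by less than
      \<open>t\<close>, so \<open>e\<close> is injective on it, and the centres lie at least
      \<open>t\<close> apart, so the balls are disjoint.\<close>
    define B where "B n = W \<inter> ball (a + of_real (of_int n * t)) (t / 2)" for n :: int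
    define V where "V n = unit_disk \<inter> \<mu> -` B n" for n
    define U where "U = e ` B 0"
    have oB: "open (B n)" for n using W by (simp add: B_def open_Int)
    have inje: "inj_on e (B n)" for n
    proof (rule inj_onI)
      fix x y assume x: "x \<in> B n" and y: "y \<in> B n" and "e x = e y"
      then obtain m :: int where m: "x = y + of_real (of_int m * t)" using ee by (auto simp: B_def)
      have "dist x y < t"
        using x y dist_triangle_half_r[of "a + of_real (of_int n * t)" x t y] by (simp add: B_def)
      then have "\<bar>of_int m * t\<bar> < t" unfolding m dist_norm by (simp del: of_real_mult)
      then have "m = 0" using t by (simp add: abs_mult)
      then show "x = y" using m by simp
    qed
    have shift: "\<zeta> + of_real (of_int k * t) \<in> B (n + k)" if "\<zeta> \<in> B n" for \<zeta> n k
      using that tr[of \<zeta> "of_int k * t"] by (auto simp: B_def dist_norm algebra_simps)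
    have per: "e (\<zeta> + of_real (of_int k * t)) = e \<zeta>" if "\<zeta> \<in> W" for \<zeta> k
      using ee[of "\<zeta> + of_real (of_int k * t)" \<zeta>] tr that by blast
    have eB: "e ` B n = U" for n
    proof -
      have "e ` B n \<subseteq> e ` B (n + k)" for n k
      proof (intro image_subsetI)
        fix x assume "x \<in> B n"
        then have "e x = e (x + of_real (of_int k * t))" "x + of_real (of_int k * t) \<in> B (n + k)"
          using per shift by (auto simp: B_def)
        then show "e x \<in> e ` B (n + k)" by (rule image_eqI)
      qed
      from this[of n "-n"] this[of 0 n] show ?thesis by (simp add: U_def)
    qed
    have \<mu>V: "\<mu> ` V n = B n" for n using \<mu>W(1) by (auto simp: V_def B_def)
    have oU: "open U" unfolding U_def
      by (rule open_mapping_thm3[OF holomorphic_on_subset[OF e(1)] oB inje]) (auto simp: B_def)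
    have US: "U \<subseteq> S" using e(2) by (auto simp: U_def B_def)
    have yU: "y \<in> U" unfolding U_def by (rule image_eqI[of _ _ a]) (use a t in \<open>auto simp: B_def\<close>)
    have oV: "open (V n)" for n
      unfolding V_def using continuous_open_preimage[OF holomorphic_on_imp_continuous_on[OF \<mu>(1)] open_unit_disk oB] .
    have un: "\<Union>(range V) = unit_disk \<inter> (e \<circ> \<mu>) -` U"
    proof
      have "e \<zeta> \<in> U" if "\<zeta> \<in> B n" for \<zeta> n using eB[of n] that by blast
      then show "\<Union>(range V) \<subseteq> unit_disk \<inter> (e \<circ> \<mu>) -` U" by (auto simp: V_def)
      show "unit_disk \<inter> (e \<circ> \<mu>) -` U \<subseteq> \<Union>(range V)"
      proof
        fix z assume z: "z \<in> unit_disk \<inter> (e \<circ> \<mu>) -` U"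
        then obtain b where b: "b \<in> B 0" "e (\<mu> z) = e b" by (auto simp: U_def)
        moreover have "\<mu> z \<in> W" using z \<mu>W(1) by blast
        ultimately obtain n :: int where "\<mu> z = b + of_real (of_int n * t)" using ee by (auto simp: B_def)
        then have "\<mu> z \<in> B n" using shift[OF b(1), of n] by simp
        then show "z \<in> \<Union>(range V)" using z by (auto simp: V_def)
      qed
    qed
    have disj: "pairwise disjnt (range V)"
    proof (rule pairwiseI, clarify)
      fix n m assume nm: "V n \<noteq> V m"
      show "disjnt (V n) (V m)"
        unfolding disjnt_iff
      proof (intro allI notI, elim conjE)
        fix z assume "z \<in> V n" "z \<in> V m"
        then have "dist (a + of_real (of_int n * t)) (a + of_real (of_int m * t)) < t"
          using dist_triangle_half_l[of "a + of_real (of_int n * t)" "\<mu> z" t "a + of_real (of_int m * t)"] by (simp add: V_def B_def)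
        moreover have "dist (a + of_real (of_int n * t)) (a + of_real (of_int m * t)) = norm (complex_of_real (of_int (n - m) * t))"
          by (simp add: dist_norm algebra_simps)
        ultimately have "\<bar>of_int (n - m) * t\<bar> < t" by (simp only: norm_of_real)
        then have "\<bar>real_of_int (n - m)\<bar> < 1" using t by (simp add: abs_mult)
        then have "n = m" by linarith
        then show False using nm by simp
      qed
    qed
    have hom: "homeomorphic_map (top_of_set (V n)) (subtopology (top_of_set S) U) (e \<circ> \<mu>)" for n
    proof -
      have Vh: "(e \<circ> \<mu>) holomorphic_on V n" by (rule holomorphic_on_subset[OF qhol]) (auto simp: V_def)
      have im: "(e \<circ> \<mu>) ` V n = U" using eB \<mu>V by (metis image_comp)
      have ij: "inj_on (e \<circ> \<mu>) (V n)"
        by (rule comp_inj_on) (use \<mu>V inje \<mu>W(2) in \<open>auto simp: V_def intro: inj_on_subset\<close>)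
      have "subtopology (top_of_set S) U = top_of_set U" using US by (simp add: subtopology_subtopology Int_absorb1)
      moreover have "homeomorphic_map (top_of_set (V n)) (top_of_set U) (e \<circ> \<mu>)"
      proof (rule bijective_open_imp_homeomorphic_map)
        show "continuous_map (top_of_set (V n)) (top_of_set U) (e \<circ> \<mu>)"
          using holomorphic_on_imp_continuous_on[OF Vh] im by auto
        show "open_map (top_of_set (V n)) (top_of_set U) (e \<circ> \<mu>)"
          unfolding open_map_def
        proof (intro allI impI)
          fix O' assume "openin (top_of_set (V n)) O'"
          then have O': "open O'" "O' \<subseteq> V n" using oV by (auto simp: openin_open_eq)
          have "open ((e \<circ> \<mu>) ` O')"
            by (rule open_mapping_thm3[OF holomorphic_on_subset[OF Vh O'(2)] O'(1) inj_on_subset[OF ij O'(2)]])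
          then show "openin (top_of_set U) ((e \<circ> \<mu>) ` O')" using im O'(2) oU by (auto simp: openin_open_eq)
        qed
      qed (use im ij in auto)
      ultimately show ?thesis by simp
    qed
    show ?thesis
      by (rule exI[of _ U], intro conjI exI[of _ "range V"])
         (use oU US S yU un oV disj hom in \<open>auto simp: openin_open_eq\<close>)
  qed
  have "continuous_map (top_of_set unit_disk) (top_of_set S) (e \<circ> \<mu>)"
    using holomorphic_on_imp_continuous_on[OF qhol] qS by auto
  then have "covering_map_onto unit_disk (top_of_set S) (e \<circ> \<mu>)"
    unfolding covering_map_onto_def using qS ev by simp
  moreover have "hol_into (top_of_set S) (std_atlas S) unit_disk (e \<circ> \<mu>)"
    unfolding hol_into_def std_atlas_def
    using \<open>continuous_map (top_of_set unit_disk) (top_of_set S) (e \<circ> \<mu>)\<close> holomorphic_on_subset[OF qhol]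
    by (auto simp flip: comp_assoc)
  ultimately show ?thesis by (simp add: disk_universal_covering_def)
qed

lemma disk_universal_covering_id: "disk_universal_covering (top_of_set unit_disk) (std_atlas unit_disk) id"
proof -
  have "covering_map_onto unit_disk (top_of_set unit_disk) id"
    unfolding covering_map_onto_def
    by (auto intro!: exI[of _ unit_disk] exI[of _ "{unit_disk}"] simp: homeomorphic_map_id subtopology_subtopology)
  then show ?thesis
    by (auto simp: disk_universal_covering_def hol_into_def std_atlas_def holomorphic_on_id)
qed

section \<open>Automorphisms of the disk\<close>

text \<open>After moving \<open>\<phi> 0\<close> to the origin, the Schwarz lemma applies to the map
  and to its inverse. Equality of moduli at one nonzero point, here \<open>1/2\<close>, makes it a
  rotation \<open>\<zeta>\<close>.\<close>

lemma disk_automorphism_form: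
  assumes \<phi>: "\<phi> holomorphic_on unit_disk" "bij_betw \<phi> unit_disk unit_disk"
  obtains \<zeta> u where "norm \<zeta> = 1" "norm u < 1" "\<And>z. z \<in> unit_disk \<Longrightarrow> \<phi> z = (\<zeta> * z + u) / (1 + cnj u * (\<zeta> * z))"
proof -
  have D: "z \<in> unit_disk \<longleftrightarrow> norm z < 1" for z by (simp add: unit_disk_def)
  define u where "u = \<phi> 0"
  have im: "\<phi> ` unit_disk = unit_disk" and inj: "inj_on \<phi> unit_disk" using \<phi>(2) by (auto simp: bij_betw_def)
  have im': "\<phi> z \<in> unit_disk" if "z \<in> unit_disk" for z using im that by blast
  have u: "norm u < 1" using im'[of 0] by (simp add: u_def D)
  obtain k where k: "k holomorphic_on unit_disk" "\<And>z. z \<in> unit_disk \<Longrightarrow> k (\<phi> z) = z"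
    using holomorphic_has_inverse[OF \<phi>(1) open_unit_disk inj] im by metis
  have kim: "k w \<in> unit_disk" if "w \<in> unit_disk" for w using im that k(2) by (metis imageE)
  let ?M = "Moebius_function 0 u" and ?M' = "Moebius_function 0 (-u)"
  have M: "?M w \<in> unit_disk" "?M' w \<in> unit_disk" if "w \<in> unit_disk" for w
    using Moebius_function_norm_lt_1[of u w 0] Moebius_function_norm_lt_1[of "-u" w 0] u that by (auto simp: D)
  have MM: "?M' (?M w) = w" "?M (?M' w) = w" if "w \<in> unit_disk" for w
    using Moebius_function_compose[of "-u" u w] Moebius_function_compose[of u "-u" w] u that by (auto simp: D)
  have Mh: "?M holomorphic_on unit_disk" "?M' holomorphic_on unit_disk"
    using Moebius_function_holomorphic[of u 0] Moebius_function_holomorphic[of "-u" 0] u by (auto simp: unit_disk_def)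
  define f where "f = ?M \<circ> \<phi>"
  define g where "g = k \<circ> ?M'"
  have f: "f holomorphic_on ball 0 1"
    unfolding f_def unit_disk_def[symmetric]
    by (rule holomorphic_on_compose[OF \<phi>(1)]) (use Mh im in simp)
  have g: "g holomorphic_on ball 0 1"
    unfolding g_def unit_disk_def[symmetric]
    by (rule holomorphic_on_compose[OF Mh(2)]) (rule holomorphic_on_subset[OF k(1)], use M in auto)
  have f0: "f 0 = 0" by (simp add: f_def u_def Moebius_function_eq_zero)
  have g0: "g 0 = 0"
    using k(2)[of 0] by (simp add: g_def u_def[symmetric] Moebius_function_of_zero D)
  have fn: "norm (f z) < 1" if "norm z < 1" for z using M(1) im' that by (simp add: f_def D)
  have gn: "norm (g z) < 1" if "norm z < 1" for z using M(2) kim that by (simp add: g_def D)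
  have "norm (f (1/2)) \<le> norm (1/2 :: complex)" by (rule Schwarz_Lemma(1)[OF f f0 fn]) auto
  moreover have e: "g (f (1/2)) = 1/2"
    using MM(1) k(2) im' by (simp add: g_def f_def D norm_divide)
  have half: "norm (1/2 :: complex) < 1" by (simp add: norm_divide)
  have "norm (1/2 :: complex) \<le> norm (f (1/2))"
    using Schwarz_Lemma(1)[OF g g0 gn fn[OF half]] unfolding e .
  ultimately have eq: "norm (f (1/2)) = norm (1/2 :: complex)" by simp
  have "\<exists>z. norm z < 1 \<and> z \<noteq> 0 \<and> norm (f z) = norm z"
    using eq by (intro exI[of _ "1/2"]) (auto simp: norm_divide)
  then obtain \<zeta> where z: "\<And>z. norm z < 1 \<Longrightarrow> f z = \<zeta> * z" "norm \<zeta> = 1"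
    using Schwarz_Lemma(3)[OF f f0 fn, of 0] by auto
  have "\<phi> z = (\<zeta> * z + u) / (1 + cnj u * (\<zeta> * z))" if zD: "z \<in> unit_disk" for z
  proof -
    have "\<phi> z = ?M' (f z)" using MM(1)[OF im'[OF zD]] by (simp add: f_def)
    also have "\<dots> = ?M' (\<zeta> * z)" using z(1) zD by (simp add: D)
    finally show ?thesis by (simp add: Moebius_function_simple)
  qed
  then show ?thesis using that z(2) u by blast
qed

section \<open>Half-plane and strip as models of the disk\<close>

definition right_halfplane :: "complex set" where "right_halfplane = {v. Re v > 0}"

text \<open>The Cayley transform that sends the boundary point \<open>\<xi>\<close> to infinity; the
  real part of the image is \<open>(1 - |z|^2) / |\<xi> - z|^2\<close>.\<close>

lemma cayley_bij:
  assumes \<xi>: "norm \<xi> = 1"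
  shows "bij_betw (\<lambda>z. (\<xi> + z) / (\<xi> - z)) unit_disk right_halfplane"
proof (rule bij_betw_byWitness[where f' = "\<lambda>v. \<xi> * (v - 1) / (v + 1)"])
  have xx: "\<xi> * cnj \<xi> = 1" using \<xi> complex_norm_square[of \<xi>] by simp
  have ne: "\<xi> - z \<noteq> 0" if "z \<in> unit_disk" for z using that \<xi> by (auto simp: unit_disk_def)
  have x0: "\<xi> \<noteq> 0" using \<xi> by auto
  have ne2: "v + 1 \<noteq> 0" if "v \<in> right_halfplane" for v
  proof
    assume "v + 1 = 0"
    then have "Re (v + 1) = 0" by simp
    then show False using that by (simp add: right_halfplane_def)
  qed
  show "\<forall>z\<in>unit_disk. \<xi> * ((\<xi> + z) / (\<xi> - z) - 1) / ((\<xi> + z) / (\<xi> - z) + 1) = z"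
  proof
    fix z assume "z \<in> unit_disk"
    then have n: "\<xi> - z \<noteq> 0" by (rule ne)
    then have "(\<xi> + z) / (\<xi> - z) - 1 = 2 * z / (\<xi> - z)" "(\<xi> + z) / (\<xi> - z) + 1 = 2 * \<xi> / (\<xi> - z)"
      by (simp_all add: field_simps)
    then show "\<xi> * ((\<xi> + z) / (\<xi> - z) - 1) / ((\<xi> + z) / (\<xi> - z) + 1) = z" using n x0 by simp
  qed
  show "\<forall>v\<in>right_halfplane. (\<xi> + \<xi> * (v - 1) / (v + 1)) / (\<xi> - \<xi> * (v - 1) / (v + 1)) = v"
  proof
    fix v assume "v \<in> right_halfplane"
    then have n: "v + 1 \<noteq> 0" by (rule ne2)
    have "\<xi> + \<xi> * (v - 1) / (v + 1) = 2 * \<xi> * v / (v + 1)" "\<xi> - \<xi> * (v - 1) / (v + 1) = 2 * \<xi> / (v + 1)"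
      using n by (simp_all add: field_simps)
    then show "(\<xi> + \<xi> * (v - 1) / (v + 1)) / (\<xi> - \<xi> * (v - 1) / (v + 1)) = v" using n x0 by simp
  qed
  show "(\<lambda>z. (\<xi> + z) / (\<xi> - z)) ` unit_disk \<subseteq> right_halfplane"
  proof (intro image_subsetI)
    fix z assume z: "z \<in> unit_disk"
    have n: "norm (\<xi> - z) > 0" using ne[OF z] by simp
    have "(\<xi> + z) / (\<xi> - z) = (\<xi> + z) * cnj (\<xi> - z) / of_real ((norm (\<xi> - z))\<^sup>2)"
      unfolding complex_norm_square using ne[OF z] by simp
    also have "Re \<dots> = Re ((\<xi> + z) * cnj (\<xi> - z)) / (norm (\<xi> - z))\<^sup>2" by (rule Re_divide_of_real)
    also have "Re ((\<xi> + z) * cnj (\<xi> - z)) = (norm \<xi>)\<^sup>2 - (norm z)\<^sup>2"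
      unfolding cmod_power2 by (simp add: power2_eq_square algebra_simps)
    finally show "(\<xi> + z) / (\<xi> - z) \<in> right_halfplane"
      using z n \<xi> by (simp add: right_halfplane_def unit_disk_def abs_square_less_1)
  qed
  show "(\<lambda>v. \<xi> * (v - 1) / (v + 1)) ` right_halfplane \<subseteq> unit_disk"
  proof (intro image_subsetI)
    fix v assume v: "v \<in> right_halfplane"
    have "(norm (v - 1))\<^sup>2 < (norm (v + 1))\<^sup>2"
      using v unfolding cmod_power2 by (simp add: power2_eq_square algebra_simps right_halfplane_def)
    then have "norm (v - 1) < norm (v + 1)" by (rule power2_less_imp_less) simp
    then show "\<xi> * (v - 1) / (v + 1) \<in> unit_disk"
      using \<xi> ne2[OF v] by (simp add: unit_disk_def norm_mult norm_divide)
  qed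
qed

lemma mom_scaled:
  assumes "complex_of_real a = A / of_real k" "b = B / of_real k"
  shows "mom a b (z, cnj z) = (A * (1 + z * cnj z) + B * z + cnj B * cnj z) / (of_real k * (1 - z * cnj z))"
  by (simp only: mom_def assms fst_conv snd_conv complex_cnj_divide complex_cnj_complex_of_real
      times_divide_eq_left add_divide_distrib[symmetric] divide_divide_eq_left)

text \<open>With \<open>V = (1 + \<phi>) / (1 - \<phi>)\<close> and \<open>\<phi> = N / M\<close>, \<open>N = \<zeta>z + u\<close>, \<open>M = 1 + cnj u \<zeta>z\<close>, one has
  \<open>|M|\<^sup>2 - |N|\<^sup>2 = (1 - |u|\<^sup>2) (1 - |z|\<^sup>2)\<close>; both quotients are then of the form \<open>mom a b\<close>.\<close>
lemma halfplane_moments: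
  assumes V: "V holomorphic_on unit_disk" "bij_betw V unit_disk right_halfplane"
  obtains a b a' b' where "norm b = a" "a > 0" "(norm b')\<^sup>2 = a'\<^sup>2 + 1"
    "\<And>z. z \<in> unit_disk \<Longrightarrow> mom a b (z, cnj z) = of_real (1 / Re (V z))"
    "\<And>z. z \<in> unit_disk \<Longrightarrow> mom a' b' (z, cnj z) = of_real (Im (V z) / Re (V z))"
proof -
  have VR: "Re (V z) > 0" if "z \<in> unit_disk" for z
    using V(2) that by (auto simp: bij_betw_def right_halfplane_def)
  have V1: "V z + 1 \<noteq> 0" if "z \<in> unit_disk" for z
  proof
    assume "V z + 1 = 0"
    then have "Re (V z + 1) = 0" by simp
    then show False using VR[OF that] by simp
  qed
  define \<phi> where "\<phi> z = (V z - 1) / (V z + 1)" for z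
  have "\<phi> holomorphic_on unit_disk" unfolding \<phi>_def by (intro holomorphic_intros V V1)
  moreover have "bij_betw \<phi> unit_disk unit_disk"
  proof -
    have "bij_betw (inv_into unit_disk (\<lambda>z. (1 + z) / (1 - z))) right_halfplane unit_disk"
      by (rule bij_betw_inv_into[OF cayley_bij[of 1]]) simp
    then have "bij_betw (inv_into unit_disk (\<lambda>z. (1 + z) / (1 - z)) \<circ> V) unit_disk unit_disk"
      by (rule bij_betw_trans[OF V(2)])
    moreover have "(inv_into unit_disk (\<lambda>z. (1 + z) / (1 - z)) \<circ> V) z = \<phi> z" if z: "z \<in> unit_disk" for z
    proof -
      have b: "bij_betw (\<lambda>z. (1 + z) / (1 - z)) unit_disk right_halfplane" using cayley_bij[of 1] by simp
      have "norm (V z - 1) < norm (V z + 1)"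
      proof (rule power2_less_imp_less)
        show "(norm (V z - 1))\<^sup>2 < (norm (V z + 1))\<^sup>2"
          using VR[OF z] unfolding cmod_power2 by (simp add: power2_eq_square algebra_simps)
      qed simp
      then have pD: "\<phi> z \<in> unit_disk" using V1[OF z] by (simp add: \<phi>_def unit_disk_def norm_divide)
      have "1 + \<phi> z = 2 * V z / (V z + 1)" "1 - \<phi> z = 2 / (V z + 1)"
        using V1[OF z] by (simp_all add: \<phi>_def field_simps)
      then have "(1 + \<phi> z) / (1 - \<phi> z) = V z" using V1[OF z] by simp
      then show ?thesis using inv_into_f_f[of "\<lambda>z. (1 + z) / (1 - z)" unit_disk "\<phi> z"] b pD
        by (simp add: bij_betw_def)
    qed
    ultimately show ?thesis using bij_betw_cong[of unit_disk "inv_into unit_disk (\<lambda>z. (1 + z) / (1 - z)) \<circ> V" \<phi>] by blast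
  qed
  ultimately obtain \<zeta> u where \<zeta>: "norm \<zeta> = 1" and u: "norm u < 1"
    and form: "\<And>z. z \<in> unit_disk \<Longrightarrow> \<phi> z = (\<zeta> * z + u) / (1 + cnj u * (\<zeta> * z))"
    by (rule disk_automorphism_form) (rule that; assumption)
  define k where "k = 1 - (norm u)\<^sup>2"
  have k: "k > 0" using u by (simp add: k_def abs_square_less_1)
  have kc: "complex_of_real k = 1 - u * cnj u" by (simp add: k_def flip: complex_norm_square)
  have zz: "\<zeta> * cnj \<zeta> = 1" using \<zeta> complex_norm_square[of \<zeta>] by simp
  \<comment> \<open>The parameters are the coefficients of \<open>|M - N|^2\<close> and of
    \<open>- \<i> (N * cnj M - M * cnj N)\<close> in \<open>z\<close>, over the common denominator
    \<open>k (1 - |z|^2)\<close>: these are the numerators of \<open>1 / Re V\<close> and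
    \<open>Im V / Re V\<close>.\<close>
  define a where "a = (norm (1 - u))\<^sup>2 / k"
  define b where "b = - (1 - cnj u)\<^sup>2 * \<zeta> / of_real k"
  define a' where "a' = 2 * Im u / k"
  define b' where "b' = - \<i> * (1 - (cnj u)\<^sup>2) * \<zeta> / of_real k"
  have ac: "complex_of_real a = (1 - u) * (1 - cnj u) / of_real k"
  proof -
    have "complex_of_real ((norm (1 - u))\<^sup>2) = (1 - u) * cnj (1 - u)" by (rule complex_norm_square)
    then show ?thesis by (simp add: a_def)
  qed
  have a'c: "complex_of_real a' = - \<i> * (u - cnj u) / of_real k"
    by (simp add: a'_def complex_eq_iff)
  have na: "norm b = a" using k \<zeta> complex_mod_cnj[of "1 - u"] by (simp add: a_def b_def norm_mult norm_divide norm_power)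
  have "norm (1 - u) > 0" using u by auto
  then have a0: "a > 0" using k by (simp add: a_def)
  have nb': "(norm b')\<^sup>2 = a'\<^sup>2 + 1"
  proof -
    have "norm b' = norm (1 - (cnj u)\<^sup>2) / k" using k \<zeta> by (simp add: b'_def norm_mult norm_divide)
    also have "norm (1 - (cnj u)\<^sup>2) = norm (1 - u\<^sup>2)" using complex_mod_cnj[of "1 - u\<^sup>2"] by simp
    finally have "(norm b')\<^sup>2 = (norm (1 - u\<^sup>2))\<^sup>2 / k\<^sup>2" by (simp add: power_divide)
    moreover have "(norm (1 - u\<^sup>2))\<^sup>2 = k\<^sup>2 + (2 * Im u)\<^sup>2"
      unfolding k_def cmod_power2 by (simp add: power2_eq_square algebra_simps)
    ultimately show ?thesis using k by (simp add: a'_def power_divide add_divide_distrib)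
  qed
  have main: "mom a b (z, cnj z) = of_real (1 / Re (V z)) \<and> mom a' b' (z, cnj z) = of_real (Im (V z) / Re (V z))"
    if z: "z \<in> unit_disk" for z
  proof -
    define P where "P = \<zeta> * z"
    define N M where "N = P + u" and "M = 1 + cnj u * P"
    define Q where "Q = M - N"
    define v where "v = V z"
    have PP: "P * cnj P = z * cnj z" using zz by (simp add: P_def mult_ac)
    have M0: "M \<noteq> 0"
      using mult_neq_1_unit_disk[of "- cnj u" P] z u \<zeta> by (auto simp: M_def P_def unit_disk_def norm_mult add_eq_0_iff)
    have "(v - 1) / (v + 1) = N / M" using form[OF z] by (simp add: \<phi>_def v_def N_def M_def P_def)
    then have "(v - 1) * M = N * (v + 1)" using V1[OF z] M0 by (simp add: v_def frac_eq_eq)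
    then have vQ: "v * Q = M + N" by (simp add: Q_def algebra_simps)
    have Q0: "Q \<noteq> 0"
    proof
      assume "Q = 0"
      then have "M = 0" using vQ by (simp add: Q_def)
      then show False using M0 by simp
    qed
    have cvQ: "cnj v * cnj Q = cnj M + cnj N" using arg_cong[OF vQ, of cnj] by simp
    have D: "M * cnj M - N * cnj N = of_real k * (1 - z * cnj z)"
      unfolding kc PP[symmetric] by (simp add: M_def N_def algebra_simps)
    have "(v + cnj v) * (Q * cnj Q) = (v * Q) * cnj Q + (cnj v * cnj Q) * Q" by (simp add: algebra_simps)
    also have "\<dots> = 2 * (M * cnj M - N * cnj N)" unfolding vQ cvQ by (simp add: Q_def algebra_simps)
    finally have re: "of_real (Re v) * (Q * cnj Q) = of_real k * (1 - z * cnj z)" unfolding D by (simp add: complex_add_cnj)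
    have "(v - cnj v) * (Q * cnj Q) = (v * Q) * cnj Q - (cnj v * cnj Q) * Q" by (simp add: algebra_simps)
    also have "\<dots> = 2 * (N * cnj M - M * cnj N)" unfolding vQ cvQ by (simp add: Q_def algebra_simps)
    also have "v - cnj v = 2 * (\<i> * of_real (Im v))" by (simp add: complex_eq_iff)
    finally have "2 * (\<i> * of_real (Im v) * (Q * cnj Q)) = 2 * (N * cnj M - M * cnj N)" by (simp only: mult.assoc)
    then have im: "\<i> * of_real (Im v) * (Q * cnj Q) = N * cnj M - M * cnj N" by (rule mult_left_cancel[THEN iffD1, rotated]) simp
    have z1: "1 - z * cnj z \<noteq> 0" using mult_neq_1_unit_disk[of z "cnj z"] z by auto
    have k0: "complex_of_real k \<noteq> 0" using k by simp
    have QQ: "Q * cnj Q \<noteq> 0" using Q0 by simp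
    have Rv: "complex_of_real (Re v) \<noteq> 0" using VR[OF z] by (simp add: v_def)
    have rv: "of_real (Re v) = of_real k * (1 - z * cnj z) / (Q * cnj Q)" using re QQ by (simp add: field_simps)
    have "mom a b (z, cnj z) = Q * cnj Q / (of_real k * (1 - z * cnj z))"
    proof -
      have "Q * cnj Q = (1 - u) * (1 - cnj u) * (1 + z * cnj z) + (- (1 - cnj u)\<^sup>2 * \<zeta>) * z + cnj (- (1 - cnj u)\<^sup>2 * \<zeta>) * cnj z"
        unfolding PP[symmetric] by (simp add: Q_def M_def N_def P_def power2_eq_square algebra_simps)
      then show ?thesis by (simp only: mom_scaled[OF ac b_def])
    qed
    also have "\<dots> = of_real (1 / Re v)" unfolding of_real_divide rv by simp
    finally have 1: "mom a b (z, cnj z) = of_real (1 / Re v)" .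
    have "mom a' b' (z, cnj z) = - \<i> * (N * cnj M - M * cnj N) / (of_real k * (1 - z * cnj z))"
    proof -
      have "- \<i> * (N * cnj M - M * cnj N) = - \<i> * (u - cnj u) * (1 + z * cnj z) + (- \<i> * (1 - (cnj u)\<^sup>2) * \<zeta>) * z + cnj (- \<i> * (1 - (cnj u)\<^sup>2) * \<zeta>) * cnj z"
        unfolding PP[symmetric] by (simp add: M_def N_def P_def power2_eq_square algebra_simps)
      then show ?thesis by (simp only: mom_scaled[OF a'c b'_def])
    qed
    also have "\<dots> = of_real (Im v / Re v)"
      unfolding of_real_divide rv im[symmetric] using QQ by (simp add: mult.assoc)
    finally show ?thesis using 1 by (simp add: v_def)
  qed
  show ?thesis by (rule that[OF na a0 nb']) (use main in auto)
qed

definition upper_halfplane :: "complex set" where "upper_halfplane = {\<zeta>. Im \<zeta> > 0}"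
text \<open>With half-width \<open>pi / 4\<close> the map \<open>exp (2 * \<zeta>)\<close> is a
  bijection onto the right half-plane, and \<open>tan (2 * Im \<zeta>)\<close> is a moment map with
  Casimir exactly 1.\<close>

definition strip :: "complex set" where "strip = {\<zeta>. \<bar>Im \<zeta>\<bar> < pi / 4}"

lemma exp_strip_bij: "bij_betw (\<lambda>\<zeta>. exp (2 * \<zeta>)) strip right_halfplane"
proof (rule bij_betw_byWitness[where f' = "\<lambda>v. Ln v / 2"])
  have c: "\<bar>2 * Im \<zeta>\<bar> < pi / 2" if "\<zeta> \<in> strip" for \<zeta> using that by (auto simp: strip_def)
  show "\<forall>\<zeta>\<in>strip. Ln (exp (2 * \<zeta>)) / 2 = \<zeta>"
  proof
    fix \<zeta> assume "\<zeta> \<in> strip"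
    from c[OF this] have "- pi < Im (2 * \<zeta>)" "Im (2 * \<zeta>) \<le> pi" using pi_gt_zero by auto
    then show "Ln (exp (2 * \<zeta>)) / 2 = \<zeta>" by (simp add: Ln_exp)
  qed
  have n0: "v \<noteq> 0" if "v \<in> right_halfplane" for v using that by (auto simp: right_halfplane_def)
  show "\<forall>v\<in>right_halfplane. exp (2 * (Ln v / 2)) = v" using n0 by simp
  show "(\<lambda>\<zeta>. exp (2 * \<zeta>)) ` strip \<subseteq> right_halfplane"
  proof (intro image_subsetI)
    fix \<zeta> assume "\<zeta> \<in> strip"
    from c[OF this] have "0 < cos (2 * Im \<zeta>)" by (intro cos_gt_zero_pi) linarith+
    then show "exp (2 * \<zeta>) \<in> right_halfplane" by (simp add: right_halfplane_def Re_exp)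
  qed
  show "(\<lambda>v. Ln v / 2) ` right_halfplane \<subseteq> strip"
  proof (intro image_subsetI)
    fix v assume v: "v \<in> right_halfplane"
    then have "\<bar>Im (Ln v)\<bar> < pi / 2" using Re_Ln_pos_lt_imp[of v] n0[OF v] by (auto simp: right_halfplane_def)
    then show "Ln v / 2 \<in> strip" by (simp add: strip_def)
  qed
qed

text \<open>In the coordinate of \<open>W\<close> the one-parameter group consists of the real
  translations; \<open>\<eta>\<close> is its moment map as a function of the imaginary part, and
  \<open>\<delta>\<close> the Casimir. The cases are the parabolic and the hyperbolic group.\<close>

definition model :: "complex set \<Rightarrow> (real \<Rightarrow> real) \<Rightarrow> real \<Rightarrow> bool" where
  "model W \<eta> \<delta> \<longleftrightarrow> (W = upper_halfplane \<and> \<eta> = (\<lambda>y. 1 / y) \<and> \<delta> = 0) \<or> (W = strip \<and> \<eta> = (\<lambda>y. tan (2 * y)) \<and> \<delta> = 1)"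

text \<open>The maps \<open>- \<i> * \<zeta>\<close> and \<open>exp (2 * \<zeta>)\<close> lead to
  the right half-plane, where \<open>1 / Re V\<close> becomes \<open>1 / Im \<zeta>\<close> and
  \<open>Im V / Re V\<close> becomes \<open>tan (2 * Im \<zeta>)\<close>.\<close>

lemma model_moment:
  assumes m: "model W \<eta> \<delta>" and \<mu>: "\<mu> holomorphic_on unit_disk" "bij_betw \<mu> unit_disk W"
  obtains a b where "b \<noteq> 0" "(norm b)\<^sup>2 = a\<^sup>2 + \<delta>" "\<delta> = 0 \<Longrightarrow> a > 0" "\<delta> = 0 \<Longrightarrow> norm b = a"
    "\<And>z. z \<in> unit_disk \<Longrightarrow> mom a b (z, cnj z) = of_real (\<eta> (Im (\<mu> z)))"
  using m unfolding model_def
proof (elim disjE conjE)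
  assume W: "W = upper_halfplane" "\<eta> = (\<lambda>y. 1 / y)" "\<delta> = 0"
  have "bij_betw (\<lambda>\<zeta>. - \<i> * \<zeta>) upper_halfplane right_halfplane"
    by (rule bij_betw_byWitness[where f' = "\<lambda>v. \<i> * v"]) (auto simp: upper_halfplane_def right_halfplane_def)
  then have "bij_betw ((\<lambda>\<zeta>. - \<i> * \<zeta>) \<circ> \<mu>) unit_disk right_halfplane"
    using \<mu>(2) W(1) by (auto intro: bij_betw_trans)
  moreover have "((\<lambda>\<zeta>. - \<i> * \<zeta>) \<circ> \<mu>) holomorphic_on unit_disk"
    unfolding o_def by (intro holomorphic_intros \<mu>)
  ultimately obtain a b where ab: "norm b = a" "a > 0"
    "\<And>z. z \<in> unit_disk \<Longrightarrow> mom a b (z, cnj z) = of_real (1 / Re (((\<lambda>\<zeta>. - \<i> * \<zeta>) \<circ> \<mu>) z))"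
    using halfplane_moments by metis
  show thesis by (rule that[of b a]) (use ab W in auto)
next
  assume W: "W = strip" "\<eta> = (\<lambda>y. tan (2 * y))" "\<delta> = 1"
  have "bij_betw ((\<lambda>\<zeta>. exp (2 * \<zeta>)) \<circ> \<mu>) unit_disk right_halfplane"
    using \<mu>(2) W(1) exp_strip_bij by (auto intro: bij_betw_trans)
  moreover have "((\<lambda>\<zeta>. exp (2 * \<zeta>)) \<circ> \<mu>) holomorphic_on unit_disk"
    unfolding o_def by (intro holomorphic_intros \<mu>)
  ultimately obtain a b where ab: "(norm b)\<^sup>2 = a\<^sup>2 + 1"
    "\<And>z. z \<in> unit_disk \<Longrightarrow> mom a b (z, cnj z) = of_real (Im (((\<lambda>\<zeta>. exp (2 * \<zeta>)) \<circ> \<mu>) z) / Re (((\<lambda>\<zeta>. exp (2 * \<zeta>)) \<circ> \<mu>) z))"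
    using halfplane_moments by metis
  have "b \<noteq> 0"
  proof
    assume "b = 0"
    then have "a\<^sup>2 + 1 = 0" using ab(1) by simp
    moreover have "a\<^sup>2 \<ge> 0" by simp
    ultimately show False by linarith
  qed
  then show thesis by (rule that[of b a]) (use ab W in \<open>auto simp: Re_exp Im_exp tan_def\<close>)
qed

lemma model_inj:
  assumes m: "model W \<eta> \<delta>" and "\<zeta> \<in> W" "\<xi> \<in> W" and eq: "\<eta> (Im \<zeta>) = \<eta> (Im \<xi>)"
  shows "Im \<zeta> = Im \<xi>"
  using m unfolding model_def
proof (elim disjE conjE)
  assume "W = strip" "\<eta> = (\<lambda>y. tan (2 * y))"
  then have t: "tan (2 * Im \<zeta>) = tan (2 * Im \<xi>)" and i: "\<bar>Im \<zeta>\<bar> < pi / 4" "\<bar>Im \<xi>\<bar> < pi / 4"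
    using assms by (auto simp: strip_def)
  have "2 * Im \<zeta> = arctan (tan (2 * Im \<zeta>))" by (rule arctan_tan[symmetric]) (use i in linarith)+
  also have "\<dots> = arctan (tan (2 * Im \<xi>))" by (simp only: t)
  also have "\<dots> = 2 * Im \<xi>" by (rule arctan_tan) (use i in linarith)+
  finally show ?thesis by simp
next
  assume "\<eta> = (\<lambda>y. 1 / y)" then show ?thesis using eq by simp
qed

lemma model_domain:
  assumes "model W \<eta> \<delta>"
  shows "open W" "convex W" "\<And>\<zeta> (r::real). \<zeta> \<in> W \<Longrightarrow> \<zeta> + of_real r \<in> W"
proof -
  have *: "strip = {\<zeta>. Im \<zeta> < pi / 4} \<inter> {\<zeta>. Im \<zeta> > - (pi / 4)}" by (auto simp: strip_def)
  have "open strip" "convex strip" unfolding *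
    by (intro open_Int convex_Int open_halfspace_Im_lt open_halfspace_Im_gt convex_halfspace_Im_lt convex_halfspace_Im_gt)+
  moreover have "open upper_halfplane" "convex upper_halfplane"
    by (auto simp: upper_halfplane_def open_halfspace_Im_gt convex_halfspace_Im_gt)
  ultimately show "open W" "convex W" using assms by (auto simp: model_def)
  show "\<And>\<zeta> (r::real). \<zeta> \<in> W \<Longrightarrow> \<zeta> + of_real r \<in> W"
    using assms by (auto simp: model_def upper_halfplane_def strip_def)
qed

text \<open>The two fixed points of a fixed-point free automorphism have a product of modulus 1, hence both lie
  on the unit circle; sending one of them to infinity turns the automorphism into an affine map.\<close>
lemma fixed_point_free_affine:
  assumes g: "g holomorphic_on unit_disk" "bij_betw g unit_disk unit_disk" and fpf: "\<And>z. z \<in> unit_disk \<Longrightarrow> g z \<noteq> z"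
  obtains V l s where "V holomorphic_on unit_disk" "bij_betw V unit_disk right_halfplane" "l > 0"
    "\<And>z. z \<in> unit_disk \<Longrightarrow> V (g z) = of_real l * V z + \<i> * of_real s"
proof -
  obtain \<zeta> u where \<zeta>: "norm \<zeta> = 1" and u: "norm u < 1"
    and form: "\<And>z. z \<in> unit_disk \<Longrightarrow> g z = (\<zeta> * z + u) / (1 + cnj u * (\<zeta> * z))"
    using disk_automorphism_form[OF g] by blast
  have u0: "u \<noteq> 0" using fpf[of 0] form[of 0] by (auto simp: unit_disk_def)
  have z0: "\<zeta> \<noteq> 0" using \<zeta> by auto
  \<comment> \<open>A square root of the discriminant of the fixed point equation
    \<open>cnj u * \<zeta> * r^2 + (1 - \<zeta>) * r - u = 0\<close>.\<close>
  define d where "d = csqrt ((1 - \<zeta>)\<^sup>2 + 4 * cnj u * \<zeta> * u)"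
  have d2: "d\<^sup>2 = (1 - \<zeta>)\<^sup>2 + 4 * cnj u * \<zeta> * u" by (simp add: d_def)
  define x y where "x = (- (1 - \<zeta>) + d) / (2 * cnj u * \<zeta>)" and "y = (- (1 - \<zeta>) - d) / (2 * cnj u * \<zeta>)"
  have c0: "2 * cnj u * \<zeta> \<noteq> 0" using u0 z0 by simp
  have root: "cnj u * \<zeta> * r\<^sup>2 + (1 - \<zeta>) * r - u = 0" if r: "2 * cnj u * \<zeta> * r + (1 - \<zeta>) = e" "e\<^sup>2 = d\<^sup>2" for r e
  proof -
    have "(2 * cnj u * \<zeta> * r + (1 - \<zeta>))\<^sup>2 = (1 - \<zeta>)\<^sup>2 + 4 * cnj u * \<zeta> * u" using r d2 by simp
    then have "4 * cnj u * \<zeta> * (cnj u * \<zeta> * r\<^sup>2 + (1 - \<zeta>) * r - u) = 0" by (simp add: power2_eq_square algebra_simps)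
    then show ?thesis using c0 by simp
  qed
  have rx: "cnj u * \<zeta> * x\<^sup>2 + (1 - \<zeta>) * x - u = 0" by (rule root[of x d]) (use c0 in \<open>auto simp: x_def\<close>)
  have ry: "cnj u * \<zeta> * y\<^sup>2 + (1 - \<zeta>) * y - u = 0" by (rule root[of y "-d"]) (use c0 in \<open>auto simp: y_def\<close>)
  have "x * y = ((1 - \<zeta>)\<^sup>2 - d\<^sup>2) / (2 * cnj u * \<zeta>)\<^sup>2"
    by (simp add: x_def y_def power2_eq_square algebra_simps)
  also have "\<dots> = - u / (cnj u * \<zeta>)" unfolding d2 using u0 z0 by (simp add: power2_eq_square field_simps)
  finally have "norm (x * y) = 1" using u0 \<zeta> by (simp add: norm_divide norm_mult)
  then have nxy: "norm x * norm y = 1" by (simp add: norm_mult)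
  have out: "1 \<le> norm r" if r: "cnj u * \<zeta> * r\<^sup>2 + (1 - \<zeta>) * r - u = 0" for r
  proof (rule ccontr)
    assume "\<not> 1 \<le> norm r"
    then have rD: "r \<in> unit_disk" by (simp add: unit_disk_def)
    have ne: "1 + cnj u * (\<zeta> * r) \<noteq> 0"
      using mult_neq_1_unit_disk[of "- cnj u" "\<zeta> * r"] u \<zeta> rD by (auto simp: unit_disk_def norm_mult add_eq_0_iff)
    have "\<zeta> * r + u = r * (1 + cnj u * (\<zeta> * r))" using r by (simp add: power2_eq_square algebra_simps)
    then have "g r = r" using form[OF rD] ne by simp
    then show False using fpf[OF rD] by simp
  qed
  have "norm x \<le> norm x * norm y" "1 \<le> norm x" using out[OF rx] out[OF ry] by (auto intro: mult_left_mono[of 1 "norm y" "norm x", simplified])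
  then have x1: "norm x = 1" using nxy by simp
  have xx: "x * cnj x = 1" using x1 complex_norm_square[of x] by simp
  have x0: "x \<noteq> 0" using x1 by auto
  \<comment> \<open>As \<open>g 0 = u\<close> and \<open>V 0 = 1\<close>, the affine map has to send
    1 to \<open>L\<close>; this is where \<open>l = Re L\<close> and \<open>s = Im L\<close> come
    from.\<close>
  define L where "L = (x + u) / (x - u)"
  have LH: "L \<in> right_halfplane" using bij_betw_imp_surj_on[OF cayley_bij[OF x1]] u by (force simp: L_def unit_disk_def)
  define V where "V z = (x + z) / (x - z)" for z
  have ne: "x - z \<noteq> 0" if "z \<in> unit_disk" for z using that x1 by (auto simp: unit_disk_def)
  have xu: "x - u \<noteq> 0" using ne u by (simp add: unit_disk_def)
  have xu': "1 - cnj u * x \<noteq> 0"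
  proof
    assume "1 - cnj u * x = 0"
    from arg_cong[OF this, of cnj] have "x * (1 - u * cnj x) = 0" by simp
    then have "x - u * (x * cnj x) = 0" by (simp add: algebra_simps)
    then show False using xu xx by simp
  qed
  have fx: "x - u = \<zeta> * x * (1 - cnj u * x)" using rx by (simp add: power2_eq_square algebra_simps)
  have cL: "cnj L = (1 + cnj u * x) / (1 - cnj u * x)"
  proof -
    have "cnj L = (x * (cnj x + cnj u)) / (x * (cnj x - cnj u))" using x0 by (simp add: L_def)
    then show ?thesis using xx by (simp add: algebra_simps)
  qed
  have aff: "V (g z) = of_real (Re L) * V z + \<i> * of_real (Im L)" if z: "z \<in> unit_disk" for z
  proof -
    let ?M = "1 + cnj u * (\<zeta> * z)"
    have M0: "?M \<noteq> 0"
      using mult_neq_1_unit_disk[of "- cnj u" "\<zeta> * z"] u \<zeta> z by (auto simp: unit_disk_def norm_mult add_eq_0_iff)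
    have gM: "g z * ?M = \<zeta> * z + u" using form[OF z] M0 by simp
    have "V (g z) = ((x + g z) * ?M) / ((x - g z) * ?M)" using M0 by (simp add: V_def)
    also have "(x + g z) * ?M = (x + u) + \<zeta> * z * (1 + cnj u * x)" unfolding distrib_right gM by (simp add: algebra_simps)
    also have "(x - g z) * ?M = (x - u) - \<zeta> * z * (1 - cnj u * x)" unfolding left_diff_distrib gM by (simp add: algebra_simps)
    also have "\<dots> = \<zeta> * (1 - cnj u * x) * (x - z)" unfolding fx by (simp add: algebra_simps)
    also have "x + u = \<zeta> * x * (1 - cnj u * x) * L" using xu fx by (simp add: L_def)
    also have "\<zeta> * z * (1 + cnj u * x) = \<zeta> * z * (1 - cnj u * x) * cnj L" using xu' by (simp add: cL)
    also have "(\<zeta> * x * (1 - cnj u * x) * L + \<zeta> * z * (1 - cnj u * x) * cnj L) / (\<zeta> * (1 - cnj u * x) * (x - z))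
       = (\<zeta> * (1 - cnj u * x) * (x * L + z * cnj L)) / (\<zeta> * (1 - cnj u * x) * (x - z))" by (simp add: algebra_simps)
    also have "\<dots> = (x * L + z * cnj L) / (x - z)" using z0 xu' by simp
    also have "x * L + z * cnj L = of_real (Re L) * (x + z) + \<i> * of_real (Im L) * (x - z)"
      by (simp add: complex_eq_iff algebra_simps)
    also have "\<dots> / (x - z) = of_real (Re L) * V z + \<i> * of_real (Im L)"
    proof -
      have "(A * B + C * E) / E = A * (B / E) + C" if "E \<noteq> 0" for A B C E :: complex
        using that by (simp add: add_divide_distrib)
      from this[OF ne[OF z]] show ?thesis unfolding V_def .
    qed
    finally show ?thesis .
  qed
  show ?thesis
  proof (rule that)
    show "V holomorphic_on unit_disk" unfolding V_def by (intro holomorphic_intros ne)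
    show "bij_betw V unit_disk right_halfplane" unfolding V_def[abs_def] by (rule cayley_bij[OF x1])
    show "Re L > 0" using LH by (simp add: right_halfplane_def)
  qed (rule aff)
qed

text \<open>For \<open>l = 1\<close> the affine map is already a translation of the half-plane.
  Otherwise it is a dilation about a point of the imaginary axis, which the logarithm turns into a
  translation of the strip by \<open>ln l / 2\<close>.\<close>

lemma fixed_point_free_translation:
  assumes g: "g holomorphic_on unit_disk" "bij_betw g unit_disk unit_disk" and fpf: "\<And>z. z \<in> unit_disk \<Longrightarrow> g z \<noteq> z"
  obtains W \<eta> \<delta> \<mu> s where "model W \<eta> \<delta>" "\<mu> holomorphic_on unit_disk" "bij_betw \<mu> unit_disk W" "s \<noteq> 0"
    "\<And>z. z \<in> unit_disk \<Longrightarrow> \<mu> (g z) = \<mu> z + of_real s"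
proof -
  obtain V l s where V: "V holomorphic_on unit_disk" "bij_betw V unit_disk right_halfplane" "l > 0"
    "\<And>z. z \<in> unit_disk \<Longrightarrow> V (g z) = of_real l * V z + \<i> * of_real s"
    by (rule fixed_point_free_affine[OF g]; (erule fpf | (rule that; assumption)))
  have gD: "g z \<in> unit_disk" if "z \<in> unit_disk" for z using g(2) that by (auto simp: bij_betw_def)
  have VR: "V z \<in> right_halfplane" if "z \<in> unit_disk" for z using V(2) that by (auto simp: bij_betw_def)
  show ?thesis
  proof (cases "l = 1")
    case True
    have s: "s \<noteq> 0"
    proof
      assume "s = 0"
      then have "V (g 0) = V 0" using V(4)[of 0] True by (simp add: unit_disk_def)
      then have "g 0 = 0" using V(2) gD[of 0] by (auto simp: bij_betw_def inj_on_def unit_disk_def)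
      then show False using fpf[of 0] by (simp add: unit_disk_def)
    qed
    have "bij_betw (\<lambda>v. \<i> * v) right_halfplane upper_halfplane"
      by (rule bij_betw_byWitness[where f' = "\<lambda>v. - \<i> * v"]) (auto simp: upper_halfplane_def right_halfplane_def)
    then have b: "bij_betw ((\<lambda>v. \<i> * v) \<circ> V) unit_disk upper_halfplane" by (rule bij_betw_trans[OF V(2)])
    show ?thesis
      by (rule that[of upper_halfplane "\<lambda>y. 1 / y" 0 "(\<lambda>v. \<i> * v) \<circ> V" "- s"])
         (use b s V True in \<open>auto simp: model_def o_def algebra_simps intro!: holomorphic_intros\<close>)
  next
    case False
    \<comment> \<open>\<open>- \<i> * s / (l - 1)\<close> is the finite fixed point of
      \<open>v \<mapsto> l * v + \<i> * s\<close>; it is moved to the origin.\<close>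
    define V1 where "V1 z = V z + \<i> * of_real (s / (l - 1))" for z
    have "bij_betw (\<lambda>v. v + \<i> * of_real (s / (l - 1))) right_halfplane right_halfplane"
      by (rule bij_betw_byWitness[where f' = "\<lambda>v. v - \<i> * of_real (s / (l - 1))"])
         (auto simp: right_halfplane_def simp del: of_real_divide of_real_diff)
    then have b1: "bij_betw V1 unit_disk right_halfplane"
      using bij_betw_trans[OF V(2)] by (auto simp: V1_def[abs_def] o_def)
    have V1R: "V1 z \<in> right_halfplane" if "z \<in> unit_disk" for z using b1 that by (auto simp: bij_betw_def)
    have V1g: "V1 (g z) = of_real l * V1 z" if z: "z \<in> unit_disk" for z
    proof -
      have "s + s / (l - 1) = l * (s / (l - 1))" using False by (simp add: field_simps)
      then have "complex_of_real s + of_real (s / (l - 1)) = of_real l * of_real (s / (l - 1))"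
        by (simp only: of_real_add[symmetric] of_real_mult[symmetric])
      then show ?thesis unfolding V1_def V(4)[OF z] by (simp add: algebra_simps del: of_real_divide of_real_diff flip: distrib_left[of \<i>])
    qed
    have hV1: "V1 holomorphic_on unit_disk" unfolding V1_def by (intro holomorphic_intros V)
    define \<mu> where "\<mu> z = Ln (V1 z) / 2" for z
    have np: "V1 z \<notin> \<real>\<^sub>\<le>\<^sub>0" if "z \<in> unit_disk" for z
      using V1R[OF that] by (auto simp: right_halfplane_def complex_nonpos_Reals_iff)
    have h\<mu>: "\<mu> holomorphic_on unit_disk" unfolding \<mu>_def by (intro holomorphic_intros hV1 np) simp_all
    have b: "bij_betw (\<lambda>v. Ln v / 2) right_halfplane strip"
    proof -
      have i: "inv_into strip (\<lambda>\<zeta>. exp (2 * \<zeta>)) v = Ln v / 2" if "v \<in> right_halfplane" for v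
      proof -
        obtain \<zeta> where z: "\<zeta> \<in> strip" "v = exp (2 * \<zeta>)" using \<open>v \<in> right_halfplane\<close> bij_betw_imp_surj_on[OF exp_strip_bij] by blast
        then have "- pi < Im (2 * \<zeta>)" "Im (2 * \<zeta>) \<le> pi" by (auto simp: strip_def)
        then have l: "Ln v / 2 = \<zeta>" using z by (simp add: Ln_exp)
        have "inv_into strip (\<lambda>\<zeta>. exp (2 * \<zeta>)) v = \<zeta>"
          unfolding z(2) by (rule inv_into_f_f[OF bij_betw_imp_inj_on[OF exp_strip_bij] z(1)])
        then show ?thesis using l by simp
      qed
      show ?thesis by (rule iffD1[OF bij_betw_cong bij_betw_inv_into[OF exp_strip_bij]]) (rule i)
    qed
    have b\<mu>: "bij_betw \<mu> unit_disk strip" using bij_betw_trans[OF b1 b] by (simp add: \<mu>_def[abs_def] o_def)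
    have tr: "\<mu> (g z) = \<mu> z + of_real (ln l / 2)" if z: "z \<in> unit_disk" for z
    proof -
      have "V1 z \<noteq> 0" using V1R[OF z] by (auto simp: right_halfplane_def)
      then have "Ln (of_real l * V1 z) = of_real (ln l) + Ln (V1 z)" using V(3) Ln_times_of_real[of l "V1 z"] Ln_of_real[of l] by simp
      then show ?thesis by (simp add: \<mu>_def V1g[OF z] add_divide_distrib)
    qed
    show ?thesis
      by (rule that[of strip "\<lambda>y. tan (2 * y)" 1 \<mu> "ln l / 2"])
         (use h\<mu> b\<mu> tr False V(3) in \<open>auto simp: model_def\<close>)
  qed
qed

lemma holomorphic_zero_Im_imp_real_const:
  assumes f: "f holomorphic_on unit_disk" and im: "\<And>z. z \<in> unit_disk \<Longrightarrow> Im (f z) = 0"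
  obtains r :: real where "\<And>z. z \<in> unit_disk \<Longrightarrow> f z = of_real r"
proof -
  have zero: "0 \<in> unit_disk" by (simp add: unit_disk_def)
  have "f constant_on unit_disk"
  proof (rule ccontr)
    assume "\<not> f constant_on unit_disk"
    then have o: "open (f ` unit_disk)"
      using open_mapping_thm[OF f open_unit_disk connected_unit_disk open_unit_disk] by simp
    then obtain e where e: "e > 0" "ball (f 0) e \<subseteq> f ` unit_disk" using zero open_contains_ball by blast
    have "f 0 + \<i> * of_real (e / 2) \<in> ball (f 0) e" using e(1) by (simp add: dist_norm norm_mult)
    then obtain z where "z \<in> unit_disk" "f z = f 0 + \<i> * of_real (e / 2)" using e(2) by (metis imageE subsetD)
    then show False using im[of z] im[OF zero] e(1) by simp
  qed
  then obtain c where c: "\<And>z. z \<in> unit_disk \<Longrightarrow> f z = c" by (auto simp: constant_on_def)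
  have "c = of_real (Re c)" using c[OF zero] im[OF zero] by (simp add: complex_eq_iff)
  then show ?thesis using that[of "Re c"] c by simp
qed

section \<open>Translation coverings\<close>

text \<open>The generator is the infimum of the positive elements, which is attained because
  distinct elements are at least \<open>e\<close> apart.\<close>

lemma discrete_subgroup_cyclic:
  fixes G :: "real set"
  assumes diff: "\<And>r s. r \<in> G \<Longrightarrow> s \<in> G \<Longrightarrow> r - s \<in> G"
    and e: "e > 0" "\<And>r. r \<in> G \<Longrightarrow> \<bar>r\<bar> < e \<Longrightarrow> r = 0" and s: "s \<in> G" "s \<noteq> 0"
  obtains t where "t > 0" "\<And>r. r \<in> G \<longleftrightarrow> (\<exists>n::int. r = of_int n * t)"
proof -
  have 0: "0 \<in> G" using diff[OF s(1) s(1)] by simp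
  have neg: "- r \<in> G" if "r \<in> G" for r using diff[OF 0 that] by simp
  have add: "r + r' \<in> G" if "r \<in> G" "r' \<in> G" for r r' using diff[OF that(1) neg[OF that(2)]] by simp
  define A where "A = {r \<in> G. r > 0}"
  have "\<bar>s\<bar> \<in> A" using s neg[OF s(1)] by (auto simp: A_def abs_if)
  then have ne: "A \<noteq> {}" by blast
  have bdd: "bdd_below A" by (rule bdd_belowI[of _ 0]) (auto simp: A_def)
  define t where "t = Inf A"
  obtain r where r: "r \<in> A" "r < t + e" using cInf_lessD[OF ne, of "t + e"] e(1) by (auto simp: t_def)
  have lower: "t \<le> r'" if "r' \<in> A" for r' unfolding t_def by (rule cInf_lower[OF that bdd])
  have tA: "t \<in> A"
  proof (rule ccontr)
    assume "t \<notin> A"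
    then have "t < r" using lower[OF r(1)] r(1) by (cases "t = r") auto
    then obtain r' where r': "r' \<in> A" "r' < r" using cInf_lessD[OF ne, of r] by (auto simp: t_def)
    have "r - r' \<in> G" using diff r r' by (auto simp: A_def)
    moreover have "\<bar>r - r'\<bar> < e" using r r' lower[OF r'(1)] by auto
    ultimately have "r - r' = 0" by (rule e(2))
    then show False using r'(2) by simp
  qed
  have t0: "t > 0" and tG: "t \<in> G" using tA by (auto simp: A_def)
  have nat: "of_nat n * t \<in> G" for n :: nat
    by (induction n) (auto simp: 0 algebra_simps intro: add tG)
  have int: "of_int n * t \<in> G" for n :: int
  proof (cases "n \<ge> 0")
    case True then show ?thesis using nat[of "nat n"] by simp
  next
    case False then show ?thesis using neg[OF nat[of "nat (- n)"]] by simp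
  qed
  have "\<exists>n::int. r = of_int n * t" if rG: "r \<in> G" for r
  proof -
    define n where "n = \<lfloor>r / t\<rfloor>"
    have "of_int n \<le> r / t" "r / t < of_int n + 1" by (auto simp: n_def)
    then have b: "of_int n * t \<le> r" "r < of_int n * t + t" using t0 by (auto simp: field_simps)
    have "r - of_int n * t \<in> G" using diff rG int by blast
    then have "r - of_int n * t \<in> A \<or> r - of_int n * t = 0" using b by (auto simp: A_def)
    then have "r - of_int n * t = 0" using lower[of "r - of_int n * t"] b by linarith
    then show ?thesis by (intro exI[of _ n]) simp
  qed
  then show ?thesis using that[OF t0] int by blast
qed

section \<open>Quotients of the model domains by translations\<close>

definition covering_exp :: "real \<Rightarrow> complex \<Rightarrow> complex" where
  "covering_exp t \<zeta> = exp (2 * of_real pi * \<i> * \<zeta> / of_real t)"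

lemma covering_exp_holomorphic: "covering_exp t holomorphic_on S"
  unfolding covering_exp_def by (cases "t = 0") (auto intro!: holomorphic_intros)

lemma covering_exp_eq_iff:
  assumes "t > 0"
  shows "covering_exp t \<zeta>1 = covering_exp t \<zeta>2 \<longleftrightarrow> (\<exists>n::int. \<zeta>1 = \<zeta>2 + of_real (of_int n * t))"
proof -
  have "2 * of_real pi * \<i> * \<zeta>1 / of_real t = 2 * of_real pi * \<i> * \<zeta>2 / of_real t + (of_int (2 * n) * pi) * \<i>
      \<longleftrightarrow> \<zeta>1 = \<zeta>2 + of_real (of_int n * t)" for n :: int
  proof -
    have "2 * of_real pi * \<i> * \<zeta>2 / of_real t + (of_int (2 * n) * pi) * \<i> = 2 * of_real pi * \<i> * (\<zeta>2 + of_real (of_int n * t)) / of_real t"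
      using assms by (simp add: field_simps)
    then show ?thesis using assms by simp
  qed
  then show ?thesis unfolding covering_exp_def exp_eq by simp
qed

lemma norm_covering_exp: "norm (covering_exp t \<zeta>) = exp (- (2 * pi * Im \<zeta> / t))"
proof -
  have "2 * complex_of_real pi * \<i> * \<zeta> / complex_of_real t = \<i> * \<zeta> * of_real (2 * pi / t)" by simp
  then have "Re (2 * complex_of_real pi * \<i> * \<zeta> / complex_of_real t) = - (2 * pi * Im \<zeta> / t)"
    by (simp del: of_real_divide of_real_mult)
  then show ?thesis by (simp add: covering_exp_def)
qed

lemma covering_exp_surj:
  assumes "t > 0" "w \<noteq> 0"
  obtains \<zeta> where "covering_exp t \<zeta> = w"
proof -
  have "covering_exp t (Ln w * of_real t / (2 * of_real pi * \<i>)) = w"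
    using assms by (simp add: covering_exp_def)
  then show ?thesis by (rule that)
qed

lemma covering_exp_upper_halfplane:
  assumes "t > 0"
  shows "covering_exp t ` upper_halfplane = punct_disk" "covering_exp t \<zeta> \<in> punct_disk \<Longrightarrow> \<zeta> \<in> upper_halfplane"
proof -
  have *: "covering_exp t \<zeta> \<in> punct_disk \<longleftrightarrow> \<zeta> \<in> upper_halfplane" for \<zeta>
  proof -
    have "covering_exp t \<zeta> \<noteq> 0" by (simp add: covering_exp_def)
    then have "covering_exp t \<zeta> \<in> punct_disk \<longleftrightarrow> norm (covering_exp t \<zeta>) < 1" by (simp add: punct_disk_def)
    also have "\<dots> \<longleftrightarrow> Im \<zeta> > 0"
      unfolding norm_covering_exp using assms by (simp add: zero_less_mult_iff zero_less_divide_iff)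
    finally show ?thesis by (simp add: upper_halfplane_def)
  qed
  then show "covering_exp t \<zeta> \<in> punct_disk \<Longrightarrow> \<zeta> \<in> upper_halfplane" by blast
  show "covering_exp t ` upper_halfplane = punct_disk"
  proof
    show "covering_exp t ` upper_halfplane \<subseteq> punct_disk" using * by blast
    show "punct_disk \<subseteq> covering_exp t ` upper_halfplane"
    proof
      fix w assume w: "w \<in> punct_disk"
      then obtain \<zeta> where "covering_exp t \<zeta> = w" using covering_exp_surj[OF assms] by (auto simp: punct_disk_def)
      then show "w \<in> covering_exp t ` upper_halfplane" using * w by blast
    qed
  qed
qed

text \<open>The radius is the modulus at the edge of the strip:
  \<open>2 * pi * (pi / 4) / t = pi^2 / (2 * t)\<close>.\<close>

lemma covering_exp_strip:
  assumes "t > 0" and R: "R = exp (pi\<^sup>2 / (2 * t))"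
  shows "covering_exp t ` strip = annulus R" "covering_exp t \<zeta> \<in> annulus R \<Longrightarrow> \<zeta> \<in> strip"
proof -
  have *: "covering_exp t \<zeta> \<in> annulus R \<longleftrightarrow> \<zeta> \<in> strip" for \<zeta>
  proof -
    have "1 / R = exp (- (pi\<^sup>2 / (2 * t)))" by (simp add: R exp_minus field_simps)
    then have "covering_exp t \<zeta> \<in> annulus R \<longleftrightarrow> - (pi\<^sup>2 / (2 * t)) < - (2 * pi * Im \<zeta> / t) \<and> - (2 * pi * Im \<zeta> / t) < pi\<^sup>2 / (2 * t)"
      by (simp only: annulus_def mem_Collect_eq norm_covering_exp R exp_less_cancel_iff)
    also have "\<dots> \<longleftrightarrow> 2 * pi * Im \<zeta> / t < pi * pi / 2 / t \<and> - (pi * pi / 2) / t < 2 * pi * Im \<zeta> / t"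
      by (auto simp: power2_eq_square)
    also have "\<dots> \<longleftrightarrow> pi * (2 * Im \<zeta>) < pi * (pi / 2) \<and> pi * (- (pi / 2)) < pi * (2 * Im \<zeta>)"
      using assms(1) by (simp only: divide_less_cancel) (simp add: mult_ac)
    also have "\<dots> \<longleftrightarrow> 2 * Im \<zeta> < pi / 2 \<and> - (pi / 2) < 2 * Im \<zeta>"
      by (simp only: mult_less_cancel_left_pos[OF pi_gt_zero])
    also have "\<dots> \<longleftrightarrow> \<zeta> \<in> strip" by (auto simp: strip_def)
    finally show ?thesis .
  qed
  then show "covering_exp t \<zeta> \<in> annulus R \<Longrightarrow> \<zeta> \<in> strip" by blast
  have "R > 0" by (simp add: R)
  show "covering_exp t ` strip = annulus R"
  proof
    show "covering_exp t ` strip \<subseteq> annulus R" using * by blast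
    show "annulus R \<subseteq> covering_exp t ` strip"
    proof
      fix w assume w: "w \<in> annulus R"
      then have "w \<noteq> 0" using \<open>R > 0\<close> by (auto simp: annulus_def)
      then obtain \<zeta> where "covering_exp t \<zeta> = w" using covering_exp_surj[OF assms(1)] by blast
      then show "w \<in> covering_exp t ` strip" using * w by blast
    qed
  qed
qed

text \<open>Dilations of the upper half-plane rescale the period, so every \<open>t\<close> yields
  the punctured disk; for the strip, \<open>t\<close> determines the annulus.\<close>

definition model_surface :: "complex set \<Rightarrow> real \<Rightarrow> complex set \<Rightarrow> bool" where
  "model_surface W t S \<longleftrightarrow> t > 0 \<and> ((W = upper_halfplane \<and> S = punct_disk) \<or> (W = strip \<and> S = annulus (exp (pi\<^sup>2 / (2 * t)))))"

lemma model_surfaceD: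
  assumes "model_surface W t S"
  shows "t > 0" "covering_exp t ` W = S" "\<And>\<zeta>. covering_exp t \<zeta> \<in> S \<Longrightarrow> \<zeta> \<in> W" "open S" "0 \<notin> S"
proof -
  have m: "t > 0" "(W = upper_halfplane \<and> S = punct_disk) \<or> (W = strip \<and> S = annulus (exp (pi\<^sup>2 / (2 * t))))"
    using assms by (auto simp: model_surface_def)
  show "t > 0" by (rule m)
  show "covering_exp t ` W = S" using m(2) covering_exp_upper_halfplane(1)[OF m(1)] covering_exp_strip(1)[OF m(1) refl] by blast
  then show "0 \<notin> S" by (auto simp: covering_exp_def)
  show "\<And>\<zeta>. covering_exp t \<zeta> \<in> S \<Longrightarrow> \<zeta> \<in> W" using m(2) covering_exp_upper_halfplane(2)[OF m(1)] covering_exp_strip(2)[OF m(1) refl] by blast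
  have "annulus R = {z. 1 / R < norm z} \<inter> {z. norm z < R}" for R by (auto simp: annulus_def)
  then have "open (annulus R)" for R by (auto intro!: open_Int open_Collect_less continuous_intros)
  moreover have "open punct_disk" by (auto simp: punct_disk_def intro: open_Diff)
  ultimately show "open S" using m(2) by auto
qed

lemma covering_exp_locally_inj:
  assumes t: "t > 0" and W: "open W"
  shows "locally_inj_on (covering_exp t) W"
  unfolding locally_inj_on_def
proof
  fix y assume y: "y \<in> W"
  have "inj_on (covering_exp t) (W \<inter> ball y (t / 2))"
  proof (rule inj_onI)
    fix a b assume ab: "a \<in> W \<inter> ball y (t / 2)" "b \<in> W \<inter> ball y (t / 2)" "covering_exp t a = covering_exp t b"
    then obtain n :: int where n: "a = b + of_real (of_int n * t)" using covering_exp_eq_iff[OF t] by blast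
    have "dist a b < t" using ab dist_triangle_half_r[of y a t b] by simp
    then have "\<bar>of_int n * t\<bar> < t" unfolding n dist_norm by (simp del: of_real_mult)
    then have "n = 0" using t by (simp add: abs_mult)
    then show "a = b" using n by simp
  qed
  then show "\<exists>N. open N \<and> y \<in> N \<and> N \<subseteq> W \<and> inj_on (covering_exp t) N"
    using y t W by (intro exI[of _ "W \<inter> ball y (t / 2)"]) auto
qed

section \<open>Invariant functions and translation coverings\<close>

context disk_cover
begin

definition invariants :: "(complex \<Rightarrow> complex) set" where
  "invariants = {f \<in> A_disk. \<forall>z1\<in>unit_disk. \<forall>z2\<in>unit_disk. p z1 = p z2 \<longrightarrow> f z1 = f z2}"

definition translation_cover :: "complex set \<Rightarrow> (complex \<Rightarrow> complex) \<Rightarrow> real \<Rightarrow> bool" where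
  "translation_cover W \<mu> t \<longleftrightarrow> \<mu> holomorphic_on unit_disk \<and> bij_betw \<mu> unit_disk W \<and> t > 0 \<and>
     (\<forall>z1\<in>unit_disk. \<forall>z2\<in>unit_disk. p z1 = p z2 \<longleftrightarrow> (\<exists>n::int. \<mu> z1 = \<mu> z2 + of_real (of_int n * t)))"

lemma deckD:
  assumes "g \<in> deck"
  shows "g holomorphic_on unit_disk" "bij_betw g unit_disk unit_disk" "g ` unit_disk = unit_disk"
    "\<And>z. z \<in> unit_disk \<Longrightarrow> p (g z) = p z" "\<And>z. z \<in> unit_disk \<Longrightarrow> g z \<in> unit_disk"
  using assms by (auto simp: deck_def bij_betw_def)

lemma deck_fixed_point:
  assumes "g \<in> deck" "a \<in> unit_disk" "g a = a" "z \<in> unit_disk"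
  shows "g z = z"
  by (rule deck_unique[of g a z]) (use assms deckD[OF assms(1)] in \<open>auto intro: holomorphic_on_imp_continuous_on\<close>)

text \<open>The powers of \<open>g\<close> supply the infinite orbit for
  \<open>invariant_imp_pull\<close>: \<open>g ^^ n\<close> translates \<open>\<mu>\<close> by
  \<open>n * s\<close>, so the images of the origin are distinct, while \<open>Im \<mu>\<close> and
  with it the moment map stay fixed.\<close>

lemma invariants_pull:
  assumes \<mu>: "bij_betw \<mu> unit_disk W" and s: "s \<noteq> 0"
    and g: "g \<in> deck" "\<And>z. z \<in> unit_disk \<Longrightarrow> \<mu> (g z) = \<mu> z + of_real s"
    and b: "b \<noteq> 0" "\<And>z. z \<in> unit_disk \<Longrightarrow> mom a b (z, cnj z) = of_real (\<eta> (Im (\<mu> z)))"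
    and f: "f \<in> invariants"
  shows "\<exists>E. E holomorphic_on UNIV \<and> f = pull a b E"
proof (rule invariant_imp_pull[where \<Gamma> = "range (\<lambda>n. g ^^ n)"])
  note gD = deckD[OF g(1)]
  have it: "(g ^^ n) z \<in> unit_disk \<and> \<mu> ((g ^^ n) z) = \<mu> z + of_real (of_nat n * s) \<and> p ((g ^^ n) z) = p z"
    if "z \<in> unit_disk" for n z
    using that by (induction n) (auto simp: gD g(2) algebra_simps)
  have im: "(g ^^ n) ` unit_disk = unit_disk" for n
  proof (induction n)
    case (Suc n)
    have "(g ^^ Suc n) ` unit_disk = g ` ((g ^^ n) ` unit_disk)" by (simp add: image_image)
    then show ?case by (simp only: Suc gD(3))
  qed simp
  show "f \<in> A_disk" "b \<noteq> 0" using f b by (auto simp: invariants_def)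
  have hol: "(g ^^ n) holomorphic_on unit_disk" for n
  proof (induction n)
    case (Suc n)
    then show ?case unfolding funpow.simps by (intro holomorphic_on_compose) (simp_all add: im gD(1))
  qed (simp add: holomorphic_on_id)
  show "k holomorphic_on unit_disk" "k ` unit_disk = unit_disk" if "k \<in> range (\<lambda>n. g ^^ n)" for k
    using that hol im by auto
  show "f (k z) = f z" if kr: "k \<in> range (\<lambda>n. g ^^ n)" and z: "z \<in> unit_disk" for k z
  proof -
    obtain n where n: "k = g ^^ n" using kr by blast
    have "k z \<in> unit_disk" "p (k z) = p z" using it[OF z, of n] n by auto
    then show ?thesis using f z unfolding invariants_def by blast
  qed
  show "mom a b (k z, cnj (k z)) = mom a b (z, cnj z)" if kr: "k \<in> range (\<lambda>n. g ^^ n)" and z: "z \<in> unit_disk" for k z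
  proof -
    obtain n where k: "k = g ^^ n" using kr by blast
    have "k z \<in> unit_disk" "\<mu> (k z) = \<mu> z + of_real (of_nat n * s)" using it[OF z, of n] k by auto
    then show ?thesis using b(2)[of "k z"] b(2)[OF z] by simp
  qed
  have zero: "0 \<in> unit_disk" by (simp add: unit_disk_def)
  have "inj (\<lambda>n. (g ^^ n) 0)"
  proof (rule injI)
    fix n m assume "(g ^^ n) 0 = (g ^^ m) 0"
    then have "\<mu> ((g ^^ n) 0) = \<mu> ((g ^^ m) 0)" by simp
    then have "of_nat n * s = of_nat m * s" using it[OF zero, of n] it[OF zero, of m] by (simp del: of_real_mult)
    then show "n = m" using s by simp
  qed
  then have "infinite (range (\<lambda>n. (g ^^ n) 0))" by (rule range_inj_infinite)
  then show "infinite ((\<lambda>k. k 0) ` range (\<lambda>n. g ^^ n))" by (simp add: image_image)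
qed

text \<open>If \<open>\<gamma>\<^sub>1\<close> translates in the coordinate \<open>\<mu>\<close> and some invariant function is not constant, then the moment map
  of every other deck transformation is proportional to that of \<open>\<gamma>\<^sub>1\<close>, so that it preserves \<open>Im \<mu>\<close>.\<close>
lemma translation_cover_exists:
  assumes ni: "\<not> inj_on p unit_disk"
    and nc: "f0 \<in> invariants" "\<not> (\<exists>c. \<forall>z\<in>unit_disk. f0 z = c)"
  obtains W \<eta> \<delta> \<mu> t where "model W \<eta> \<delta>" "translation_cover W \<mu> t"
proof -
  have zero: "0 \<in> unit_disk" by (simp add: unit_disk_def)
  obtain x y where xy: "x \<in> unit_disk" "y \<in> unit_disk" "p x = p y" "x \<noteq> y" using ni by (auto simp: inj_on_def)
  obtain g where g: "g \<in> deck" "g x = y" using deck_transitive[OF xy(1-3)] by blast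
  have fpf: "g z \<noteq> z" if "z \<in> unit_disk" for z
    using deck_fixed_point[OF g(1) that _ xy(1)] g(2) xy(4) by auto
  obtain W \<eta> \<delta> \<mu> s where m: "model W \<eta> \<delta>" and \<mu>: "\<mu> holomorphic_on unit_disk" "bij_betw \<mu> unit_disk W"
    and s: "s \<noteq> 0" "\<And>z. z \<in> unit_disk \<Longrightarrow> \<mu> (g z) = \<mu> z + of_real s"
    by (rule fixed_point_free_translation[OF deckD(1,2)[OF g(1)]]; (erule fpf | (rule that; assumption)))
  obtain a b where b: "b \<noteq> 0" and ab: "\<And>z. z \<in> unit_disk \<Longrightarrow> mom a b (z, cnj z) = of_real (\<eta> (Im (\<mu> z)))"
    using model_moment[OF m \<mu>] by metis
  obtain E where E: "E holomorphic_on UNIV" "f0 = pull a b E"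
    using invariants_pull[OF \<mu>(2) s(1) g(1) s(2) b ab nc(1)] by blast
  have \<mu>D: "\<mu> z \<in> W" if "z \<in> unit_disk" for z using \<mu>(2) that by (auto simp: bij_betw_def)
  have \<mu>i: "z = w" if "z \<in> unit_disk" "w \<in> unit_disk" "\<mu> z = \<mu> w" for z w
    using \<mu>(2) that by (auto simp: bij_betw_def inj_on_def)
  have tr: "\<exists>r::real. \<forall>z\<in>unit_disk. \<mu> (h z) = \<mu> z + of_real r" if h: "h \<in> deck" for h
  proof (cases "\<exists>z\<in>unit_disk. h z = z")
    case True
    then have "\<forall>z\<in>unit_disk. h z = z" using deck_fixed_point[OF h] by blast
    then show ?thesis by (intro exI[of _ 0]) simp
  next
    case False
    then have fpf': "h z \<noteq> z" if "z \<in> unit_disk" for z using that by blast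
    obtain W' \<eta>' \<delta>' \<mu>' s' where m': "model W' \<eta>' \<delta>'" and \<mu>': "\<mu>' holomorphic_on unit_disk" "bij_betw \<mu>' unit_disk W'"
      and s': "s' \<noteq> 0" "\<And>z. z \<in> unit_disk \<Longrightarrow> \<mu>' (h z) = \<mu>' z + of_real s'"
      by (rule fixed_point_free_translation[OF deckD(1,2)[OF h]]; (erule fpf' | (rule that; assumption)))
    obtain a' b' where b': "b' \<noteq> 0" and ab': "\<And>z. z \<in> unit_disk \<Longrightarrow> mom a' b' (z, cnj z) = of_real (\<eta>' (Im (\<mu>' z)))"
      using model_moment[OF m' \<mu>'] by metis
    obtain E' where E': "E' holomorphic_on UNIV" "f0 = pull a' b' E'"
      using invariants_pull[OF \<mu>'(2) s'(1) h s'(2) b' ab' nc(1)] by blast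
    have "\<not> (\<exists>c. \<forall>t. E t = c)"
    proof
      assume "\<exists>c. \<forall>t. E t = c"
      then obtain c where "\<And>t. E t = c" by blast
      then have "\<forall>z\<in>unit_disk. f0 z = c" by (simp add: E(2) pull_def)
      then show False using nc(2) by blast
    qed
    then obtain k :: real where k: "k \<noteq> 0" "a' = k * a" "b' = of_real k * b"
      using pull_eq_pull_cases[OF E(1) E'(1) b b'] E(2) E'(2) by metis
    have mk: "mom a' b' (z, cnj z) = of_real k * mom a b (z, cnj z)" for z
    proof -
      have "of_real a' * (1 + z * cnj z) + b' * z + cnj b' * cnj z = of_real k * (of_real a * (1 + z * cnj z) + b * z + cnj b * cnj z)"
        by (simp add: k algebra_simps)
      then show ?thesis by (simp only: mom_def fst_conv snd_conv times_divide_eq_right)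
    qed
    have "Im (\<mu> (h z)) = Im (\<mu> z)" if z: "z \<in> unit_disk" for z
    proof -
      have hz: "h z \<in> unit_disk" using deckD(5)[OF h z] .
      have "mom a' b' (h z, cnj (h z)) = mom a' b' (z, cnj z)" using ab'[OF z] ab'[OF hz] s'(2)[OF z] by simp
      then have "mom a b (h z, cnj (h z)) = mom a b (z, cnj z)" unfolding mk using k(1) by simp
      then have "\<eta> (Im (\<mu> (h z))) = \<eta> (Im (\<mu> z))" unfolding ab[OF z] ab[OF hz] by simp
      then show ?thesis by (rule model_inj[OF m \<mu>D[OF hz] \<mu>D[OF z]])
    qed
    then have im: "Im (\<mu> (h z) - \<mu> z) = 0" if "z \<in> unit_disk" for z using that by simp
    have "\<mu> \<circ> h holomorphic_on unit_disk"
      by (rule holomorphic_on_compose[OF deckD(1)[OF h]]) (simp add: deckD(3)[OF h] \<mu>(1))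
    then have "(\<lambda>z. \<mu> (h z) - \<mu> z) holomorphic_on unit_disk"
      using \<mu>(1) by (auto simp: o_def intro: holomorphic_intros)
    then obtain r where "\<And>z. z \<in> unit_disk \<Longrightarrow> \<mu> (h z) - \<mu> z = of_real r"
      by (rule holomorphic_zero_Im_imp_real_const) (use im in auto)
    then show ?thesis by (intro exI[of _ r]) (auto simp: diff_eq_eq add.commute)
  qed
  \<comment> \<open>The translation lengths of the deck transformations. Closure under differences
    comes from \<open>deck_transitive\<close>, and discreteness from the injectivity of
    \<open>p\<close> near the origin.\<close>
  define G where "G = {r::real. \<exists>h\<in>deck. \<forall>z\<in>unit_disk. \<mu> (h z) = \<mu> z + of_real r}"
  have diff: "r1 - r2 \<in> G" if r: "r1 \<in> G" "r2 \<in> G" for r1 r2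
  proof -
    obtain h1 h2 where h: "h1 \<in> deck" "\<And>z. z \<in> unit_disk \<Longrightarrow> \<mu> (h1 z) = \<mu> z + of_real r1"
      "h2 \<in> deck" "\<And>z. z \<in> unit_disk \<Longrightarrow> \<mu> (h2 z) = \<mu> z + of_real r2" using r unfolding G_def by blast
    have D: "h1 0 \<in> unit_disk" "h2 0 \<in> unit_disk" "p (h2 0) = p (h1 0)"
      using deckD(4,5)[OF h(1) zero] deckD(4,5)[OF h(3) zero] by auto
    obtain h3 where h3: "h3 \<in> deck" "h3 (h2 0) = h1 0" using deck_transitive[OF D(2,1,3)] by blast
    obtain r where r: "\<forall>z\<in>unit_disk. \<mu> (h3 z) = \<mu> z + of_real r" using tr[OF h3(1)] by blast
    then have "\<mu> (h1 0) = \<mu> (h2 0) + of_real r" using D(2) h3(2) by metis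
    then have "of_real r1 = of_real r2 + (of_real r :: complex)" using h(2)[OF zero] h(4)[OF zero] by simp
    then have "r1 = r2 + r" by (metis of_real_add of_real_eq_iff)
    then show ?thesis using r h3(1) unfolding G_def by auto
  qed
  obtain N where N: "open N" "0 \<in> N" "N \<subseteq> unit_disk" "inj_on p N" using locally_inj_onE[OF p_locally_inj zero] .
  have "open (\<mu> ` N)"
    by (rule open_mapping_thm3[OF holomorphic_on_subset[OF \<mu>(1) N(3)] N(1)])
       (use \<mu>(2) N(3) in \<open>auto simp: bij_betw_def intro: inj_on_subset\<close>)
  then obtain e where e: "e > 0" "ball (\<mu> 0) e \<subseteq> \<mu> ` N" using N(2) open_contains_ball by blast
  have disc: "r = 0" if r: "r \<in> G" "\<bar>r\<bar> < e" for r
  proof -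
    obtain h where h: "h \<in> deck" "\<And>z. z \<in> unit_disk \<Longrightarrow> \<mu> (h z) = \<mu> z + of_real r" using r(1) unfolding G_def by blast
    have "\<mu> (h 0) \<in> ball (\<mu> 0) e" using h(2)[OF zero] r(2) by (simp add: dist_norm)
    then obtain z where z: "z \<in> N" "\<mu> (h 0) = \<mu> z" using e(2) by blast
    have "z \<in> unit_disk" using z(1) N(3) by blast
    then have "h 0 = z" using \<mu>i[OF deckD(5)[OF h(1) zero] _ z(2)] by blast
    then have "p z = p 0" using deckD(4)[OF h(1) zero] by simp
    then have "z = 0" using N(2,4) z(1) by (auto simp: inj_on_def)
    then show ?thesis using z(2) h(2)[OF zero] by simp
  qed
  have "s \<in> G" using g(1) s(2) unfolding G_def by blast
  then obtain t where t: "t > 0" "\<And>r. r \<in> G \<longleftrightarrow> (\<exists>n::int. r = of_int n * t)"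
    using discrete_subgroup_cyclic[OF diff e(1) disc _ s(1)] by blast
  have "p z1 = p z2 \<longleftrightarrow> (\<exists>n::int. \<mu> z1 = \<mu> z2 + of_real (of_int n * t))" if z: "z1 \<in> unit_disk" "z2 \<in> unit_disk" for z1 z2
  proof
    assume "p z1 = p z2"
    then obtain h where h: "h \<in> deck" "h z2 = z1" using deck_transitive[OF z(2,1)] by metis
    obtain r where r: "\<forall>z\<in>unit_disk. \<mu> (h z) = \<mu> z + of_real r" using tr[OF h(1)] by blast
    then have "r \<in> G" using h(1) unfolding G_def by blast
    then show "\<exists>n::int. \<mu> z1 = \<mu> z2 + of_real (of_int n * t)" using t(2) r z(2) h(2) by metis
  next
    assume "\<exists>n::int. \<mu> z1 = \<mu> z2 + of_real (of_int n * t)"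
    then obtain n :: int where n: "\<mu> z1 = \<mu> z2 + of_real (of_int n * t)" by blast
    have "of_int n * t \<in> G" using t(2) by blast
    then obtain h where h: "h \<in> deck" "\<forall>z\<in>unit_disk. \<mu> (h z) = \<mu> z + of_real (of_int n * t)" unfolding G_def by blast
    have "h z2 = z1" using \<mu>i[OF deckD(5)[OF h(1) z(2)] z(1)] h(2) z(2) n by simp
    then show "p z1 = p z2" using deckD(4)[OF h(1) z(2)] by simp
  qed
  then have "translation_cover W \<mu> t" using \<mu> t(1) by (simp add: translation_cover_def)
  then show ?thesis by (rule that[OF m])
qed

text \<open>A deck transformation translating by \<open>t\<close> puts every invariant function into
  the form \<open>pull a b E\<close>. Conversely, the moment map depends on \<open>Im \<mu>\<close>
  only and is therefore constant on fibres.\<close>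

lemma translation_cover_invariants:
  assumes m: "model W \<eta> \<delta>" and tc: "translation_cover W \<mu> t"
    and b: "b \<noteq> 0" "\<And>z. z \<in> unit_disk \<Longrightarrow> mom a b (z, cnj z) = of_real (\<eta> (Im (\<mu> z)))"
  shows "invariants = {pull a b E | E. E holomorphic_on UNIV}"
proof
  have \<mu>: "\<mu> holomorphic_on unit_disk" "bij_betw \<mu> unit_disk W" "t > 0"
    and fib: "\<And>z1 z2. z1 \<in> unit_disk \<Longrightarrow> z2 \<in> unit_disk \<Longrightarrow> p z1 = p z2 \<longleftrightarrow> (\<exists>n::int. \<mu> z1 = \<mu> z2 + of_real (of_int n * t))"
    using tc by (auto simp: translation_cover_def)
  have zero: "0 \<in> unit_disk" by (simp add: unit_disk_def)
  have \<mu>0: "\<mu> 0 \<in> W" using \<mu>(2) zero by (auto simp: bij_betw_def)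
  have "\<mu> 0 + of_real t \<in> \<mu> ` unit_disk" using model_domain(3)[OF m \<mu>0] \<mu>(2) by (simp add: bij_betw_def)
  then obtain w where w: "w \<in> unit_disk" "\<mu> w = \<mu> 0 + of_real t" by (metis imageE)
  then have "p w = p 0" using fib[OF w(1) zero] by (auto intro: exI[of _ 1])
  then obtain g where g: "g \<in> deck" "g 0 = w" using deck_transitive[OF zero w(1)] by auto
  \<comment> \<open>By the choice of \<open>g\<close> this holds at 0. Elsewhere the two sides
    differ by some multiple of \<open>t\<close>, so they are lifts of one map through
    \<open>covering_exp t\<close>, and uniqueness of lifts applies.\<close>
  have "\<mu> (g z) = \<mu> z + of_real t" if z: "z \<in> unit_disk" for z
  proof (rule unique_lift[where c = "covering_exp t" and B = UNIV and A = unit_disk and a = 0 and ?g1.0 = "\<lambda>z. \<mu> (g z)"])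
    show "locally_inj_on (covering_exp t) UNIV" using covering_exp_locally_inj[OF \<mu>(3) open_UNIV] .
    have "\<mu> \<circ> g holomorphic_on unit_disk"
      by (rule holomorphic_on_compose[OF deckD(1)[OF g(1)]]) (simp add: deckD(3)[OF g(1)] \<mu>(1))
    then show "continuous_on unit_disk (\<lambda>z. \<mu> (g z))" using holomorphic_on_imp_continuous_on by (auto simp: o_def)
    show "continuous_on unit_disk (\<lambda>z. \<mu> z + of_real t)"
      by (intro continuous_intros holomorphic_on_imp_continuous_on \<mu>)
    show "covering_exp t (\<mu> (g x)) = covering_exp t (\<mu> x + of_real t)" if x: "x \<in> unit_disk" for x
    proof -
      obtain n :: int where "\<mu> (g x) = \<mu> x + of_real (of_int n * t)"
        using fib[OF deckD(5)[OF g(1) x] x] deckD(4)[OF g(1) x] by auto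
      then have "\<mu> (g x) = (\<mu> x + of_real t) + of_real (of_int (n - 1) * t)" by (simp add: algebra_simps)
      then show ?thesis using covering_exp_eq_iff[OF \<mu>(3)] by blast
    qed
  qed (use zero z g w in auto)
  then show "invariants \<subseteq> {pull a b E | E. E holomorphic_on UNIV}"
  proof (intro subsetI)
    assume tr: "\<And>z. z \<in> unit_disk \<Longrightarrow> \<mu> (g z) = \<mu> z + of_real t"
    fix f assume f: "f \<in> invariants"
    have "t \<noteq> 0" using \<mu>(3) by simp
    from invariants_pull[OF \<mu>(2) this g(1) tr b f]
    show "f \<in> {pull a b E | E. E holomorphic_on UNIV}" by blast
  qed
  show "{pull a b E | E. E holomorphic_on UNIV} \<subseteq> invariants"
  proof clarify
    fix E :: "complex \<Rightarrow> complex" assume E: "E holomorphic_on UNIV"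
    have eq: "pull a b E z1 = pull a b E z2" if z: "z1 \<in> unit_disk" "z2 \<in> unit_disk" "p z1 = p z2" for z1 z2
    proof -
      obtain n :: int where "\<mu> z1 = \<mu> z2 + of_real (of_int n * t)" using fib[OF z(1,2)] z(3) by auto
      then have "Im (\<mu> z1) = Im (\<mu> z2)" by simp
      then show ?thesis using z b(2) by (simp add: pull_def)
    qed
    show "pull a b E \<in> invariants"
      unfolding invariants_def by (intro CollectI conjI ballI impI pull_in_A_disk[OF E] eq)
  qed
qed

lemma translation_cover_imp_conf_equiv:
  assumes m: "model W \<eta> \<delta>" and tc: "translation_cover W \<mu> t" and S: "model_surface W t S"
  shows "conf_equiv X atlas S"
proof (rule conf_equiv_same_fibres[where q = "covering_exp t \<circ> \<mu>"])
  note SD = model_surfaceD[OF S]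
  have \<mu>: "\<mu> holomorphic_on unit_disk" "\<mu> ` unit_disk = W" using tc by (auto simp: translation_cover_def bij_betw_def)
  show "covering_exp t \<circ> \<mu> holomorphic_on unit_disk"
    by (rule holomorphic_on_compose[OF \<mu>(1) covering_exp_holomorphic])
  show "(covering_exp t \<circ> \<mu>) ` unit_disk = S" using SD(2) \<mu>(2) by (metis image_comp)
  show "open S" by (rule SD(4))
  show "(covering_exp t \<circ> \<mu>) z1 = (covering_exp t \<circ> \<mu>) z2 \<longleftrightarrow> p z1 = p z2" if "z1 \<in> unit_disk" "z2 \<in> unit_disk" for z1 z2
    using that tc covering_exp_eq_iff[OF SD(1)] by (simp add: translation_cover_def)
qed

text \<open>The covering \<open>c\<close> of \<open>S\<close> omits 0 and so has a logarithm on the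
  disk. Rescaled, this is a lift \<open>\<mu>\<close> through \<open>covering_exp t\<close>,
  bijective by \<open>biholomorphic_lift\<close>.\<close>

lemma conf_equiv_imp_translation_cover:
  assumes m: "model W \<eta> \<delta>" and S: "model_surface W t S" and ce: "conf_equiv X atlas S"
  obtains \<mu> where "translation_cover W \<mu> t"
proof -
  note SD = model_surfaceD[OF S]
  obtain c where c: "c holomorphic_on unit_disk" "locally_inj_on c unit_disk" "covering_space unit_disk c S"
    and fib: "\<And>z1 z2. z1 \<in> unit_disk \<Longrightarrow> z2 \<in> unit_disk \<Longrightarrow> c z1 = c z2 \<longleftrightarrow> p z1 = p z2"
    by (rule conf_equiv_imp_covering_space[OF ce SD(4)]) (rule that; assumption)
  have cS: "c z \<in> S" if "z \<in> unit_disk" for z using covering_space_imp_surjective[OF c(3)] that by blast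
  have contr: "contractible unit_disk" by (simp add: unit_disk_def convex_imp_contractible)
  have "c z \<noteq> 0" if "z \<in> unit_disk" for z using cS[OF that] SD(5) by metis
  then obtain l where l: "l holomorphic_on unit_disk" "\<And>z. z \<in> unit_disk \<Longrightarrow> c z = exp (l z)"
    using contractible_imp_holomorphic_log[OF c(1) contr] by metis
  define \<mu> where "\<mu> z = l z * of_real t / (2 * of_real pi * \<i>)" for z
  have h\<mu>: "\<mu> holomorphic_on unit_disk" unfolding \<mu>_def by (intro holomorphic_intros l(1)) simp_all
  have e: "covering_exp t (\<mu> z) = c z" if "z \<in> unit_disk" for z
    using l(2)[OF that] SD(1) by (simp add: covering_exp_def \<mu>_def)
  have \<mu>W: "\<mu> ` unit_disk \<subseteq> W" using SD(3) e cS by (metis image_subsetI)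
  have "bij_betw \<mu> unit_disk W"
    by (rule biholomorphic_lift[OF c(3,2) model_domain(1,2)[OF m] _ covering_exp_locally_inj[OF SD(1) model_domain(1)[OF m]] _
          holomorphic_on_imp_continuous_on[OF h\<mu>] \<mu>W e])
       (simp_all add: SD(2) holomorphic_on_imp_continuous_on covering_exp_holomorphic)
  moreover have "p z1 = p z2 \<longleftrightarrow> (\<exists>n::int. \<mu> z1 = \<mu> z2 + of_real (of_int n * t))" if z: "z1 \<in> unit_disk" "z2 \<in> unit_disk" for z1 z2
    using fib[OF z] e[OF z(1)] e[OF z(2)] covering_exp_eq_iff[OF SD(1), of "\<mu> z1" "\<mu> z2"] by simp
  ultimately have "translation_cover W \<mu> t" using h\<mu> SD(1) by (simp add: translation_cover_def)
  then show ?thesis by (rule that)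
qed

text \<open>A covering of the disk by the disk is injective: \<open>biholomorphic_lift\<close> with
  the identity as \<open>e\<close>.\<close>

lemma conf_equiv_disk_iff: "conf_equiv X atlas unit_disk \<longleftrightarrow> inj_on p unit_disk"
proof
  assume ce: "conf_equiv X atlas unit_disk"
  obtain c where c: "c holomorphic_on unit_disk" "locally_inj_on c unit_disk" "covering_space unit_disk c unit_disk"
    and fib: "\<And>z1 z2. z1 \<in> unit_disk \<Longrightarrow> z2 \<in> unit_disk \<Longrightarrow> c z1 = c z2 \<longleftrightarrow> p z1 = p z2"
    by (rule conf_equiv_imp_covering_space[OF ce open_unit_disk]) (rule that; assumption)
  have "bij_betw c unit_disk unit_disk"
  proof (rule biholomorphic_lift[OF c(3,2) open_unit_disk, where e = "\<lambda>z. z"])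
    show "convex unit_disk" by (simp add: unit_disk_def)
    show "locally_inj_on (\<lambda>z. z) unit_disk" unfolding locally_inj_on_def by (auto intro!: exI[of _ unit_disk])
    show "c ` unit_disk \<subseteq> unit_disk" using covering_space_imp_surjective[OF c(3)] by simp
  qed (use c(1) in \<open>auto simp: holomorphic_on_imp_continuous_on\<close>)
  then show "inj_on p unit_disk" using fib by (auto simp: bij_betw_def inj_on_def)
next
  assume "inj_on p unit_disk"
  then show "conf_equiv X atlas unit_disk"
    by (intro conf_equiv_same_fibres[where q = id]) (auto simp: inj_on_eq_iff holomorphic_on_id)
qed

end

section \<open>The topology and strong isomorphisms\<close>

lemma topspace_A_disk_topology: "topspace A_disk_topology = A_disk"
proof
  show "topspace A_disk_topology \<subseteq> A_disk"
    unfolding A_disk_topology_def topology_generated_by_topspace by blast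
  show "A_disk \<subseteq> topspace A_disk_topology"
  proof
    fix f assume f: "f \<in> A_disk"
    have "f \<in> {g \<in> A_disk. \<forall>i<4. \<forall>p \<in> {}. norm (Omega_rep g i p - Omega_rep f i p) < 1}" using f by simp
    moreover have "{g \<in> A_disk. \<forall>i<4. \<forall>p \<in> {}. norm (Omega_rep g i p - Omega_rep f i p) < 1}
      \<in> {{g \<in> A_disk. \<forall>i<4. \<forall>p \<in> K i. norm (Omega_rep g i p - Omega_rep f i p) < e}
       | f K e. f \<in> A_disk \<and> e > 0 \<and> (\<forall>i<4. compact (K i) \<and> K i \<subseteq> chart_dom i)}"
      using f by (intro CollectI exI[of _ f] exI[of _ "\<lambda>i. {}"] exI[of _ "1::real"]) auto
    ultimately show "f \<in> topspace A_disk_topology"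
      unfolding A_disk_topology_def topology_generated_by_topspace by blast
  qed
qed

definition disk_nbhd :: "(complex \<Rightarrow> complex) \<Rightarrow> (nat \<Rightarrow> (complex \<times> complex) set) \<Rightarrow> real \<Rightarrow> (complex \<Rightarrow> complex) set" where
  "disk_nbhd f K e = {g \<in> A_disk. \<forall>i<4. \<forall>p \<in> K i. norm (Omega_rep g i p - Omega_rep f i p) < e}"

lemma openin_disk_nbhd:
  assumes "f \<in> A_disk" "e > 0" "\<And>i. i < 4 \<Longrightarrow> compact (K i) \<and> K i \<subseteq> chart_dom i"
  shows "openin A_disk_topology (disk_nbhd f K e)"
  unfolding A_disk_topology_def disk_nbhd_def
  by (rule topology_generated_by_Basis, intro CollectI exI[of _ f] exI[of _ K] exI[of _ e] conjI refl allI impI)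
     (use assms in auto)

text \<open>The generating sets are centred at an arbitrary \<open>f\<close> rather than at
  \<open>\<Phi> F\<close>, so all those that contain \<open>\<Phi> F\<close> have to be
  tested.\<close>

lemma continuous_map_A_disk_topology:
  assumes im: "\<And>F. F \<in> topspace Z \<Longrightarrow> \<Phi> F \<in> A_disk"
    and nb: "\<And>F f K e. F \<in> topspace Z \<Longrightarrow> f \<in> A_disk \<Longrightarrow> e > 0 \<Longrightarrow> (\<And>i. i < 4 \<Longrightarrow> compact (K i) \<and> K i \<subseteq> chart_dom i)
       \<Longrightarrow> \<Phi> F \<in> disk_nbhd f K e \<Longrightarrow> \<exists>N. openin Z N \<and> F \<in> N \<and> \<Phi> ` N \<subseteq> disk_nbhd f K e"
  shows "continuous_map Z A_disk_topology \<Phi>"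
  unfolding A_disk_topology_def continuous_on_generated_topo_iff
proof (intro conjI allI impI)
  fix U assume "U \<in> {{g \<in> A_disk. \<forall>i<4. \<forall>p \<in> K i. norm (Omega_rep g i p - Omega_rep f i p) < e}
       | f K e. f \<in> A_disk \<and> e > 0 \<and> (\<forall>i<4. compact (K i) \<and> K i \<subseteq> chart_dom i)}"
  then obtain f K e where f: "f \<in> A_disk" "e > 0" "\<forall>i<4. compact (K i) \<and> K i \<subseteq> chart_dom i" and U: "U = disk_nbhd f K e"
    unfolding disk_nbhd_def by blast
  show "openin Z (\<Phi> -` U \<inter> topspace Z)"
  proof (subst openin_subopen, intro ballI)
    fix F assume F: "F \<in> \<Phi> -` U \<inter> topspace Z"
    have "\<exists>N. openin Z N \<and> F \<in> N \<and> \<Phi> ` N \<subseteq> disk_nbhd f K e"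
      by (rule nb) (use F f U in auto)
    then obtain N where N: "openin Z N" "F \<in> N" "\<Phi> ` N \<subseteq> U" using U by blast
    then have "N \<subseteq> \<Phi> -` U \<inter> topspace Z" using openin_subset by blast
    then show "\<exists>T. openin Z T \<and> F \<in> T \<and> T \<subseteq> \<Phi> -` U \<inter> topspace Z" using N(1,2) by blast
  qed
next
  have "\<Phi> ` topspace Z \<subseteq> topspace A_disk_topology" using im by (auto simp: topspace_A_disk_topology)
  then show "\<Phi> ` topspace Z \<subseteq> \<Union> {{g \<in> A_disk. \<forall>i<4. \<forall>p \<in> K i. norm (Omega_rep g i p - Omega_rep f i p) < e}
       | f K e. f \<in> A_disk \<and> e > 0 \<and> (\<forall>i<4. compact (K i) \<and> K i \<subseteq> chart_dom i)}"
    unfolding A_disk_topology_def topology_generated_by_topspace .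
qed

text \<open>The slice \<open>x = 0\<close> of chart 0 is a section of \<open>mom a b\<close>, so a compact set of values of \<open>mom a' b'\<close>
  lifts to a compact subset of that slice.\<close>
lemma continuous_map_pull:
  assumes b: "b \<noteq> 0" and \<Phi>: "\<And>E. E holomorphic_on UNIV \<Longrightarrow> \<Phi> (pull a b E) = pull a' b' E"
  shows "continuous_map (subtopology A_disk_topology {pull a b E | E. E holomorphic_on UNIV}) A_disk_topology \<Phi>"
proof (rule continuous_map_A_disk_topology)
  let ?S = "{pull a b E | E. E holomorphic_on UNIV}"
  show "\<Phi> F \<in> A_disk" if "F \<in> topspace (subtopology A_disk_topology ?S)" for F
    using that \<Phi> pull_in_A_disk by auto
  fix F f K and e :: real
  assume F: "F \<in> topspace (subtopology A_disk_topology ?S)" and f: "f \<in> A_disk" and e: "e > 0"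
    and K: "\<And>i. i < 4 \<Longrightarrow> compact (K i) \<and> K i \<subseteq> chart_dom i" and FN: "\<Phi> F \<in> disk_nbhd f K e"
  obtain E where E: "E holomorphic_on UNIV" "F = pull a b E" using F by auto
  have repF: "Omega_rep (\<Phi> F) i p = E (moms a' b' i p)" if "i < 4" "p \<in> chart_dom i" for i p
    using Omega_rep_pull[OF E(1) that] \<Phi>[OF E(1)] E(2) by simp
  \<comment> \<open>The distances to the centre \<open>f\<close> have a maximum \<open>m < e\<close>
    on the compact sets, which leaves the margin \<open>e - m\<close> around
    \<open>\<Phi> F\<close>. The added 0 keeps \<open>C\<close> nonempty if all \<open>K i\<close>
    are empty.\<close>
  define C where "C = insert 0 (\<Union>i<4. (\<lambda>p. norm (Omega_rep (\<Phi> F) i p - Omega_rep f i p)) ` K i)"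
  have "compact C"
    unfolding C_def
  proof (intro compact_insert compact_UN ballI compact_continuous_image)
    fix i :: nat assume "i \<in> {..<4}"
    then have i: "i < 4" by simp
    have "continuous_on (K i) (Omega_rep (\<Phi> F) i)" "continuous_on (K i) (Omega_rep f i)"
      using Omega_rep_props(1)[OF f] Omega_rep_props(1)[OF pull_in_A_disk[OF E(1), of a' b']] K[OF i] i \<Phi>[OF E(1)] E(2)
      unfolding hol_Omega_def holomorphic2_on_def by (metis continuous_on_subset)+
    then show "continuous_on (K i) (\<lambda>p. norm (Omega_rep (\<Phi> F) i p - Omega_rep f i p))" by (intro continuous_intros)
    show "compact (K i)" using K[OF i] by simp
  qed simp
  moreover have "C \<noteq> {}" by (simp add: C_def)
  ultimately obtain m where m: "m \<in> C" "\<And>v. v \<in> C \<Longrightarrow> v \<le> m" using compact_attains_sup[of C] by blast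
  have me: "m < e" using m(1) FN e by (auto simp: C_def disk_nbhd_def)
  define V where "V = (\<Union>i<4. moms a' b' i ` K i)"
  have "compact V"
    unfolding V_def
  proof (intro compact_UN ballI compact_continuous_image)
    fix i :: nat assume "i \<in> {..<4}"
    then have i: "i < 4" by simp
    show "continuous_on (K i) (moms a' b' i)"
      using holomorphic2_moms[of a' b' i] K[OF i] unfolding holomorphic2_on_def by (metis continuous_on_subset)
    show "compact (K i)" using K[OF i] by simp
  qed simp
  define K' where "K' i = (if i = 0 then (\<lambda>t. (0::complex, (t - of_real a) / cnj b)) ` V else {})" for i :: nat
  have K': "compact (K' i) \<and> K' i \<subseteq> chart_dom i" for i
    using \<open>compact V\<close> b by (auto simp: K'_def chart_dom_0_iff intro!: compact_continuous_image continuous_intros)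
  have FA: "F \<in> A_disk" using pull_in_A_disk[OF E(1)] E(2) by simp
  have op: "openin A_disk_topology (disk_nbhd F K' (e - m))" using openin_disk_nbhd[OF FA _ K'] me by simp
  show "\<exists>N. openin (subtopology A_disk_topology ?S) N \<and> F \<in> N \<and> \<Phi> ` N \<subseteq> disk_nbhd f K e"
  proof (intro exI[of _ "disk_nbhd F K' (e - m) \<inter> ?S"] conjI)
    show "openin (subtopology A_disk_topology ?S) (disk_nbhd F K' (e - m) \<inter> ?S)"
      using op by (auto simp: openin_subtopology)
    show "F \<in> disk_nbhd F K' (e - m) \<inter> ?S" using FA me E by (auto simp: disk_nbhd_def)
    show "\<Phi> ` (disk_nbhd F K' (e - m) \<inter> ?S) \<subseteq> disk_nbhd f K e"
    proof (intro image_subsetI)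
      fix G assume G: "G \<in> disk_nbhd F K' (e - m) \<inter> ?S"
      then obtain E2 where E2: "E2 holomorphic_on UNIV" "G = pull a b E2" by blast
      have close: "norm (E2 t - E t) < e - m" if "t \<in> V" for t
      proof -
        let ?q = "(0::complex, (t - of_real a) / cnj b)"
        have "?q \<in> K' 0" unfolding K'_def using that by auto
        then have "norm (Omega_rep G 0 ?q - Omega_rep F 0 ?q) < e - m" using G by (auto simp: disk_nbhd_def)
        moreover have "Omega_rep G 0 ?q = E2 t" "Omega_rep F 0 ?q = E t"
          unfolding E2(2) E(2) using b by (simp_all add: Omega_rep_pull E2(1) E(1) chart_dom_0_iff mom_def)
        ultimately show ?thesis by simp
      qed
      have PG: "\<Phi> G = pull a' b' E2" using \<Phi>[OF E2(1)] E2(2) by simp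
      have "norm (Omega_rep (\<Phi> G) i q - Omega_rep f i q) < e" if i: "i < 4" and q: "q \<in> K i" for i q
      proof -
        have qd: "q \<in> chart_dom i" using K[OF i] q by blast
        have "Omega_rep (\<Phi> G) i q - Omega_rep f i q = (E2 (moms a' b' i q) - E (moms a' b' i q)) + (Omega_rep (\<Phi> F) i q - Omega_rep f i q)"
          using Omega_rep_pull[OF E2(1) i qd, of a' b'] repF[OF i qd] PG by simp
        also have "norm \<dots> \<le> norm (E2 (moms a' b' i q) - E (moms a' b' i q)) + norm (Omega_rep (\<Phi> F) i q - Omega_rep f i q)"
          by (rule norm_triangle_ineq)
        also have "\<dots> < (e - m) + m"
        proof (rule add_less_le_mono)
          show "norm (E2 (moms a' b' i q) - E (moms a' b' i q)) < e - m" using close i q by (auto simp: V_def)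
          show "norm (Omega_rep (\<Phi> F) i q - Omega_rep f i q) \<le> m" using m(2) i q by (auto simp: C_def)
        qed
        finally show ?thesis by simp
      qed
      then show "\<Phi> G \<in> disk_nbhd f K e" using pull_in_A_disk[OF E2(1)] PG by (simp add: disk_nbhd_def)
    qed
  qed
qed

section \<open>Functions on a surface and their lifts to the disk\<close>

locale hyp_surface =
  fixes X :: "'a topology" and atlas :: "('a set \<times> ('a \<Rightarrow> complex)) set"
  assumes hyp: "hyperbolic_RS X atlas"
begin

sublocale disk_cover X atlas "ucov X atlas"
proof
  show "riemann_surface X atlas" using hyp by (simp add: hyperbolic_RS_def)
  have "\<exists>p. disk_universal_covering X atlas p" using hyp by (simp add: hyperbolic_RS_def)
  from someI_ex[OF this] show "disk_universal_covering X atlas (ucov X atlas)" by (simp only: ucov_def)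
qed

abbreviation "p \<equiv> ucov X atlas"
abbreviation "\<A> \<equiv> A_RS X atlas"

lemma lift_eq: "z \<in> unit_disk \<Longrightarrow> lift X atlas f z = f (p z)"
  and lift_outside: "z \<notin> unit_disk \<Longrightarrow> lift X atlas f z = 0"
  by (simp_all add: lift_def)

lemma lift_invariants: "f \<in> \<A> \<Longrightarrow> lift X atlas f \<in> invariants"
  by (simp add: A_RS_def invariants_def lift_def)

text \<open>The same choice as in \<open>star_RS\<close>, so that \<open>star_RS\<close> is
  \<open>star_disk\<close> evaluated at \<open>chosen x\<close>.\<close>

definition chosen :: "'a \<Rightarrow> complex" where
  "chosen x = (SOME z. z \<in> unit_disk \<and> p z = x)"

lemma chosen: "x \<in> topspace X \<Longrightarrow> chosen x \<in> unit_disk \<and> p (chosen x) = x"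
  unfolding chosen_def
proof (rule someI_ex)
  assume "x \<in> topspace X"
  then have "x \<in> p ` unit_disk" by (simp only: p_onto)
  then show "\<exists>z. z \<in> unit_disk \<and> p z = x" by (auto simp: image_iff)
qed

lemma p_topspace: "z \<in> unit_disk \<Longrightarrow> p z \<in> topspace X"
  using p_onto by blast

definition descend :: "(complex \<Rightarrow> complex) \<Rightarrow> 'a \<Rightarrow> complex" where
  "descend F = (\<lambda>x. if x \<in> topspace X then F (chosen x) else 0)"

lemma lift_descend:
  assumes "F \<in> invariants"
  shows "lift X atlas (descend F) = F" "descend F \<in> \<A>"
proof -
  have A: "F \<in> A_disk" and inv: "\<And>z1 z2. z1 \<in> unit_disk \<Longrightarrow> z2 \<in> unit_disk \<Longrightarrow> p z1 = p z2 \<Longrightarrow> F z1 = F z2"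
    using assms unfolding invariants_def by blast+
  show l: "lift X atlas (descend F) = F"
  proof
    fix z
    show "lift X atlas (descend F) z = F z"
    proof (cases "z \<in> unit_disk")
      case True
      then have "F (chosen (p z)) = F z" using chosen[OF p_topspace] inv by blast
      then show ?thesis using True p_topspace by (simp add: lift_eq descend_def)
    next
      case False
      then have "F z = 0" using A by (auto simp: A_disk_def)
      then show ?thesis using False by (simp add: lift_outside)
    qed
  qed
  show "descend F \<in> \<A>" unfolding A_RS_def using A l by (simp add: descend_def)
qed

lemma A_eqI:
  assumes "\<And>x. x \<notin> topspace X \<Longrightarrow> f x = 0" "\<And>x. x \<notin> topspace X \<Longrightarrow> g x = 0"
    and "\<And>z. z \<in> unit_disk \<Longrightarrow> f (p z) = g (p z)"
  shows "f = g"
proof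
  fix x
  show "f x = g x"
  proof (cases "x \<in> topspace X")
    case True
    then show ?thesis using assms(3)[of "chosen x"] chosen by simp
  qed (use assms in simp)
qed

lemma A_outside: "f \<in> \<A> \<Longrightarrow> x \<notin> topspace X \<Longrightarrow> f x = 0"
  by (simp add: A_RS_def)

lemma lift_inject:
  assumes "f \<in> \<A>" "g \<in> \<A>" "lift X atlas f = lift X atlas g"
  shows "f = g"
  using A_outside[OF assms(1)] A_outside[OF assms(2)] fun_cong[OF assms(3)]
  by (intro A_eqI) (simp_all flip: lift_eq)

lemma A_iff: "f \<in> \<A> \<longleftrightarrow> (\<forall>x. x \<notin> topspace X \<longrightarrow> f x = 0) \<and> lift X atlas f \<in> invariants"
  by (auto simp: A_RS_def invariants_def lift_def)

lemma star_RS_eq: "x \<in> topspace X \<Longrightarrow> star_RS X atlas h f g x = star_disk h (lift X atlas f) (lift X atlas g) (chosen x)"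
  and star_RS_outside: "x \<notin> topspace X \<Longrightarrow> star_RS X atlas h f g x = 0"
  by (simp_all add: star_RS_def chosen_def)

lemma topspace_A_RS_topology: "topspace (A_RS_topology X atlas) = \<A>"
  by (auto simp: A_RS_topology_def topspace_pullback_topology topspace_A_disk_topology A_RS_def)

lemma continuous_lift: "continuous_map (A_RS_topology X atlas) (subtopology A_disk_topology invariants) (lift X atlas)"
  unfolding continuous_map_in_subtopology
proof (intro conjI)
  show "continuous_map (A_RS_topology X atlas) A_disk_topology (lift X atlas)"
    using continuous_map_pullback[OF continuous_map_id, of \<A> "lift X atlas" A_disk_topology]
    by (simp add: A_RS_topology_def)
  show "lift X atlas \<in> topspace (A_RS_topology X atlas) \<rightarrow> invariants"
    using lift_invariants by (auto simp: topspace_A_RS_topology)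
qed

end

text \<open>The strong isomorphism induced by a map \<open>\<psi>\<close> of the disk (with inverse \<open>\<psi>'\<close> on the level of invariant functions),
  which need neither be continuous nor compatible with the coverings.\<close>
lemma strongly_isoI:
  fixes X :: "'a topology" and Y :: "'b topology"
  assumes X: "hyp_surface X ax" and Y: "hyp_surface Y ay"
    and \<psi>: "\<And>z. z \<in> unit_disk \<Longrightarrow> \<psi> z \<in> unit_disk"
    and \<Phi>: "\<Phi> = (\<lambda>F z. if z \<in> unit_disk then F (\<psi> z) else 0)"
    and bij: "\<And>F. F \<in> disk_cover.invariants (ucov X ax) \<Longrightarrow> \<Phi> F \<in> disk_cover.invariants (ucov Y ay)"
      "\<And>G. G \<in> disk_cover.invariants (ucov Y ay) \<Longrightarrow> \<Phi>' G \<in> disk_cover.invariants (ucov X ax)"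
      "\<And>F. F \<in> disk_cover.invariants (ucov X ax) \<Longrightarrow> \<Phi>' (\<Phi> F) = F"
      "\<And>G. G \<in> disk_cover.invariants (ucov Y ay) \<Longrightarrow> \<Phi> (\<Phi>' G) = G"
    and star: "\<And>h F G z z' z''. F \<in> disk_cover.invariants (ucov X ax) \<Longrightarrow> G \<in> disk_cover.invariants (ucov X ax) \<Longrightarrow>
        z \<in> unit_disk \<Longrightarrow> z' \<in> unit_disk \<Longrightarrow> z'' \<in> unit_disk \<Longrightarrow> ucov X ax z' = ucov X ax (\<psi> z) \<Longrightarrow> ucov Y ay z'' = ucov Y ay z
        \<Longrightarrow> star_disk h (\<Phi> F) (\<Phi> G) z'' = star_disk h F G z'"
    and cont: "continuous_map (subtopology A_disk_topology (disk_cover.invariants (ucov X ax))) A_disk_topology \<Phi>"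
      "continuous_map (subtopology A_disk_topology (disk_cover.invariants (ucov Y ay))) A_disk_topology \<Phi>'"
  shows "strongly_iso X ax Y ay"
proof -
  interpret X: hyp_surface X ax by (rule X)
  interpret Y: hyp_surface Y ay by (rule Y)
  define T where "T f = (\<lambda>y. if y \<in> topspace Y then lift X ax f (\<psi> (Y.chosen y)) else 0)" for f
  define T' where "T' g = X.descend (\<Phi>' (lift Y ay g))" for g
  have fibY: "F z1 = F z2" if "F \<in> Y.invariants" "z1 \<in> unit_disk" "z2 \<in> unit_disk" "Y.p z1 = Y.p z2" for F z1 z2
    using that unfolding Y.invariants_def by blast
  have T: "lift Y ay (T f) = \<Phi> (lift X ax f) \<and> T f \<in> A_RS Y ay" if f: "f \<in> A_RS X ax" for f
  proof -
    have inv: "\<Phi> (lift X ax f) \<in> Y.invariants" using bij(1) X.lift_invariants[OF f] by blast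
    have "T f = Y.descend (\<Phi> (lift X ax f))"
      using Y.chosen by (auto simp: T_def Y.descend_def \<Phi>)
    then show ?thesis using Y.lift_descend[OF inv] by simp
  qed
  have T': "lift X ax (T' g) = \<Phi>' (lift Y ay g) \<and> T' g \<in> A_RS X ax" if g: "g \<in> A_RS Y ay" for g
    unfolding T'_def using X.lift_descend[OF bij(2)[OF Y.lift_invariants[OF g]]] by blast
  have T'T: "T' (T f) = f" if f: "f \<in> A_RS X ax" for f
    using X.lift_inject[of "T' (T f)" f] T[OF f] T'[of "T f"] f bij(3)[OF X.lift_invariants[OF f]] by simp
  have TT': "T (T' g) = g" if g: "g \<in> A_RS Y ay" for g
    using Y.lift_inject[of "T (T' g)" g] T'[OF g] T[of "T' g"] g bij(4)[OF Y.lift_invariants[OF g]] by simp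
  have 1: "bij_betw T (A_RS X ax) (A_RS Y ay)"
    by (rule bij_betw_byWitness[where f' = T']) (use T'T TT' T T' in auto)
  have 2: "T (\<lambda>x. a * f x + b * g x) = (\<lambda>y. a * T f y + b * T g y)" for f g a b
    by (auto simp: T_def lift_def fun_eq_iff)
  have 3: "T (star_RS X ax h f g) = star_RS Y ay h (T f) (T g)" if f: "f \<in> A_RS X ax" and g: "g \<in> A_RS X ax" for h f g
  proof (rule Y.A_eqI)
    fix z assume z: "z \<in> unit_disk"
    \<comment> \<open>The two star products are evaluated at points chosen separately on each
      surface. \<open>v\<close> is the point for \<open>Y\<close>, and \<open>u\<close>, the one for
      \<open>X\<close>, is only known to lie in the fibre of \<open>\<psi> v\<close>; the assumption
      \<open>star\<close> bridges this gap.\<close>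
    define v where "v = Y.chosen (Y.p z)"
    have v: "v \<in> unit_disk" "Y.p v = Y.p z" using Y.chosen[OF Y.p_topspace[OF z]] by (auto simp: v_def)
    have \<psi>v: "\<psi> v \<in> unit_disk" using \<psi>[OF v(1)] .
    define u where "u = X.chosen (X.p (\<psi> v))"
    have u: "u \<in> unit_disk" "X.p u = X.p (\<psi> v)" using X.chosen[OF X.p_topspace[OF \<psi>v]] by (auto simp: u_def)
    have "T (star_RS X ax h f g) (Y.p z) = star_RS X ax h f g (X.p (\<psi> v))"
      using Y.p_topspace[OF z] \<psi>v by (simp add: T_def v_def X.lift_eq)
    also have "\<dots> = star_disk h (lift X ax f) (lift X ax g) u"
      using X.star_RS_eq[OF X.p_topspace[OF \<psi>v]] by (simp add: u_def)
    also have "\<dots> = star_disk h (\<Phi> (lift X ax f)) (\<Phi> (lift X ax g)) v"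
      using star[OF X.lift_invariants[OF f] X.lift_invariants[OF g] v(1) u(1) v(1) u(2) refl] by simp
    also have "\<dots> = star_RS Y ay h (T f) (T g) (Y.p z)"
      using Y.star_RS_eq[OF Y.p_topspace[OF z]] T[OF f] T[OF g] by (simp add: v_def)
    finally show "T (star_RS X ax h f g) (Y.p z) = star_RS Y ay h (T f) (T g) (Y.p z)" .
  qed (simp_all add: T_def Y.star_RS_outside)
  have cT: "continuous_map (A_RS_topology X ax) (A_RS_topology Y ay) T"
    unfolding A_RS_topology_def[of Y]
  proof (rule continuous_map_pullback')
    have "continuous_map (A_RS_topology X ax) A_disk_topology (\<Phi> \<circ> lift X ax)"
      by (rule continuous_map_compose[OF X.continuous_lift cont(1)])
    then show "continuous_map (A_RS_topology X ax) A_disk_topology (lift Y ay \<circ> T)"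
      by (rule continuous_map_eq) (use T in \<open>simp add: X.topspace_A_RS_topology\<close>)
    show "topspace (A_RS_topology X ax) \<subseteq> T -` A_RS Y ay" using T by (auto simp: X.topspace_A_RS_topology)
  qed
  have cT': "continuous_map (A_RS_topology Y ay) (A_RS_topology X ax) T'"
    unfolding A_RS_topology_def[of X]
  proof (rule continuous_map_pullback')
    have "continuous_map (A_RS_topology Y ay) A_disk_topology (\<Phi>' \<circ> lift Y ay)"
      by (rule continuous_map_compose[OF Y.continuous_lift cont(2)])
    then show "continuous_map (A_RS_topology Y ay) A_disk_topology (lift X ax \<circ> T')"
      by (rule continuous_map_eq) (use T' in \<open>simp add: Y.topspace_A_RS_topology\<close>)
    show "topspace (A_RS_topology Y ay) \<subseteq> T' -` A_RS X ax" using T' by (auto simp: Y.topspace_A_RS_topology)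
  qed
  have "homeomorphic_maps (A_RS_topology X ax) (A_RS_topology Y ay) T T'"
    unfolding homeomorphic_maps_def X.topspace_A_RS_topology Y.topspace_A_RS_topology
    using cT cT' T'T TT' by blast
  then have 4: "homeomorphic_map (A_RS_topology X ax) (A_RS_topology Y ay) T"
    using homeomorphic_map_maps by blast
  show ?thesis unfolding strongly_iso_def
    by (intro exI[of _ T] conjI 1 4 ballI allI 2 3)
qed

section \<open>Algebraic invariants\<close>

lemma one_half_hbar_dom: "1 \<in> hbar_dom" "1/2 \<in> hbar_dom"
proof -
  have "h \<in> hbar_dom" if "Re h > 0" for h
  proof -
    have "h \<noteq> - 1 / of_nat (Suc n)" for n
    proof
      assume "h = - 1 / of_nat (Suc n)"
      then have "h = of_real (- 1 / real (Suc n))" by (simp only: of_real_divide of_real_minus of_real_1 of_real_of_nat_eq)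
      then have "Re h = - 1 / real (Suc n)" by (simp only: Re_complex_of_real)
      moreover have "- 1 / real (Suc n) < 0" by simp
      ultimately show False using that by linarith
    qed
    then show ?thesis using that by (auto simp: hbar_dom_def)
  qed
  then show "1 \<in> hbar_dom" "1/2 \<in> hbar_dom" by simp_all
qed

definition star_commutative :: "'a topology \<Rightarrow> ('a set \<times> ('a \<Rightarrow> complex)) set \<Rightarrow> bool" where
  "star_commutative X ax \<longleftrightarrow> (\<forall>f\<in>A_RS X ax. \<forall>g\<in>A_RS X ax. star_RS X ax 1 f g = star_RS X ax 1 g f)"

text \<open>Both products are required to lie in the algebra, because an isomorphism is known to be
  injective only there.\<close>

definition noncommuting_pair :: "'a topology \<Rightarrow> ('a set \<times> ('a \<Rightarrow> complex)) set \<Rightarrow> bool" where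
  "noncommuting_pair X ax \<longleftrightarrow> (\<exists>f\<in>A_RS X ax. \<exists>g\<in>A_RS X ax. star_RS X ax 1 f g \<in> A_RS X ax \<and>
     star_RS X ax 1 g f \<in> A_RS X ax \<and> star_RS X ax 1 f g \<noteq> star_RS X ax 1 g f)"

text \<open>Both sides have the literal shape \<open>a * f x + b * g x\<close> of the linearity
  clause in \<open>strongly_iso\<close>; hence \<open>+ (- 4)\<close> and the summand
  \<open>0 * f x\<close>.\<close>

definition star_relation :: "'a topology \<Rightarrow> ('a set \<times> ('a \<Rightarrow> complex)) set \<Rightarrow> complex \<Rightarrow> ('a \<Rightarrow> complex) \<Rightarrow> bool" where
  "star_relation X ax \<kappa> f \<longleftrightarrow>
     (\<lambda>x. 3 * star_RS X ax 1 f f x + (- 4) * star_RS X ax (1/2) f f x) = (\<lambda>x. \<kappa> * f x + 0 * f x)"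

text \<open>Linear independence survives every linear bijection. If only constants solve the
  relations, a solution \<open>f\<close> and a solution \<open>g\<close> are always
  dependent.\<close>

definition independent_pair :: "'a topology \<Rightarrow> ('a set \<times> ('a \<Rightarrow> complex)) set \<Rightarrow> bool" where
  "independent_pair X ax \<longleftrightarrow> (\<exists>f\<in>A_RS X ax. \<exists>g\<in>A_RS X ax. star_relation X ax (- 2 * \<i>) f \<and> star_relation X ax (2 * \<i>) g \<and>
     (\<forall>c d. (\<lambda>x. c * f x + d * g x) = (\<lambda>x. 0 * f x + 0 * g x) \<longrightarrow> c = 0 \<and> d = 0))"

definition A_constant :: "'a topology \<Rightarrow> ('a set \<times> ('a \<Rightarrow> complex)) set \<Rightarrow> bool" where
  "A_constant X ax \<longleftrightarrow> (\<forall>f \<in> A_RS X ax. \<exists>c. \<forall>x \<in> topspace X. f x = c)"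

lemma strongly_isoE:
  assumes "strongly_iso X ax Y ay"
  obtains T where "bij_betw T (A_RS X ax) (A_RS Y ay)"
    "\<And>f g a b. f \<in> A_RS X ax \<Longrightarrow> g \<in> A_RS X ax \<Longrightarrow> T (\<lambda>x. a * f x + b * g x) = (\<lambda>y. a * T f y + b * T g y)"
    "\<And>h f g. h \<in> hbar_dom \<Longrightarrow> f \<in> A_RS X ax \<Longrightarrow> g \<in> A_RS X ax \<Longrightarrow> T (star_RS X ax h f g) = star_RS Y ay h (T f) (T g)"
proof -
  obtain T where *: "bij_betw T (A_RS X ax) (A_RS Y ay)"
     "\<forall>f \<in> A_RS X ax. \<forall>g \<in> A_RS X ax. \<forall>a b. T (\<lambda>x. a * f x + b * g x) = (\<lambda>y. a * T f y + b * T g y)"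
     "\<forall>h \<in> hbar_dom. \<forall>f \<in> A_RS X ax. \<forall>g \<in> A_RS X ax. T (star_RS X ax h f g) = star_RS Y ay h (T f) (T g)"
    using assms unfolding strongly_iso_def by (elim exE conjE)
  show ?thesis
    by (rule that[OF *(1)]) (use *(2,3) in simp_all)
qed

lemma strongly_iso_commutative:
  assumes "strongly_iso X ax Y ay" "star_commutative X ax"
  shows "star_commutative Y ay"
proof -
  obtain T where T: "bij_betw T (A_RS X ax) (A_RS Y ay)"
    and m: "\<And>h f g. h \<in> hbar_dom \<Longrightarrow> f \<in> A_RS X ax \<Longrightarrow> g \<in> A_RS X ax \<Longrightarrow> T (star_RS X ax h f g) = star_RS Y ay h (T f) (T g)"
    by (rule strongly_isoE[OF assms(1)]) (rule that; assumption)
  have "star_RS Y ay 1 (T f) (T g) = star_RS Y ay 1 (T g) (T f)" if "f \<in> A_RS X ax" "g \<in> A_RS X ax" for f g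
    using m[OF one_half_hbar_dom(1) that] m[OF one_half_hbar_dom(1) that(2,1)] assms(2) that
    by (simp add: star_commutative_def)
  then show ?thesis unfolding star_commutative_def bij_betw_imp_surj_on[OF T, symmetric] by blast
qed

text \<open>The counterpart of \<open>strongly_iso_commutative\<close> for a noncommutative source:
  it relies on injectivity where the other relies on surjectivity.\<close>

lemma strongly_iso_noncommuting:
  assumes "strongly_iso X ax Y ay" "noncommuting_pair X ax" "star_commutative Y ay"
  shows False
proof -
  obtain T where T: "bij_betw T (A_RS X ax) (A_RS Y ay)"
    and m: "\<And>h f g. h \<in> hbar_dom \<Longrightarrow> f \<in> A_RS X ax \<Longrightarrow> g \<in> A_RS X ax \<Longrightarrow> T (star_RS X ax h f g) = star_RS Y ay h (T f) (T g)"
    by (rule strongly_isoE[OF assms(1)]) (rule that; assumption)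
  obtain f g where f: "f \<in> A_RS X ax" "g \<in> A_RS X ax" "star_RS X ax 1 f g \<in> A_RS X ax"
     "star_RS X ax 1 g f \<in> A_RS X ax" "star_RS X ax 1 f g \<noteq> star_RS X ax 1 g f"
    using assms(2) unfolding noncommuting_pair_def by blast
  have "T f \<in> A_RS Y ay" "T g \<in> A_RS Y ay" using T f(1,2) by (auto simp: bij_betw_def)
  then have "star_RS Y ay 1 (T f) (T g) = star_RS Y ay 1 (T g) (T f)" using assms(3) by (simp add: star_commutative_def)
  then have "T (star_RS X ax 1 f g) = T (star_RS X ax 1 g f)"
    using m[OF one_half_hbar_dom(1) f(1,2)] m[OF one_half_hbar_dom(1) f(2,1)] by simp
  then show False using f(3-5) bij_betw_imp_inj_on[OF T] by (auto dest: inj_onD)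
qed

text \<open>Elements of the target are images under \<open>T\<close>, and equations between them are
  pulled back by injectivity. Closure under the operations is thus needed on the side of
  \<open>X\<close> alone.\<close>

lemma strongly_iso_independent_pair:
  assumes iso: "strongly_iso X ax Y ay"
    and closed: "\<And>f. f \<in> A_RS X ax \<Longrightarrow> star_RS X ax 1 f f \<in> A_RS X ax \<and> star_RS X ax (1/2) f f \<in> A_RS X ax"
    and lin: "\<And>f g a b. f \<in> A_RS X ax \<Longrightarrow> g \<in> A_RS X ax \<Longrightarrow> (\<lambda>x. a * f x + b * g x) \<in> A_RS X ax"
  shows "independent_pair X ax \<longleftrightarrow> independent_pair Y ay"
proof -
  obtain T where T: "bij_betw T (A_RS X ax) (A_RS Y ay)"
    and l: "\<And>f g a b. f \<in> A_RS X ax \<Longrightarrow> g \<in> A_RS X ax \<Longrightarrow> T (\<lambda>x. a * f x + b * g x) = (\<lambda>y. a * T f y + b * T g y)"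
    and m: "\<And>h f g. h \<in> hbar_dom \<Longrightarrow> f \<in> A_RS X ax \<Longrightarrow> g \<in> A_RS X ax \<Longrightarrow> T (star_RS X ax h f g) = star_RS Y ay h (T f) (T g)"
    by (rule strongly_isoE[OF iso]) (rule that; assumption)
  have inj: "T u = T v \<longleftrightarrow> u = v" if "u \<in> A_RS X ax" "v \<in> A_RS X ax" for u v
    using inj_on_eq_iff[OF bij_betw_imp_inj_on[OF T] that] .
  have lineq: "(\<lambda>y. a * T f y + b * T g y) = (\<lambda>y. c * T u y + d * T v y) \<longleftrightarrow> (\<lambda>x. a * f x + b * g x) = (\<lambda>x. c * u x + d * v x)"
    if "f \<in> A_RS X ax" "g \<in> A_RS X ax" "u \<in> A_RS X ax" "v \<in> A_RS X ax" for a b c d f g u v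
    using inj[OF lin[OF that(1,2)] lin[OF that(3,4)], of a b c d] l[OF that(1,2), of a b] l[OF that(3,4), of c d] by simp
  have rel: "star_relation Y ay \<kappa> (T f) \<longleftrightarrow> star_relation X ax \<kappa> f" if f: "f \<in> A_RS X ax" for \<kappa> f
    unfolding star_relation_def m[OF one_half_hbar_dom(1) f f, symmetric] m[OF one_half_hbar_dom(2) f f, symmetric]
    using closed[OF f] f by (intro lineq) auto
  have ind: "(\<lambda>y. c * T f y + d * T g y) = (\<lambda>y. 0 * T f y + 0 * T g y) \<longleftrightarrow> (\<lambda>x. c * f x + d * g x) = (\<lambda>x. 0 * f x + 0 * g x)"
    if "f \<in> A_RS X ax" "g \<in> A_RS X ax" for c d f g
    by (rule lineq[OF that that])
  have "independent_pair Y ay \<longleftrightarrow> (\<exists>f\<in>A_RS X ax. \<exists>g\<in>A_RS X ax. star_relation Y ay (- 2 * \<i>) (T f) \<and> star_relation Y ay (2 * \<i>) (T g) \<and>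
     (\<forall>c d. (\<lambda>x. c * T f x + d * T g x) = (\<lambda>x. 0 * T f x + 0 * T g x) \<longrightarrow> c = 0 \<and> d = 0))"
    unfolding independent_pair_def bij_betw_imp_surj_on[OF T, symmetric] bex_simps(7) ..
  also have "\<dots> \<longleftrightarrow> independent_pair X ax"
    unfolding independent_pair_def
    by (intro bex_cong refl) (simp only: rel ind)
  finally show ?thesis by simp
qed

section \<open>The algebra when all invariants are functions of one moment map\<close>

context hyp_surface
begin

definition pull_type :: "real \<Rightarrow> complex \<Rightarrow> bool" where
  "pull_type a b \<longleftrightarrow> b \<noteq> 0 \<and> invariants = {pull a b E | E. E holomorphic_on UNIV}"

lemma pull_typeE:
  assumes "pull_type a b" "f \<in> \<A>"
  obtains E where "E holomorphic_on UNIV" "lift X atlas f = pull a b E"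
  using lift_invariants[OF assms(2)] assms(1) unfolding pull_type_def by blast

lemma pull_type_fibre:
  assumes "pull_type a b" "z \<in> unit_disk" "w \<in> unit_disk" "p z = p w"
  shows "mom a b (z, cnj z) = mom a b (w, cnj w)"
proof -
  have "(\<lambda>t::complex. t) holomorphic_on UNIV" by (intro holomorphic_intros)
  then have "pull a b (\<lambda>t. t) \<in> invariants" using assms(1) unfolding pull_type_def by blast
  then have "pull a b (\<lambda>t. t) z = pull a b (\<lambda>t. t) w" using assms(2-4) unfolding invariants_def by blast
  then show ?thesis using assms(2,3) by (simp add: pull_def)
qed

text \<open>The star product on the disk depends on the point only through the moment map, which is
  constant on fibres; hence the point chosen in \<open>star_RS\<close> does not matter.\<close>

lemma lift_star_pull:
  assumes pt: "pull_type a b" and E: "E1 holomorphic_on UNIV" "E2 holomorphic_on UNIV"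
    and l: "lift X atlas f = pull a b E1" "lift X atlas g = pull a b E2"
  shows "lift X atlas (star_RS X atlas h f g) = pull a b (star_sym h (of_real ((norm b)\<^sup>2 - a\<^sup>2)) E1 E2)"
proof
  fix z
  show "lift X atlas (star_RS X atlas h f g) z = pull a b (star_sym h (of_real ((norm b)\<^sup>2 - a\<^sup>2)) E1 E2) z"
  proof (cases "z \<in> unit_disk")
    case True
    define w where "w = chosen (p z)"
    have w: "w \<in> unit_disk" "p w = p z" using chosen[OF p_topspace[OF True]] by (auto simp: w_def)
    have "star_RS X atlas h f g (p z) = star_disk h (pull a b E1) (pull a b E2) w"
      using star_RS_eq[OF p_topspace[OF True]] l by (simp add: w_def)
    also have "\<dots> = star_sym h (of_real ((norm b)\<^sup>2 - a\<^sup>2)) E1 E2 (mom a b (z, cnj z))"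
      using star_disk_pull[OF E w(1)] pull_type_fibre[OF pt w(1) True w(2)] by simp
    finally show ?thesis using True by (simp add: lift_eq pull_def)
  qed (simp add: lift_outside pull_def)
qed

lemma pull_type_star_closed:
  assumes pt: "pull_type a b" and f: "f \<in> \<A>" and h: "h = 1 \<or> h = 1/2"
  shows "star_RS X atlas h f f \<in> \<A>"
proof -
  obtain E where E: "E holomorphic_on UNIV" "lift X atlas f = pull a b E" using pull_typeE[OF pt f] .
  have "lift X atlas (star_RS X atlas h f f) \<in> invariants"
    using lift_star_pull[OF pt E(1) E(1) E(2) E(2)] star_sym_entire[OF E(1) E(1) h] pt unfolding pull_type_def by blast
  then show ?thesis unfolding A_iff using star_RS_outside by blast
qed

lemma pull_type_linear:
  assumes pt: "pull_type a b" and f: "f \<in> \<A>" "g \<in> \<A>"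
  shows "(\<lambda>x. c * f x + d * g x) \<in> \<A>"
proof -
  obtain E1 where E1: "E1 holomorphic_on UNIV" "lift X atlas f = pull a b E1" using pull_typeE[OF pt f(1)] .
  obtain E2 where E2: "E2 holomorphic_on UNIV" "lift X atlas g = pull a b E2" using pull_typeE[OF pt f(2)] .
  have "lift X atlas (\<lambda>x. c * f x + d * g x) = (\<lambda>z. c * lift X atlas f z + d * lift X atlas g z)"
    by (auto simp: lift_def)
  also have "\<dots> = pull a b (\<lambda>t. c * E1 t + d * E2 t)" unfolding E1(2) E2(2) by (auto simp: pull_def)
  finally have "lift X atlas (\<lambda>x. c * f x + d * g x) = pull a b (\<lambda>t. c * E1 t + d * E2 t)" .
  moreover have "(\<lambda>t. c * E1 t + d * E2 t) holomorphic_on UNIV" by (intro holomorphic_intros E1 E2)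
  ultimately have "lift X atlas (\<lambda>x. c * f x + d * g x) \<in> invariants" using pt unfolding pull_type_def by blast
  then show ?thesis using A_outside[OF f(1)] A_outside[OF f(2)] by (simp add: A_iff)
qed

lemma star_commutative_pull:
  assumes "invariants \<subseteq> {pull a b E | E. E holomorphic_on UNIV}"
  shows "star_commutative X atlas"
  unfolding star_commutative_def
proof (intro ballI)
  fix f g assume f: "f \<in> \<A>" and g: "g \<in> \<A>"
  obtain E1 where E1: "E1 holomorphic_on UNIV" "lift X atlas f = pull a b E1" using lift_invariants[OF f] assms by blast
  obtain E2 where E2: "E2 holomorphic_on UNIV" "lift X atlas g = pull a b E2" using lift_invariants[OF g] assms by blast
  show "star_RS X atlas 1 f g = star_RS X atlas 1 g f"
  proof
    fix x
    show "star_RS X atlas 1 f g x = star_RS X atlas 1 g f x"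
    proof (cases "x \<in> topspace X")
      case True
      then have c: "chosen x \<in> unit_disk" using chosen by blast
      show ?thesis
        unfolding star_RS_eq[OF True] E1(2) E2(2) star_disk_pull[OF E1(1) E2(1) c] star_disk_pull[OF E2(1) E1(1) c]
        by (simp only: star_sym_commute[of _ _ E1 E2])
    qed (simp add: star_RS_outside)
  qed
qed

text \<open>The moment maps with \<open>b = 1\<close> and \<open>b = \<i>\<close> belong to
  different one-parameter groups; their commutator at \<open>h = 1\<close> is
  \<open>2 * \<i>\<close> times the moment map \<open>mom 1 0\<close> of the rotations.\<close>

lemma noncommuting_pair_disk:
  assumes inj: "inj_on p unit_disk"
  shows "noncommuting_pair X atlas"
proof -
  have inv: "invariants = A_disk" using inj unfolding invariants_def inj_on_def by blast
  define F where "F b = pull 0 b (\<lambda>t. t)" for b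
  have I: "(\<lambda>t::complex. t) holomorphic_on UNIV" by (intro holomorphic_intros)
  have FA: "F b \<in> A_disk" for b unfolding F_def by (rule pull_in_A_disk[OF I])
  have lF: "lift X atlas (descend (F b)) = F b" "descend (F b) \<in> \<A>" for b
    using lift_descend[of "F b"] FA inv by auto
  have D: "(deriv ^^ n) (\<lambda>t::complex. t) t = (if n = 0 then t else if n = 1 then 1 else 0)" for n t
    using higher_deriv_shift[of n 0] by (simp add: fun_eq_iff)
  have st: "star_disk 1 (F b) (F b') z = mom 0 b (z, cnj z) * mom 0 b' (z, cnj z) + cnj (momd 0 b z) * momd 0 b' z"
    if z: "z \<in> unit_disk" for b b' z
  proof -
    have "star_disk 1 (F b) (F b') z = (\<Sum>n. cc n 1 / fact n * PM_Dbar n (F b) z * PM_D n (F b') z)"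
      using z by (simp add: star_disk_def)
    also have "\<dots> = (\<Sum>n\<in>{0,1}. cc n 1 / fact n * PM_Dbar n (F b) z * PM_D n (F b') z)"
      unfolding F_def PM_Dbar_pull[OF I z] PM_D_pull[OF I z] by (rule suminf_finite) (auto simp: D)
    also have "\<dots> = mom 0 b (z, cnj z) * mom 0 b' (z, cnj z) + cnj (momd 0 b z) * momd 0 b' z"
      unfolding F_def PM_Dbar_pull[OF I z] PM_D_pull[OF I z] by (simp add: D cc_def)
    finally show ?thesis .
  qed
  define H where "H s z = (if z \<in> unit_disk then 2 * (mom 0 1 (z, cnj z) * mom 0 \<i> (z, cnj z)) + s * mom 1 0 (z, cnj z) else 0)" for s z
  have key: "cnj (momd 0 1 z) * momd 0 \<i> z = mom 0 1 (z, cnj z) * mom 0 \<i> (z, cnj z) + \<i> * mom 1 0 (z, cnj z)"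
    "cnj (momd 0 \<i> z) * momd 0 1 z = mom 0 1 (z, cnj z) * mom 0 \<i> (z, cnj z) - \<i> * mom 1 0 (z, cnj z)"
    if z: "z \<in> unit_disk" for z
  proof -
    define q where "q = 1 - z * cnj z"
    have q: "q \<noteq> 0" using mult_neq_1_unit_disk[of z "cnj z"] z by (simp add: q_def)
    have m: "mom 0 1 (z, cnj z) * mom 0 \<i> (z, cnj z) = \<i> * (z\<^sup>2 - (cnj z)\<^sup>2) / q\<^sup>2"
      by (simp add: mom_def q_def power2_eq_square algebra_simps)
    have m1: "\<i> * mom 1 0 (z, cnj z) = \<i> * (1 - (z * cnj z)\<^sup>2) / q\<^sup>2"
    proof -
      have "\<i> * (1 - (z * cnj z)\<^sup>2) = \<i> * (1 + z * cnj z) * q" by (simp add: q_def power2_eq_square algebra_simps)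
      then have "\<i> * (1 - (z * cnj z)\<^sup>2) / q\<^sup>2 = \<i> * (1 + z * cnj z) / q" using q by (simp add: power2_eq_square)
      then show ?thesis by (simp add: mom_def q_def)
    qed
    have d1: "momd 0 1 z = (1 + (cnj z)\<^sup>2) / q" "momd 0 \<i> z = \<i> * (1 - (cnj z)\<^sup>2) / q"
      by (simp_all add: momd_def q_def algebra_simps)
    have cq: "cnj q = q" by (simp add: q_def mult.commute)
    have "cnj (momd 0 1 z) * momd 0 \<i> z = \<i> * ((1 + z\<^sup>2) * (1 - (cnj z)\<^sup>2)) / q\<^sup>2"
      unfolding d1 by (simp add: cq power2_eq_square)
    also have "\<i> * ((1 + z\<^sup>2) * (1 - (cnj z)\<^sup>2)) = \<i> * (z\<^sup>2 - (cnj z)\<^sup>2) + \<i> * (1 - (z * cnj z)\<^sup>2)"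
      by (simp add: power2_eq_square algebra_simps)
    finally show "cnj (momd 0 1 z) * momd 0 \<i> z = mom 0 1 (z, cnj z) * mom 0 \<i> (z, cnj z) + \<i> * mom 1 0 (z, cnj z)"
      unfolding m m1 by (simp only: add_divide_distrib)
    have "cnj (momd 0 \<i> z) * momd 0 1 z = - \<i> * ((1 - z\<^sup>2) * (1 + (cnj z)\<^sup>2)) / q\<^sup>2"
      unfolding d1 by (simp add: cq power2_eq_square)
    also have "- \<i> * ((1 - z\<^sup>2) * (1 + (cnj z)\<^sup>2)) = \<i> * (z\<^sup>2 - (cnj z)\<^sup>2) - \<i> * (1 - (z * cnj z)\<^sup>2)"
      by (simp add: power2_eq_square algebra_simps)
    finally show "cnj (momd 0 \<i> z) * momd 0 1 z = mom 0 1 (z, cnj z) * mom 0 \<i> (z, cnj z) - \<i> * mom 1 0 (z, cnj z)"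
      unfolding m m1 by (simp only: diff_divide_distrib)
  qed
  have HA: "H s \<in> A_disk" for s
  proof -
    \<comment> \<open>Both products are polynomials in moment maps, so they extend to all charts
      together with them.\<close>
    let ?Fs = "\<lambda>i q. 2 * (moms 0 1 i q * moms 0 \<i> i q) + s * moms 1 0 i q"
    have "hol_Omega ?Fs"
      unfolding hol_Omega_def
    proof (intro allI impI conjI ballI)
      fix i show "holomorphic2_on (?Fs i) (chart_dom i)"
        by (intro holomorphic2_on_add holomorphic2_on_mult holomorphic2_on_const holomorphic2_moms open_chart_dom)
      fix q assume "q \<in> chart_dom i" "chart_ok i q"
      then show "?Fs i q = ?Fs 0 (chart_to0 i q)" by (simp only: moms_chart_to0)
    qed
    then show ?thesis unfolding A_disk_def
      by (intro CollectI conjI allI impI exI[of _ ?Fs] ballI) (simp_all add: H_def)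
  qed
  have lst: "lift X atlas (star_RS X atlas 1 (descend (F b)) (descend (F b'))) = star_disk 1 (F b) (F b')" for b b'
  proof
    fix z
    show "lift X atlas (star_RS X atlas 1 (descend (F b)) (descend (F b'))) z = star_disk 1 (F b) (F b') z"
    proof (cases "z \<in> unit_disk")
      case True
      have "chosen (p z) = z" using chosen[OF p_topspace[OF True]] inj True by (auto dest: inj_onD)
      then show ?thesis using True star_RS_eq[OF p_topspace[OF True]] by (simp add: lift_eq lF)
    qed (simp add: lift_outside star_disk_def)
  qed
  have s1: "star_disk 1 (F 1) (F \<i>) = H \<i>"
  proof
    fix z show "star_disk 1 (F 1) (F \<i>) z = H \<i> z"
      by (cases "z \<in> unit_disk") (simp_all add: st key H_def, simp add: star_disk_def)
  qed
  have s2: "star_disk 1 (F \<i>) (F 1) = H (- \<i>)"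
  proof
    fix z show "star_disk 1 (F \<i>) (F 1) z = H (- \<i>) z"
      by (cases "z \<in> unit_disk") (simp_all add: st key H_def, simp add: star_disk_def)
  qed
  have mem: "star_RS X atlas 1 (descend (F 1)) (descend (F \<i>)) \<in> \<A>" "star_RS X atlas 1 (descend (F \<i>)) (descend (F 1)) \<in> \<A>"
    using HA inv star_RS_outside by (simp_all add: A_iff lst s1 s2)
  have "H \<i> 0 \<noteq> H (- \<i>) 0" by (simp add: H_def mom_def unit_disk_def)
  then have "star_RS X atlas 1 (descend (F 1)) (descend (F \<i>)) \<noteq> star_RS X atlas 1 (descend (F \<i>)) (descend (F 1))"
    using lst[of 1 \<i>] lst[of \<i> 1] s1 s2 by metis
  then show ?thesis unfolding noncommuting_pair_def using lF(2) mem by blast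
qed

lemma star_relation_pull:
  assumes pt: "pull_type a b" and f: "f \<in> \<A>" and E: "E holomorphic_on UNIV" "lift X atlas f = pull a b E"
  shows "star_relation X atlas \<kappa> f \<longleftrightarrow> (\<forall>z\<in>unit_disk.
     3 * star_sym 1 (of_real ((norm b)\<^sup>2 - a\<^sup>2)) E E (mom a b (z, cnj z)) - 4 * star_sym (1/2) (of_real ((norm b)\<^sup>2 - a\<^sup>2)) E E (mom a b (z, cnj z))
      = \<kappa> * E (mom a b (z, cnj z)))" (is "_ \<longleftrightarrow> ?R")
proof -
  have s: "star_RS X atlas h f f (p z) = star_sym h (of_real ((norm b)\<^sup>2 - a\<^sup>2)) E E (mom a b (z, cnj z))" if "z \<in> unit_disk" for h z
    using fun_cong[OF lift_star_pull[OF pt E(1) E(1) E(2) E(2)], of h z] that by (simp add: lift_eq pull_def)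
  have fz: "f (p z) = E (mom a b (z, cnj z))" if "z \<in> unit_disk" for z
    using fun_cong[OF E(2), of z] that by (simp add: lift_eq pull_def)
  show ?thesis
  proof
    assume rel: "star_relation X atlas \<kappa> f"
    show ?R
    proof
      fix z assume z: "z \<in> unit_disk"
      show "3 * star_sym 1 (of_real ((norm b)\<^sup>2 - a\<^sup>2)) E E (mom a b (z, cnj z)) - 4 * star_sym (1/2) (of_real ((norm b)\<^sup>2 - a\<^sup>2)) E E (mom a b (z, cnj z))
      = \<kappa> * E (mom a b (z, cnj z))"
        using fun_cong[OF rel[unfolded star_relation_def], of "p z"] s[OF z] fz[OF z] by simp
    qed
  next
    assume R: ?R
    show "star_relation X atlas \<kappa> f"
      unfolding star_relation_def
    proof (rule A_eqI)
      fix z assume z: "z \<in> unit_disk"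
      show "3 * star_RS X atlas 1 f f (p z) + - 4 * star_RS X atlas (1/2) f f (p z) = \<kappa> * f (p z) + 0 * f (p z)"
        unfolding s[OF z] fz[OF z] using bspec[OF R z] by simp
    qed (simp_all add: star_RS_outside A_outside[OF f])
  qed
qed

lemma independent_pair_hyperbolic:
  assumes pt: "pull_type a b" and ab: "(norm b)\<^sup>2 = a\<^sup>2 + 1"
  shows "independent_pair X atlas"
proof -
  define f where "f c = descend (pull a b (\<lambda>t. t + c))" for c
  have hol: "(\<lambda>t::complex. t + c) holomorphic_on UNIV" for c by (intro holomorphic_intros)
  have "pull a b (\<lambda>t. t + c) \<in> invariants" for c using pt hol[of c] unfolding pull_type_def by blast
  from lift_descend[OF this] have f: "lift X atlas (f c) = pull a b (\<lambda>t. t + c)" "f c \<in> \<A>" for c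
    by (simp_all add: f_def)
  have d: "complex_of_real ((norm b)\<^sup>2 - a\<^sup>2) = 1" using ab by simp
  have rel: "star_relation X atlas \<kappa> (f c)" if k: "\<And>t. 3 * ((t + c) * (t + c) + 1 * (t\<^sup>2 + 1)) - 4 * ((t + c) * (t + c) + 1/2 * (t\<^sup>2 + 1)) = \<kappa> * (t + c)" for \<kappa> c
    unfolding star_relation_pull[OF pt f(2) hol f(1)] d star_sym_shift using k by blast
  have r1: "star_relation X atlas (- 2 * \<i>) (f \<i>)" by (rule rel) (simp add: power2_eq_square algebra_simps)
  have r2: "star_relation X atlas (2 * \<i>) (f (- \<i>))" by (rule rel) (simp add: power2_eq_square algebra_simps)
  have val: "\<exists>x. \<forall>c. f c x = of_real t + c" for t
  proof -
    obtain z where z: "z \<in> unit_disk" "mom a b (z, cnj z) = of_real t" using mom_hyperbolic_surj[OF ab] by blast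
    have "f c (p z) = of_real t + c" for c
      using fun_cong[OF f(1), of c z] z by (simp add: lift_eq pull_def)
    then show ?thesis by blast
  qed
  \<comment> \<open>Points where the moment map is 0 and 1 suffice to separate
    \<open>t + \<i>\<close> from \<open>t - \<i>\<close>.\<close>
  obtain x0 where x0: "\<And>c. f c x0 = of_real 0 + c" using val[of 0] by blast
  obtain x1 where x1: "\<And>c. f c x1 = of_real 1 + c" using val[of 1] by blast
  have "c = 0 \<and> d = 0" if e: "(\<lambda>x. c * f \<i> x + d * f (- \<i>) x) = (\<lambda>x. 0 * f \<i> x + 0 * f (- \<i>) x)" for c d
  proof -
    have "c * \<i> = d * \<i>" using fun_cong[OF e, of x0] by (simp add: x0)
    then have cd: "c = d" by simp
    have "c * (1 + \<i>) + d * (1 - \<i>) = 0" using fun_cong[OF e, of x1] by (simp add: x1)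
    then have "2 * c = 0" unfolding cd by (simp add: algebra_simps)
    then show ?thesis using cd by simp
  qed
  then show ?thesis unfolding independent_pair_def using f(2) r1 r2 by blast
qed

lemma not_independent_pair_parabolic:
  assumes pt: "pull_type a b" and ab: "norm b = a" "a > 0"
  shows "\<not> independent_pair X atlas"
proof
  have const: "\<exists>c. \<forall>x\<in>topspace X. f x = c" if f: "f \<in> \<A>" and k: "\<kappa> \<noteq> 0" "star_relation X atlas \<kappa> f" for f \<kappa>
  proof -
    obtain E where E: "E holomorphic_on UNIV" "lift X atlas f = pull a b E" using pull_typeE[OF pt f] .
    have d: "complex_of_real ((norm b)\<^sup>2 - a\<^sup>2) = 0" using ab by simp
    have "3 * star_sym 1 0 E E (of_real t) - 4 * star_sym (1/2) 0 E E (of_real t) = \<kappa> * E (of_real t)" if t: "t > 0" for t :: real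
    proof -
      obtain z where z: "z \<in> unit_disk" "mom a b (z, cnj z) = of_real t" using mom_parabolic_surj[OF ab t] by blast
      show ?thesis using bspec[OF k(2)[unfolded star_relation_pull[OF pt f E] d] z(1)] unfolding z(2) .
    qed
    then obtain c where c: "\<And>t. E t = c" using parabolic_relation_imp_const[OF E(1) k(1)] by blast
    have "f x = c" if x: "x \<in> topspace X" for x
      using fun_cong[OF E(2), of "chosen x"] chosen[OF x] c by (simp add: lift_eq pull_def)
    then show ?thesis by blast
  qed
  assume "independent_pair X atlas"
  then obtain f g where f: "f \<in> \<A>" "g \<in> \<A>" "star_relation X atlas (- 2 * \<i>) f" "star_relation X atlas (2 * \<i>) g"
    and ind: "\<And>c d. (\<lambda>x. c * f x + d * g x) = (\<lambda>x. 0 * f x + 0 * g x) \<Longrightarrow> c = 0 \<and> d = 0"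
    unfolding independent_pair_def by blast
  obtain c where c: "\<forall>x\<in>topspace X. f x = c" using const[OF f(1) _ f(3)] by auto
  obtain d where d: "\<forall>x\<in>topspace X. g x = d" using const[OF f(2) _ f(4)] by auto
  have fx: "f x = (if x \<in> topspace X then c else 0)" for x using c A_outside[OF f(1)] by simp
  have gx: "g x = (if x \<in> topspace X then d else 0)" for x using d A_outside[OF f(2)] by simp
  have "(\<lambda>x. d * f x + (- c) * g x) = (\<lambda>x. 0 * f x + 0 * g x)" by (auto simp: fx gx)
  from ind[OF this] have "d = 0" "c = 0" by simp_all
  \<comment> \<open>The relation \<open>d * f - c * g = 0\<close> is nontrivial unless both
    constants vanish; in that case \<open>f = 0\<close> is itself a dependence.\<close>
  then have "(\<lambda>x. 1 * f x + 0 * g x) = (\<lambda>x. 0 * f x + 0 * g x)" by (auto simp: fx gx)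
  from ind[OF this] show False by simp
qed

text \<open>A moment map constant on the disk would be constant on the bidisk, but on
  \<open>x = 0\<close> it is affine with slope \<open>cnj b\<close>.\<close>

lemma pull_type_not_constant:
  assumes pt: "pull_type a b"
  shows "\<not> A_constant X atlas"
proof
  assume const: "A_constant X atlas"
  have hol: "(\<lambda>t::complex. t) holomorphic_on UNIV" by (intro holomorphic_intros)
  then have "pull a b (\<lambda>t. t) \<in> invariants" using pt unfolding pull_type_def by blast
  note l = lift_descend[OF this]
  obtain c where c: "\<forall>x\<in>topspace X. descend (pull a b (\<lambda>t. t)) x = c" using const l(2) unfolding A_constant_def by blast
  have "mom a b (z, cnj z) = c" if "z \<in> unit_disk" for z
    using fun_cong[OF l(1), of z] c p_topspace[OF that] that by (simp add: lift_eq pull_def)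
  then have "mom a b (0, w) = c" if "w \<in> unit_disk" for w
    using antidiagonal_identity[OF holomorphic2_mom_bidisk holomorphic2_on_const[OF open_Times[OF open_unit_disk open_unit_disk]], of a b c 0 w] that
    by (simp add: unit_disk_def)
  from this[of 0] this[of "1/2"] have "cnj b * (1/2) = 0" by (simp add: mom_def unit_disk_def norm_divide)
  then show False using pt by (simp add: pull_type_def)
qed

lemma indicator_in_A: "(\<lambda>x. if x \<in> topspace X then 1 else 0) \<in> \<A>"
proof -
  have "pull 0 1 (\<lambda>t. 1) \<in> A_disk" by (rule pull_in_A_disk) (rule holomorphic_on_const)
  moreover have "lift X atlas (\<lambda>x. if x \<in> topspace X then 1 else 0) = pull 0 1 (\<lambda>t. 1)"
    using p_topspace by (auto simp: lift_def pull_def)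
  ultimately show ?thesis by (simp add: A_RS_def)
qed

text \<open>Constants are functions of any moment map, here \<open>mom 0 1\<close>, so the
  commutative case applies.\<close>

lemma constant_star_commutative:
  assumes "A_constant X atlas"
  shows "star_commutative X atlas"
proof (rule star_commutative_pull[of 0 1])
  show "invariants \<subseteq> {pull 0 1 E | E. E holomorphic_on UNIV}"
  proof
    fix F assume F: "F \<in> invariants"
    note l = lift_descend[OF F]
    obtain c where c: "\<forall>x\<in>topspace X. descend F x = c" using assms l(2) unfolding A_constant_def by blast
    have "F = pull 0 1 (\<lambda>t. c)"
    proof
      fix z show "F z = pull 0 1 (\<lambda>t. c) z"
        using fun_cong[OF l(1), of z] c p_topspace[of z] by (cases "z \<in> unit_disk") (simp_all add: lift_eq lift_outside pull_def)
    qed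
    then show "F \<in> {pull 0 1 E | E. E holomorphic_on UNIV}" using holomorphic_on_const by blast
  qed
qed

lemma translation_cover_pull_type:
  assumes m: "model W \<eta> \<delta>" and tc: "translation_cover W \<mu> t"
  obtains a b where "pull_type a b" "(norm b)\<^sup>2 = a\<^sup>2 + \<delta>" "\<delta> = 0 \<Longrightarrow> a > 0" "\<delta> = 0 \<Longrightarrow> norm b = a"
proof -
  have \<mu>: "\<mu> holomorphic_on unit_disk" "bij_betw \<mu> unit_disk W" using tc by (auto simp: translation_cover_def)
  obtain a b where ab: "b \<noteq> 0" "(norm b)\<^sup>2 = a\<^sup>2 + \<delta>" "\<delta> = 0 \<Longrightarrow> a > 0" "\<delta> = 0 \<Longrightarrow> norm b = a"
    "\<And>z. z \<in> unit_disk \<Longrightarrow> mom a b (z, cnj z) = of_real (\<eta> (Im (\<mu> z)))"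
    by (rule model_moment[OF m \<mu>]) (rule that; assumption)
  have "pull_type a b" unfolding pull_type_def using ab(1) translation_cover_invariants[OF m tc ab(1,5)] by blast
  then show ?thesis by (rule that[OF _ ab(2-4)])
qed

lemma A_constant_iff: "A_constant X atlas \<longleftrightarrow> (\<forall>f\<in>invariants. \<exists>c. \<forall>z\<in>unit_disk. f z = c)"
proof
  assume c: "A_constant X atlas"
  show "\<forall>f\<in>invariants. \<exists>c. \<forall>z\<in>unit_disk. f z = c"
  proof
    fix F assume F: "F \<in> invariants"
    note l = lift_descend[OF F]
    obtain c where "\<forall>x\<in>topspace X. descend F x = c" using c l(2) unfolding A_constant_def by blast
    then have "F z = c" if "z \<in> unit_disk" for z
      using fun_cong[OF l(1), of z] p_topspace[OF that] that by (simp add: lift_eq)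
    then show "\<exists>c. \<forall>z\<in>unit_disk. F z = c" by blast
  qed
next
  assume c: "\<forall>f\<in>invariants. \<exists>c. \<forall>z\<in>unit_disk. f z = c"
  show "A_constant X atlas" unfolding A_constant_def
  proof
    fix f assume f: "f \<in> \<A>"
    obtain c where c: "\<forall>z\<in>unit_disk. lift X atlas f z = c" using c lift_invariants[OF f] by blast
    have "f x = c" if "x \<in> topspace X" for x
      using chosen[OF that] c lift_eq[of "chosen x" f] by simp
    then show "\<exists>c. \<forall>x\<in>topspace X. f x = c" by blast
  qed
qed

text \<open>The third alternative comprises two types, one for each case of
  \<open>model\<close>.\<close>

lemma quadrichotomy:
  obtains "inj_on p unit_disk" | "A_constant X atlas"
  | W \<eta> \<delta> \<mu> t where "model W \<eta> \<delta>" "translation_cover W \<mu> t"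
proof -
  show ?thesis
  proof (cases "inj_on p unit_disk \<or> A_constant X atlas")
    case False
    then obtain f0 where f0: "f0 \<in> invariants" "\<not> (\<exists>c. \<forall>z\<in>unit_disk. f0 z = c)" unfolding A_constant_iff by blast
    show ?thesis
      by (rule translation_cover_exists[OF _ f0]) (use False in blast, rule that(3))
  qed (use that in blast)
qed

end

text \<open>The target is spanned by the image \<open>T u\<close> of the unit. It contains the
  indicator of the surface, a multiple of \<open>T u\<close>, so \<open>T u\<close> and everything
  else is constant.\<close>

lemma strongly_iso_constant:
  assumes iso: "strongly_iso X ax Y ay" and X: "hyp_surface X ax" and Y: "hyp_surface Y ay" and c: "A_constant X ax"
  shows "A_constant Y ay"
proof -
  interpret X: hyp_surface X ax by (rule X)
  interpret Y: hyp_surface Y ay by (rule Y)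
  obtain T where T: "bij_betw T (A_RS X ax) (A_RS Y ay)"
    and l: "\<And>f g a b. f \<in> A_RS X ax \<Longrightarrow> g \<in> A_RS X ax \<Longrightarrow> T (\<lambda>x. a * f x + b * g x) = (\<lambda>y. a * T f y + b * T g y)"
    by (rule strongly_isoE[OF iso]) (rule that; assumption)
  define u where "u = (\<lambda>x. if x \<in> topspace X then 1 else 0 :: complex)"
  have u: "u \<in> A_RS X ax" unfolding u_def by (rule X.indicator_in_A)
  have mult: "\<exists>c. \<forall>y. g y = c * T u y" if g: "g \<in> A_RS Y ay" for g
  proof -
    obtain f where f: "f \<in> A_RS X ax" "g = T f" using g bij_betw_imp_surj_on[OF T] by blast
    obtain c where "\<forall>x\<in>topspace X. f x = c" using c f(1) unfolding A_constant_def by blast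
    then have "f = (\<lambda>x. c * u x + 0 * u x)" using X.A_outside[OF f(1)] by (auto simp: u_def)
    then have "g = (\<lambda>y. c * T u y + 0 * T u y)" using l[OF u u] f(2) by metis
    then show ?thesis by (intro exI[of _ c]) simp
  qed
  obtain c0 where c0: "\<And>y. (if y \<in> topspace Y then 1 else 0) = c0 * T u y" using mult[OF Y.indicator_in_A] by blast
  have Tu: "T u y = 1 / c0" if "y \<in> topspace Y" for y
  proof -
    have "1 = c0 * T u y" using c0[of y] that by simp
    then show ?thesis by (metis mult_zero_left nonzero_mult_div_cancel_left zero_neq_one)
  qed
  show ?thesis unfolding A_constant_def
  proof
    fix g assume "g \<in> A_RS Y ay"
    then obtain c where "\<forall>y. g y = c * T u y" using mult by blast
    then have "\<forall>y\<in>topspace Y. g y = c * (1 / c0)" using Tu by simp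
    then show "\<exists>c. \<forall>y\<in>topspace Y. g y = c" by blast
  qed
qed

lemma strongly_iso_disk_type:
  assumes X: "hyp_surface X ax" and Y: "hyp_surface Y ay"
    and inj: "inj_on (ucov X ax) unit_disk" "inj_on (ucov Y ay) unit_disk"
  shows "strongly_iso X ax Y ay"
proof -
  interpret X: hyp_surface X ax by (rule X)
  interpret Y: hyp_surface Y ay by (rule Y)
  have iX: "X.invariants = A_disk" using inj(1) unfolding X.invariants_def inj_on_def by blast
  have iY: "Y.invariants = A_disk" using inj(2) unfolding Y.invariants_def inj_on_def by blast
  define \<Phi> where "\<Phi> = (\<lambda>F z. if z \<in> unit_disk then F z else 0 :: complex)"
  have \<Phi>id: "\<Phi> F = F" if "F \<in> A_disk" for F using that by (auto simp: \<Phi>_def A_disk_def)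
  have cont: "continuous_map (subtopology A_disk_topology A_disk) A_disk_topology \<Phi>"
    by (rule continuous_map_eq[of _ _ id])
       (auto simp: \<Phi>id topspace_A_disk_topology continuous_map_from_subtopology)
  show ?thesis
  proof (rule strongly_isoI[OF X Y, of "\<lambda>z. z" \<Phi> \<Phi>])
    show "\<Phi> = (\<lambda>F z. if z \<in> unit_disk then F z else 0)" by (rule \<Phi>_def)
    show "star_disk h (\<Phi> F) (\<Phi> G) z'' = star_disk h F G z'"
      if "F \<in> X.invariants" "G \<in> X.invariants" "z \<in> unit_disk" "z' \<in> unit_disk" "z'' \<in> unit_disk"
        "X.p z' = X.p z" "Y.p z'' = Y.p z" for h F G z z' z''
    proof -
      have "z' = z" "z'' = z" using that inj by (auto dest: inj_onD)
      then show ?thesis using that(1,2) \<Phi>id iX by simp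
    qed
  qed (simp_all add: iX iY \<Phi>id cont)
qed

text \<open>Equal \<open>\<delta>\<close> means equal ranges, the positive reals or all reals, so
  \<open>\<psi>\<close> with \<open>mom a b \<circ> \<psi> = mom a' b'\<close> on the antidiagonal
  can be chosen pointwise. Composition with it exchanges the moment maps and keeps \<open>E\<close>,
  and \<open>star_disk_pull\<close> gives the same \<open>star_sym\<close> on both sides for every
  \<open>h\<close>.\<close>

lemma strongly_iso_pull_type:
  assumes X: "hyp_surface X ax" and Y: "hyp_surface Y ay" and \<delta>: "\<delta> = 0 \<or> \<delta> = 1"
    and pX: "hyp_surface.pull_type X ax a b" "(norm b)\<^sup>2 = a\<^sup>2 + \<delta>" "\<delta> = 0 \<Longrightarrow> a > 0" "\<delta> = 0 \<Longrightarrow> norm b = a"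
    and pY: "hyp_surface.pull_type Y ay a' b'" "(norm b')\<^sup>2 = a'\<^sup>2 + \<delta>" "\<delta> = 0 \<Longrightarrow> a' > 0" "\<delta> = 0 \<Longrightarrow> norm b' = a'"
  shows "strongly_iso X ax Y ay"
proof -
  interpret X: hyp_surface X ax by (rule X)
  interpret Y: hyp_surface Y ay by (rule Y)
  have ex: "\<exists>z'. z' \<in> unit_disk \<and> mom a b (z', cnj z') = mom a' b' (z, cnj z)" if z: "z \<in> unit_disk"
    and b: "(norm b)\<^sup>2 = a\<^sup>2 + \<delta>" "\<delta> = 0 \<Longrightarrow> a > 0" "\<delta> = 0 \<Longrightarrow> norm b = a"
    and b': "\<delta> = 0 \<Longrightarrow> a' > 0" "\<delta> = 0 \<Longrightarrow> norm b' = a'" for z a b a' b'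
    using \<delta>
  proof
    assume d: "\<delta> = 0"
    obtain t where t: "t > 0" "mom a' b' (z, cnj z) = of_real t" using mom_parabolic_pos[OF b'(2,1)[OF d] z] .
    obtain z' where "z' \<in> unit_disk" "mom a b (z', cnj z') = of_real t" using mom_parabolic_surj[OF b(3,2)[OF d] t(1)] .
    then show ?thesis using t by auto
  next
    assume d: "\<delta> = 1"
    then have "(norm b)\<^sup>2 = a\<^sup>2 + 1" using b(1) by simp
    from mom_hyperbolic_surj[OF this] obtain z' where "z' \<in> unit_disk"
      "mom a b (z', cnj z') = of_real ((a' * (1 + (norm z)\<^sup>2) + 2 * Re (b' * z)) / (1 - (norm z)\<^sup>2))" .
    then show ?thesis using mom_eq_real[of a' b' z] by auto
  qed
  define \<psi> where "\<psi> z = (SOME z'. z' \<in> unit_disk \<and> mom a b (z', cnj z') = mom a' b' (z, cnj z))" for z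
  define \<psi>' where "\<psi>' z = (SOME z'. z' \<in> unit_disk \<and> mom a' b' (z', cnj z') = mom a b (z, cnj z))" for z
  have \<psi>: "\<psi> z \<in> unit_disk \<and> mom a b (\<psi> z, cnj (\<psi> z)) = mom a' b' (z, cnj z)" if "z \<in> unit_disk" for z
    unfolding \<psi>_def by (rule someI_ex[OF ex[OF that pX(2) pX(3) pX(4) pY(3) pY(4)]])
  have \<psi>': "\<psi>' z \<in> unit_disk \<and> mom a' b' (\<psi>' z, cnj (\<psi>' z)) = mom a b (z, cnj z)" if "z \<in> unit_disk" for z
    unfolding \<psi>'_def by (rule someI_ex[OF ex[OF that pY(2) pY(3) pY(4) pX(3) pX(4)]])
  define \<Phi> where "\<Phi> = (\<lambda>F z. if z \<in> unit_disk then F (\<psi> z) else 0 :: complex)"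
  define \<Phi>' where "\<Phi>' = (\<lambda>F z. if z \<in> unit_disk then F (\<psi>' z) else 0 :: complex)"
  have \<Phi>p: "\<Phi> (pull a b E) = pull a' b' E" for E using \<psi> by (auto simp: \<Phi>_def pull_def)
  have \<Phi>'p: "\<Phi>' (pull a' b' E) = pull a b E" for E using \<psi>' by (auto simp: \<Phi>'_def pull_def)
  have iX: "b \<noteq> 0" "X.invariants = {pull a b E | E. E holomorphic_on UNIV}" using pX(1) by (auto simp: X.pull_type_def)
  have iY: "b' \<noteq> 0" "Y.invariants = {pull a' b' E | E. E holomorphic_on UNIV}" using pY(1) by (auto simp: Y.pull_type_def)
  show ?thesis
  proof (rule strongly_isoI[OF X Y, of \<psi> \<Phi> \<Phi>'])
    show "\<Phi> = (\<lambda>F z. if z \<in> unit_disk then F (\<psi> z) else 0)" by (rule \<Phi>_def)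
    show "\<psi> z \<in> unit_disk" if "z \<in> unit_disk" for z using \<psi>[OF that] by blast
    show "\<Phi> F \<in> Y.invariants" if "F \<in> X.invariants" for F using that \<Phi>p unfolding iX iY by auto
    show "\<Phi>' F \<in> X.invariants" if "F \<in> Y.invariants" for F using that \<Phi>'p unfolding iX iY by auto
    show "\<Phi>' (\<Phi> F) = F" if "F \<in> X.invariants" for F using that \<Phi>p \<Phi>'p unfolding iX by auto
    show "\<Phi> (\<Phi>' F) = F" if "F \<in> Y.invariants" for F using that \<Phi>p \<Phi>'p unfolding iY by auto
    show "continuous_map (subtopology A_disk_topology X.invariants) A_disk_topology \<Phi>"
      unfolding iX(2) by (rule continuous_map_pull[OF iX(1) \<Phi>p])
    show "continuous_map (subtopology A_disk_topology Y.invariants) A_disk_topology \<Phi>'"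
      unfolding iY(2) by (rule continuous_map_pull[OF iY(1) \<Phi>'p])
    show "star_disk h (\<Phi> F) (\<Phi> G) z'' = star_disk h F G z'"
      if F: "F \<in> X.invariants" and G: "G \<in> X.invariants" and z: "z \<in> unit_disk" "z' \<in> unit_disk" "z'' \<in> unit_disk"
        "X.p z' = X.p (\<psi> z)" "Y.p z'' = Y.p z" for h F G z z' z''
    proof -
      obtain E1 where E1: "E1 holomorphic_on UNIV" "F = pull a b E1" using F unfolding iX by blast
      obtain E2 where E2: "E2 holomorphic_on UNIV" "G = pull a b E2" using G unfolding iX by blast
      have m1: "mom a b (z', cnj z') = mom a' b' (z, cnj z)"
        using X.pull_type_fibre[OF pX(1) z(2) _ z(4)] \<psi>[OF z(1)] by simp
      have m2: "mom a' b' (z'', cnj z'') = mom a' b' (z, cnj z)"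
        by (rule Y.pull_type_fibre[OF pY(1) z(3,1,5)])
      show ?thesis
        unfolding E1(2) E2(2) \<Phi>p star_disk_pull[OF E1(1) E2(1) z(2)] star_disk_pull[OF E1(1) E2(1) z(3)] m1 m2
        using pX(2) pY(2) by simp
    qed
  qed
qed

lemma independent_pair_transfer:
  assumes X: "hyp_surface X ax" and iso: "strongly_iso X ax Y ay" and pt: "hyp_surface.pull_type X ax a b"
  shows "independent_pair X ax \<longleftrightarrow> independent_pair Y ay"
proof -
  interpret X: hyp_surface X ax by (rule X)
  show ?thesis
    by (rule strongly_iso_independent_pair[OF iso])
       (use X.pull_type_star_closed[OF pt] X.pull_type_linear[OF pt] in blast)+
qed

section \<open>The model surfaces\<close>

lemma model_biholomorphic:
  assumes "model W \<eta> \<delta>"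
  obtains \<mu> where "\<mu> holomorphic_on unit_disk" "bij_betw \<mu> unit_disk W"
proof -
  define V where "V z = (1 + z) / (1 - z)" for z :: complex
  have bV: "bij_betw V unit_disk right_halfplane" using cayley_bij[of 1] by (simp add: V_def[abs_def])
  have hV: "V holomorphic_on unit_disk"
    unfolding V_def by (intro holomorphic_intros) (auto simp: unit_disk_def)
  have VR: "V z \<in> right_halfplane" if "z \<in> unit_disk" for z using bV that by (auto simp: bij_betw_def)
  from assms show ?thesis unfolding model_def
  proof (elim disjE conjE)
    assume W: "W = upper_halfplane"
    have "bij_betw (\<lambda>v. \<i> * v) right_halfplane upper_halfplane"
      by (rule bij_betw_byWitness[where f' = "\<lambda>v. - \<i> * v"]) (auto simp: upper_halfplane_def right_halfplane_def)
    from bij_betw_trans[OF bV this] show ?thesis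
      using W hV by (intro that[of "(\<lambda>v. \<i> * v) \<circ> V"]) (auto simp: o_def intro!: holomorphic_intros)
  next
    assume W: "W = strip"
    define k where "k = inv_into strip (\<lambda>\<zeta>. exp (2 * \<zeta>)) \<circ> V"
    have b: "bij_betw k unit_disk strip"
      unfolding k_def by (rule bij_betw_trans[OF bV bij_betw_inv_into[OF exp_strip_bij]])
    have e: "exp (2 * k z) = V z" if "z \<in> unit_disk" for z
      using f_inv_into_f[of "V z" "\<lambda>\<zeta>. exp (2 * \<zeta>)" strip] VR[OF that] bij_betw_imp_surj_on[OF exp_strip_bij] by (simp add: k_def)
    have "k z = Ln (V z) / 2" if z: "z \<in> unit_disk" for z
    proof -
      have "k z \<in> strip" using b z by (auto simp: bij_betw_def)
      then have "- pi < Im (2 * k z)" "Im (2 * k z) \<le> pi" by (auto simp: strip_def)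
      then have "Ln (exp (2 * k z)) = 2 * k z" by (rule Ln_exp)
      then show ?thesis using e[OF z] by simp
    qed
    moreover have "(\<lambda>z. Ln (V z) / 2) holomorphic_on unit_disk"
      using VR by (intro holomorphic_intros hV) (force simp: right_halfplane_def complex_nonpos_Reals_iff)+
    ultimately have "k holomorphic_on unit_disk" using holomorphic_transform[of "\<lambda>z. Ln (V z) / 2" unit_disk k] by simp
    then show ?thesis using b W by (intro that) auto
  qed
qed

lemma hyp_surface_model:
  assumes m: "model W \<eta> \<delta>" and S: "model_surface W t S"
  shows "hyp_surface (top_of_set S) (std_atlas S)"
proof
  note SD = model_surfaceD[OF S]
  obtain \<mu> where \<mu>: "\<mu> holomorphic_on unit_disk" "bij_betw \<mu> unit_disk W" using model_biholomorphic[OF m] .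
  have "W \<noteq> {}" using \<mu>(2) by (auto simp: bij_betw_def unit_disk_def)
  then have "S \<noteq> {}" "connected S"
    using SD(2) model_domain(2)[OF m]
      connected_continuous_image[OF holomorphic_on_imp_continuous_on[OF covering_exp_holomorphic] convex_connected] by blast+
  then have "riemann_surface (top_of_set S) (std_atlas S)" by (intro riemann_surface_std SD(4))
  moreover have "disk_universal_covering (top_of_set S) (std_atlas S) (covering_exp t \<circ> \<mu>)"
    by (rule disk_universal_covering_std[OF SD(4) model_domain(1)[OF m] model_domain(3)[OF m] \<mu> covering_exp_holomorphic SD(2,1) covering_exp_eq_iff[OF SD(1)]])
  ultimately show "hyperbolic_RS (top_of_set S) (std_atlas S)" unfolding hyperbolic_RS_def by blast
qed

lemma hyp_surface_disk: "hyp_surface (top_of_set unit_disk) (std_atlas unit_disk)"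
proof
  have "unit_disk \<noteq> {}" by (simp add: unit_disk_def)
  then show "hyperbolic_RS (top_of_set unit_disk) (std_atlas unit_disk)"
    unfolding hyperbolic_RS_def using riemann_surface_std[OF open_unit_disk connected_unit_disk] disk_universal_covering_id by blast
qed

lemma conf_equiv_pull_type:
  assumes X: "hyp_surface X ax" and m: "model W \<eta> \<delta>" and S: "model_surface W t S" and ce: "conf_equiv X ax S"
  obtains a b where "hyp_surface.pull_type X ax a b" "(norm b)\<^sup>2 = a\<^sup>2 + \<delta>" "\<delta> = 0 \<Longrightarrow> a > 0" "\<delta> = 0 \<Longrightarrow> norm b = a"
proof -
  interpret X: hyp_surface X ax by (rule X)
  obtain \<mu> where "X.translation_cover W \<mu> t" using X.conf_equiv_imp_translation_cover[OF m S ce] .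
  from X.translation_cover_pull_type[OF m this] show ?thesis using that .
qed

text \<open>The period solves \<open>exp (pi^2 / (2 * t)) = R\<close>.\<close>

lemma model_surface_annulus:
  assumes "R > 1"
  shows "model_surface strip (pi\<^sup>2 / (2 * ln R)) (annulus R)"
proof -
  have "ln R > 0" using assms by simp
  then have "pi\<^sup>2 / (2 * (pi\<^sup>2 / (2 * ln R))) = ln R" by (simp add: field_simps)
  then show ?thesis using assms \<open>ln R > 0\<close> by (simp add: model_surface_def)
qed

section \<open>The classification\<close>

lemma models: "model upper_halfplane (\<lambda>y. 1 / y) 0" "model strip (\<lambda>y. tan (2 * y)) 1"
  by (simp_all add: model_def)

theorem mainTheorem1:
  fixes X :: "'a topology" and atlas :: "('a set \<times> ('a \<Rightarrow> complex)) set"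
  assumes "hyperbolic_RS X atlas"
  shows "(conf_equiv X atlas unit_disk \<longleftrightarrow> strongly_iso_dom X atlas unit_disk)
    \<and> ((\<exists>R>1. conf_equiv X atlas (annulus R)) \<longleftrightarrow> (\<exists>R>1. strongly_iso_dom X atlas (annulus R)))
    \<and> ((\<exists>R>1. conf_equiv X atlas (annulus R)) \<longrightarrow> (\<forall>R>1. strongly_iso_dom X atlas (annulus R)))
    \<and> (conf_equiv X atlas punct_disk \<longleftrightarrow> strongly_iso_dom X atlas punct_disk)
    \<and> (\<not> conf_equiv X atlas unit_disk \<and> \<not> conf_equiv X atlas punct_disk
         \<and> (\<forall>R>1. \<not> conf_equiv X atlas (annulus R))
       \<longrightarrow> (\<forall>f \<in> A_RS X atlas. \<exists>c. \<forall>x \<in> topspace X. f x = c))"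
proof -
  have HX: "hyp_surface X atlas" using assms by (simp add: hyp_surface_def)
  interpret X: hyp_surface X atlas by (rule HX)
  interpret D: hyp_surface "top_of_set unit_disk" "std_atlas unit_disk" by (rule hyp_surface_disk)
  have Dinj: "inj_on D.p unit_disk" using D.conf_equiv_disk_iff conf_equiv_std[OF open_unit_disk] by blast
  \<comment> \<open>The period 1 is arbitrary here.\<close>
  have msP: "model_surface upper_halfplane 1 punct_disk" by (simp add: model_surface_def)
  have HP: "hyp_surface (top_of_set punct_disk) (std_atlas punct_disk)" by (rule hyp_surface_model[OF models(1) msP])
  interpret P: hyp_surface "top_of_set punct_disk" "std_atlas punct_disk" by (rule HP)
  obtain aP bP where P: "P.pull_type aP bP" "(norm bP)\<^sup>2 = aP\<^sup>2 + 0" "aP > 0" "norm bP = aP"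
    using conf_equiv_pull_type[OF HP models(1) msP conf_equiv_std[OF model_surfaceD(4)[OF msP]]] by auto
  have HA: "hyp_surface (top_of_set (annulus R)) (std_atlas (annulus R))" if "R > 1" for R
    by (rule hyp_surface_model[OF models(2) model_surface_annulus[OF that]])
  have A: "\<exists>a b. hyp_surface.pull_type (top_of_set (annulus R)) (std_atlas (annulus R)) a b \<and> (norm b)\<^sup>2 = a\<^sup>2 + 1" if "R > 1" for R
    by (rule conf_equiv_pull_type[OF HA[OF that] models(2) model_surface_annulus[OF that]
          conf_equiv_std[OF model_surfaceD(4)[OF model_surface_annulus[OF that]]]]) blast
  have typeA: "\<exists>a b. X.pull_type a b \<and> (norm b)\<^sup>2 = a\<^sup>2 + 1" if "R > 1" "conf_equiv X atlas (annulus R)" for R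
    by (rule conf_equiv_pull_type[OF HX models(2) model_surface_annulus[OF that(1)] that(2)]) blast
  have comm: "star_commutative Z az" if "hyp_surface Z az" "hyp_surface.pull_type Z az a b" for Z :: "complex topology" and az a b
  proof -
    interpret Z: hyp_surface Z az by (rule that(1))
    show ?thesis using Z.star_commutative_pull[of a b] that(2) by (simp add: Z.pull_type_def)
  qed
  have notconst: "\<not> A_constant Z az" if "hyp_surface Z az" "hyp_surface.pull_type Z az a b" for Z :: "complex topology" and az a b
    using hyp_surface.pull_type_not_constant[OF that] .
  have Dnc: "noncommuting_pair (top_of_set unit_disk) (std_atlas unit_disk)" by (rule D.noncommuting_pair_disk[OF Dinj])
  have Xnc: "noncommuting_pair X atlas" if "inj_on X.p unit_disk" by (rule X.noncommuting_pair_disk[OF that])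
  have tcA: "\<exists>R>1. conf_equiv X atlas (annulus R)" if "model strip \<eta> \<delta>" "X.translation_cover strip \<mu> t" for \<eta> \<delta> \<mu> t
  proof (intro exI[of _ "exp (pi\<^sup>2 / (2 * t))"] conjI)
    have t: "t > 0" using that(2) by (simp add: X.translation_cover_def)
    then show "exp (pi\<^sup>2 / (2 * t)) > 1" by simp
    show "conf_equiv X atlas (annulus (exp (pi\<^sup>2 / (2 * t))))"
      by (rule X.translation_cover_imp_conf_equiv[OF that]) (simp add: model_surface_def t)
  qed
  have tcP: "conf_equiv X atlas punct_disk" if "model upper_halfplane \<eta> \<delta>" "X.translation_cover upper_halfplane \<mu> t" for \<eta> \<delta> \<mu> t
  proof (rule X.translation_cover_imp_conf_equiv[OF that])
    show "model_surface upper_halfplane t punct_disk" using that(2) by (simp add: model_surface_def X.translation_cover_def)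
  qed
  \<comment> \<open>The alternatives of \<open>quadrichotomy\<close>, restated as conformal
    types.\<close>
  have cases: thesis
    if "conf_equiv X atlas unit_disk \<Longrightarrow> inj_on X.p unit_disk \<Longrightarrow> thesis"
      and "A_constant X atlas \<Longrightarrow> thesis"
      and "\<And>R. R > 1 \<Longrightarrow> conf_equiv X atlas (annulus R) \<Longrightarrow> thesis"
      and "conf_equiv X atlas punct_disk \<Longrightarrow> thesis" for thesis
  proof (rule X.quadrichotomy)
    assume "inj_on X.p unit_disk"
    then show thesis using that(1) X.conf_equiv_disk_iff by blast
  next
    fix W \<eta> \<delta> \<mu> t assume m: "model W \<eta> \<delta>" and tc: "X.translation_cover W \<mu> t"
    consider "W = upper_halfplane" | "W = strip" using m by (auto simp: model_def)
    then show thesis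
    proof cases
      case 1
      show thesis by (rule that(4)[OF tcP[OF m[unfolded 1] tc[unfolded 1]]])
    next
      case 2
      show thesis using tcA[OF m[unfolded 2] tc[unfolded 2]] that(3) by blast
    qed
  qed (rule that(2))
  have typeP: "\<exists>a b. X.pull_type a b \<and> (norm b)\<^sup>2 = a\<^sup>2 + 0 \<and> a > 0 \<and> norm b = a" if "conf_equiv X atlas punct_disk"
    by (rule conf_equiv_pull_type[OF HX models(1) msP that]) blast
  have Xcomm: "star_commutative X atlas" if "X.pull_type a b" for a b
    using X.star_commutative_pull[of a b] that by (simp add: X.pull_type_def)
  \<comment> \<open>Every type other than the disk has a commutative algebra, while that of the disk
    is not commutative.\<close>
  have disk: "conf_equiv X atlas unit_disk" if iso: "strongly_iso_dom X atlas unit_disk"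
  proof (rule ccontr)
    assume n: "\<not> conf_equiv X atlas unit_disk"
    have "star_commutative X atlas"
    proof (rule cases)
      show "star_commutative X atlas" if "A_constant X atlas" by (rule X.constant_star_commutative[OF that])
      show "star_commutative X atlas" if "R > 1" "conf_equiv X atlas (annulus R)" for R
        using typeA[OF that] Xcomm by blast
      show "star_commutative X atlas" if "conf_equiv X atlas punct_disk" using typeP[OF that] Xcomm by blast
    qed (use n in blast)
    from strongly_iso_commutative[OF iso this] Dnc show False
      unfolding star_commutative_def noncommuting_pair_def by blast
  qed
  have disk': "strongly_iso_dom X atlas unit_disk" if "conf_equiv X atlas unit_disk"
    using strongly_iso_disk_type[OF HX hyp_surface_disk _ Dinj] X.conf_equiv_disk_iff that by blast
  have ann': "strongly_iso_dom X atlas (annulus R')" if R: "R > 1" "conf_equiv X atlas (annulus R)" and R': "R' > 1" for R R'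
  proof -
    obtain a b where x: "X.pull_type a b" "(norm b)\<^sup>2 = a\<^sup>2 + 1" using typeA[OF R] by blast
    obtain a' b' where y: "hyp_surface.pull_type (top_of_set (annulus R')) (std_atlas (annulus R')) a' b'" "(norm b')\<^sup>2 = a'\<^sup>2 + 1"
      using A[OF R'] by blast
    show ?thesis
      by (rule strongly_iso_pull_type[where \<delta> = 1, OF HX HA[OF R'] _ x(1,2) _ _ y(1,2)]) simp_all
  qed
  \<comment> \<open>Each remaining type fails on one invariant: the disk has a noncommuting pair, a
    surface with constants only has too small an algebra, and the punctured disk has no independent
    pair.\<close>
  have ann: "\<exists>R>1. conf_equiv X atlas (annulus R)" if R: "R > 1" and iso: "strongly_iso_dom X atlas (annulus R)" for R
  proof (rule ccontr)
    assume n: "\<not> (\<exists>R>1. conf_equiv X atlas (annulus R))"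
    obtain a b where y: "hyp_surface.pull_type (top_of_set (annulus R)) (std_atlas (annulus R)) a b" "(norm b)\<^sup>2 = a\<^sup>2 + 1"
      using A[OF R] by blast
    show False
    proof (rule cases)
      assume "inj_on X.p unit_disk"
      then show False using strongly_iso_noncommuting[OF iso Xnc comm[OF HA[OF R] y(1)]] by blast
    next
      assume "A_constant X atlas"
      then show False using strongly_iso_constant[OF iso HX HA[OF R]] notconst[OF HA[OF R] y(1)] by blast
    next
      assume "conf_equiv X atlas punct_disk"
      then obtain c d where x: "X.pull_type c d" "c > 0" "norm d = c" using typeP by blast
      show False
        using X.not_independent_pair_parabolic[OF x(1,3,2)] independent_pair_transfer[OF HX iso x(1)]
          hyp_surface.independent_pair_hyperbolic[OF HA[OF R] y] by blast
    qed (use n in blast)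
  qed
  have punct': "strongly_iso_dom X atlas punct_disk" if ce: "conf_equiv X atlas punct_disk"
  proof -
    obtain a b where x: "X.pull_type a b" "(norm b)\<^sup>2 = a\<^sup>2 + 0" "a > 0" "norm b = a" using typeP[OF ce] by blast
    show ?thesis
      by (rule strongly_iso_pull_type[where \<delta> = 0, OF HX HP _ x(1,2) _ _ P(1,2)]) (simp_all add: x P)
  qed
  have punct: "conf_equiv X atlas punct_disk" if iso: "strongly_iso_dom X atlas punct_disk"
  proof (rule ccontr)
    assume n: "\<not> conf_equiv X atlas punct_disk"
    show False
    proof (rule cases)
      assume "inj_on X.p unit_disk"
      then show False using strongly_iso_noncommuting[OF iso Xnc comm[OF HP P(1)]] by blast
    next
      assume "A_constant X atlas"
      then show False using strongly_iso_constant[OF iso HX HP] notconst[OF HP P(1)] by blast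
    next
      fix R :: real assume "R > 1" "conf_equiv X atlas (annulus R)"
      then obtain c d where x: "X.pull_type c d" "(norm d)\<^sup>2 = c\<^sup>2 + 1" using typeA by blast
      show False
        using X.independent_pair_hyperbolic[OF x] independent_pair_transfer[OF HX iso x(1)]
          P.not_independent_pair_parabolic[OF P(1,4,3)] by blast
    qed (use n in blast)
  qed
  have const: "\<forall>f \<in> A_RS X atlas. \<exists>c. \<forall>x \<in> topspace X. f x = c"
    if "\<not> conf_equiv X atlas unit_disk" "\<not> conf_equiv X atlas punct_disk" "\<forall>R>1. \<not> conf_equiv X atlas (annulus R)"
  proof -
    have "A_constant X atlas" by (rule cases) (use that in blast)+
    then show ?thesis by (simp add: A_constant_def)
  qed
  show ?thesis
    by (intro conjI iffI impI allI; (elim exE conjE)?) (use disk disk' ann ann' punct punct' const in blast)+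
qed

end
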